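(* Let $\alpha,\beta,\gamma$ be nonzero real constants with $\kappa:=-\frac{\alpha\gamma}{2\beta}>0$, and let $B>0$. Let $0<s_1=\frac12-<\frac12<s_2=1-<1$ with $s_2<2s_1$ (that is, $s_1<\frac12$ sufficiently close to $\frac12$, $s_2<1$ sufficiently close to $1$, and $s_2<2s_1$). Then there are a constant $c>0$ and $K_0>0$, independent of $N$, such that for all $K\ge K_0$ and all $N\in\mathbb{N}$, $$\mu_N\big(\Omega_{N,B}\setminus\Omega_{N,B}(s_1,s_2,K)\big)\le e^{-cK^2}\qquad\text{and}\qquad \mu\big(\Omega_B\setminus\Omega_B(s_1,s_2,K)\big)\le e^{-cK^2}.$$
   Context: Write $\phi=\sum_{n\in\mathbb{Z}}a_ne^{inx}$ (complex-valued) and $\psi=\sum_{n\in\mathbb{Z}}b_ne^{inx}$ (real-valued, so $b_{-n}=\overline{b_n}$) for functions on $\mathbb{T}=[0,2\pi)$; $\mathbb{P}_N$ is the projection onto frequencies $|n|\le N$. Integrals over $\mathbb{T}$ are normalized by $\frac1{2\pi}$; $\int\psi|\phi|^2dx$ is understood as the pairing $\sum_n\widehat{\psi}(-n)\widehat{|\phi|^2}(n)$. $\Omega_{N,B}=\{(a_n,b_n)_{|n|\le N}:\ \|(a_n)\|_{\ell^2}\le B,\ |b_0|\le B\}$, $\Omega_B=\{(a_n,b_n)_{n\in\mathbb{Z}}:\ \|(a_n)\|_{\ell^2}\le B,\ |b_0|\le B\}$. With $\langle n\rangle=1+|n|$, let $\|\phi\|_{H^{r_1,r_2}}=\|\phi\|_{H^{r_1}}+\sup_n\langle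 n\rangle^{r_2}|\widehat\phi(n)|$ and $\mathrm{H}^{s_1,s_2}=H^{s_1,s_2}\times H^{s_1-\frac12,s_2-\frac12}$. Then $$\Omega_{N,B}(s_1,s_2,K)=\Big\{(a_n,b_n)_{|n|\le N}\in\Omega_{N,B}:\ \Big\|\sum_{|n|\le N}(a_n,b_n)e^{inx}\Big\|_{\mathrm{H}^{s_1,s_2}}\le K\Big\},$$ and $\Omega_B(s_1,s_2,K)$ is defined in the same way with $\Omega_B$ and the sum over all $n\in\mathbb{Z}$. $\rho_N$ is the probability measure on $(a_n,b_n)_{0<|n|\le N}$ with $$d\rho_N=\widetilde Z_N^{-1}e^{-\frac12\sum_{0<|n|\le N}(n^2|a_n|^2+\kappa|n||b_n|^2)}\prod_{0<|n|\le N}d(a_n\otimes b_n),$$ and $\rho$ is the Gaussian probability measure on $(a_n,b_n)_{n\ne0}$ given formally by the same expression over all $n\ne0$; i.e. $a_n$ ($n\neq0$) and $b_n$ ($n\ge1$) are independent centered complex Gaussians with independent real and imaginary parts of variance $\frac1{n^2}$ for $a_n$ and $\frac1{2\kappa n}$ for $b_n$, and $b_{-n}=\overline{b_n}$. With $d(a_0,b_0)$ Lebesgue measure on $\mathbb{C}\times\mathbb{R}$, the probability measures $\mu_N$ and $\mu$ are $$d\mu_N=Z_N^{-1}\exp\Big(-\frac\alpha2\int\mathbb{P}_N\psi\,|\mathbb{P}_N\phi|^2dx\Big)\chi_{\Omega_{N,B}}\,d(a_0,b_0)\otimes d\rho_N,$$ $$d\mu=Z^{-1}\exp\Big(-\frac\alpha2\int\psi\,|\phi|^2dx\Big)\chi_{\Omega_B}\,d(a_0,b_0)\otimes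 d\rho,$$ where $Z_N$, $Z$ are the (finite, positive) normalizing constants. *)

theory Defs
  imports "HOL-Probability.Probability"
begin

section \<open>Fourier side\<close>

text \<open>
  A pair \<open>(a, b)\<close> stands for the functions \<open>\<phi> = \<Sum>n. a\<^sub>n e\<^sup>i\<^sup>n\<^sup>x\<close> and \<open>\<psi> = \<Sum>n. b\<^sub>n e\<^sup>i\<^sup>n\<^sup>x\<close> on the torus.
  Families indexed by finitely many frequencies, such as \<open>|n| \<le> N\<close> or \<open>n \<noteq> 0\<close>, are identified
  with sequences on all integers that vanish at the remaining frequencies.
\<close>

type_synonym modes = "(int \<Rightarrow> complex) \<times> (int \<Rightarrow> complex)"

definition modes_space :: "modes measure" where
  "modes_space = (\<Pi>\<^sub>M n\<in>UNIV. borel) \<Otimes>\<^sub>M (\<Pi>\<^sub>M n\<in>UNIV. borel)"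

definition freqs :: "nat \<Rightarrow> int set" where
  "freqs N = {n. \<bar>n\<bar> \<le> int N}"

definition real_valued :: "(int \<Rightarrow> complex) \<Rightarrow> bool" where
  "real_valued b \<longleftrightarrow> (\<forall>n. b (- n) = cnj (b n))"

text \<open>The function \<open>P\<^sub>N f\<close>, where \<open>u\<close> is the sequence of Fourier coefficients of \<open>f\<close>.\<close>

definition partial_fourier :: "nat \<Rightarrow> (int \<Rightarrow> complex) \<Rightarrow> real \<Rightarrow> complex" where
  "partial_fourier N u x = (\<Sum>n\<in>freqs N. u n * cis (of_int n * x))"

definition torus_integral :: "(real \<Rightarrow> complex) \<Rightarrow> complex" where
  "torus_integral f = (LINT x:{0..<2*pi}|lborel. f x) / of_real (2*pi)"

definition fourier_coeff :: "(real \<Rightarrow> complex) \<Rightarrow> int \<Rightarrow> complex" where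
  "fourier_coeff f n = torus_integral (\<lambda>x. f x * cis (- (of_int n * x)))"

text \<open>
  The Fourier coefficients of \<open>|\<phi>|\<^sup>2\<close>. If \<open>a\<close> is square summable, then \<open>P\<^sub>M \<phi>\<close> converges to \<open>\<phi>\<close> in
  \<open>L\<^sup>2\<close>, so \<open>|P\<^sub>M \<phi>|\<^sup>2\<close> converges to \<open>|\<phi>|\<^sup>2\<close> in \<open>L\<^sup>1\<close> and the limit below exists.
\<close>

definition abs_sq_coeff :: "(int \<Rightarrow> complex) \<Rightarrow> int \<Rightarrow> complex" where
  "abs_sq_coeff a n =
     lim (\<lambda>M. fourier_coeff (\<lambda>x. of_real ((cmod (partial_fourier M a x))\<^sup>2)) n)"

text \<open>
  The integrals of \<open>P\<^sub>N \<psi> |P\<^sub>N \<phi>|\<^sup>2\<close> and of \<open>\<psi> |\<phi>|\<^sup>2\<close>. Both are real when \<open>\<psi>\<close> is real-valued, and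
  \<open>Re\<close> only changes the type. Under the Gaussian measure below, the series in the second one
  converges absolutely for almost all \<open>(a, b)\<close>.
\<close>

definition interaction_N :: "nat \<Rightarrow> modes \<Rightarrow> real" where
  "interaction_N N = (\<lambda>(a, b). Re (torus_integral
     (\<lambda>x. partial_fourier N b x * of_real ((cmod (partial_fourier N a x))\<^sup>2))))"

definition interaction :: "modes \<Rightarrow> real" where
  "interaction = (\<lambda>(a, b). Re (\<Sum>\<^sub>\<infinity>n\<in>UNIV. b (- n) * abs_sq_coeff a n))"


section \<open>Function spaces and the sets \<open>\<Omega>\<close>\<close>

definition jbracket :: "int \<Rightarrow> real" where
  "jbracket n = 1 + \<bar>of_int n\<bar>"

text \<open>
  Norms are real-valued and carry no information outside the space, hence the separate
  membership predicates.
\<close>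

definition in_sobolev :: "real \<Rightarrow> (int \<Rightarrow> complex) \<Rightarrow> bool" where
  "in_sobolev r u \<longleftrightarrow> (\<lambda>n. jbracket n powr (2 * r) * (cmod (u n))\<^sup>2) summable_on UNIV"

definition sobolev_norm :: "real \<Rightarrow> (int \<Rightarrow> complex) \<Rightarrow> real" where
  "sobolev_norm r u = sqrt (\<Sum>\<^sub>\<infinity>n\<in>UNIV. jbracket n powr (2 * r) * (cmod (u n))\<^sup>2)"

definition in_H :: "real \<Rightarrow> real \<Rightarrow> (int \<Rightarrow> complex) \<Rightarrow> bool" where
  "in_H r1 r2 u \<longleftrightarrow>
     in_sobolev r1 u \<and> bdd_above (range (\<lambda>n. jbracket n powr r2 * cmod (u n)))"

definition H_norm :: "real \<Rightarrow> real \<Rightarrow> (int \<Rightarrow> complex) \<Rightarrow> real" where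
  "H_norm r1 r2 u = sobolev_norm r1 u + (SUP n. jbracket n powr r2 * cmod (u n))"

definition in_HH :: "real \<Rightarrow> real \<Rightarrow> modes \<Rightarrow> bool" where
  "in_HH s1 s2 = (\<lambda>(a, b). in_H s1 s2 a \<and> in_H (s1 - 1/2) (s2 - 1/2) b)"

definition HH_norm :: "real \<Rightarrow> real \<Rightarrow> modes \<Rightarrow> real" where
  "HH_norm s1 s2 = (\<lambda>(a, b). H_norm s1 s2 a + H_norm (s1 - 1/2) (s2 - 1/2) b)"

definition Omega :: "real \<Rightarrow> modes set" where
  "Omega B = {(a, b). real_valued b \<and> (\<lambda>n. (cmod (a n))\<^sup>2) summable_on UNIV \<and>
     sqrt (\<Sum>\<^sub>\<infinity>n\<in>UNIV. (cmod (a n))\<^sup>2) \<le> B \<and> cmod (b 0) \<le> B}"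

definition Omega_N :: "nat \<Rightarrow> real \<Rightarrow> modes set" where
  "Omega_N N B = {(a, b). real_valued b \<and> (\<forall>n. n \<notin> freqs N \<longrightarrow> a n = 0 \<and> b n = 0) \<and>
     sqrt (\<Sum>n\<in>freqs N. (cmod (a n))\<^sup>2) \<le> B \<and> cmod (b 0) \<le> B}"

definition Omega_ball :: "real \<Rightarrow> real \<Rightarrow> real \<Rightarrow> real \<Rightarrow> modes set" where
  "Omega_ball B s1 s2 K = {p \<in> Omega B. in_HH s1 s2 p \<and> HH_norm s1 s2 p \<le> K}"

definition Omega_N_ball :: "nat \<Rightarrow> real \<Rightarrow> real \<Rightarrow> real \<Rightarrow> real \<Rightarrow> modes set" where
  "Omega_N_ball N B s1 s2 K = {p \<in> Omega_N N B. in_HH s1 s2 p \<and> HH_norm s1 s2 p \<le> K}"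


section \<open>The measures\<close>

definition normalized :: "'a measure \<Rightarrow> 'a measure" where
  "normalized M = scale_measure (inverse (emeasure M (space M))) M"

text \<open>
  Since \<open>b\<^sub>-\<^sub>n\<close> is the conjugate of \<open>b\<^sub>n\<close>, the independent coordinates are \<open>a\<^sub>n\<close> for \<open>n \<in> F - {0}\<close> and
  \<open>b\<^sub>n\<close> for \<open>n \<in> F\<close> with \<open>n \<ge> 1\<close>. The map below recovers \<open>(a\<^sub>n, b\<^sub>n)\<close> for \<open>n \<in> F - {0}\<close> from them;
  \<open>F\<close> is symmetric.
\<close>

definition from_coords :: "int set \<Rightarrow> modes \<Rightarrow> modes" where
  "from_coords F = (\<lambda>(a, b).
     ((\<lambda>n. if n \<in> F - {0} then a n else 0),
      (\<lambda>n. if n \<notin> F then 0 else if n \<ge> 1 then b n else if n \<le> -1 then cnj (b (- n)) else 0)))"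

definition lebesgue_modes :: "nat \<Rightarrow> modes measure" where
  "lebesgue_modes N = distr
     ((\<Pi>\<^sub>M n\<in>freqs N - {0}. lborel) \<Otimes>\<^sub>M (\<Pi>\<^sub>M n\<in>{n\<in>freqs N. n \<ge> 1}. lborel))
     modes_space (from_coords (freqs N))"

definition rho_N :: "real \<Rightarrow> nat \<Rightarrow> modes measure" where
  "rho_N \<kappa> N = normalized (density (lebesgue_modes N) (\<lambda>(a, b).
     ennreal (exp (- (1/2) * (\<Sum>n\<in>freqs N - {0}.
       (of_int n)\<^sup>2 * (cmod (a n))\<^sup>2 + \<kappa> * \<bar>of_int n\<bar> * (cmod (b n))\<^sup>2)))))"

text \<open>Complex Gaussian with independent real and imaginary parts, each of variance \<open>v\<close>.\<close>

definition complex_gaussian :: "real \<Rightarrow> complex measure" where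
  "complex_gaussian v = density lborel (\<lambda>z.
     ennreal (normal_density 0 (sqrt v) (Re z) * normal_density 0 (sqrt v) (Im z)))"

definition rho :: "real \<Rightarrow> modes measure" where
  "rho \<kappa> = distr
     ((\<Pi>\<^sub>M n\<in>UNIV - {0}. complex_gaussian (1 / (of_int n)\<^sup>2)) \<Otimes>\<^sub>M
      (\<Pi>\<^sub>M n\<in>{1..}. complex_gaussian (1 / (2 * \<kappa> * of_int n))))
     modes_space (from_coords UNIV)"

text \<open>The product of Lebesgue measure \<open>d(a\<^sub>0, b\<^sub>0)\<close> with a measure on the nonzero modes.\<close>

definition with_zero_mode :: "modes measure \<Rightarrow> modes measure" where
  "with_zero_mode R = distr ((lborel :: (complex \<times> real) measure) \<Otimes>\<^sub>M R) modes_space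
     (\<lambda>((a0, b0), (a, b)). (a(0 := a0), b(0 := complex_of_real b0)))"

definition mu_N :: "real \<Rightarrow> real \<Rightarrow> real \<Rightarrow> nat \<Rightarrow> modes measure" where
  "mu_N \<alpha> \<kappa> B N = normalized (density (with_zero_mode (rho_N \<kappa> N))
     (\<lambda>p. ennreal (exp (- (\<alpha> / 2) * interaction_N N p)) * indicator (Omega_N N B) p))"

definition mu :: "real \<Rightarrow> real \<Rightarrow> real \<Rightarrow> modes measure" where
  "mu \<alpha> \<kappa> B = normalized (density (with_zero_mode (rho \<kappa>))
     (\<lambda>p. ennreal (exp (- (\<alpha> / 2) * interaction p)) * indicator (Omega B) p))"

end

theory Submission
  imports Defs "HOL-Real_Asymp.Real_Asymp"
begin

text \<open>
  Given \<open>a\<close>, the interaction is linear in the Gaussian variable \<open>b\<close>, so integrating out \<open>b\<close> turns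
  the Gibbs weight into \<open>exp (C * (\<Sum>n\<ge>1. |q\<^sub>n|\<^sup>2 / n))\<close>, where \<open>q\<^sub>n\<close> are the Fourier coefficients of
  \<open>|\<phi>|\<^sup>2\<close>. The cutoff \<open>\<parallel>a\<parallel> \<le> B\<close> gives \<open>|q\<^sub>n| \<le> B\<^sup>2\<close> and
  \<open>|n|\<^bsup>1/4\<^esup> |q\<^sub>n| \<le> 2 B \<parallel>\<phi>\<parallel>\<close> with the \<open>H\<^bsup>1/4\<^esup>\<close> norm of \<open>\<phi>\<close>; splitting the sum at a large frequency
  bounds it by \<open>C\<^sub>\<epsilon> + \<epsilon> \<parallel>\<phi>\<parallel>\<^sup>2\<close>, which is exponentially integrable for small \<open>\<epsilon>\<close>. The same formula
  bounds the partition functions from below, as the \<open>b\<close>-integral of a centred exponential is at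
  least \<open>1\<close> and \<open>\<parallel>a\<parallel>\<close> is small with positive probability.

  Since \<open>s\<^sub>1 + 1/2 < 1\<close>, both parts of the norms are controlled by the weighted supremum norms with
  an exponent \<open>r < 1\<close>, whose Gaussian tails follow from a union bound over the frequencies. The
  inequality \<open>w \<le> t + w\<^sup>2 / t\<close> for the weight \<open>w\<close> separates the tail from the Gibbs weight.
\<close>

section \<open>Gaussian integrals\<close>

text \<open>After \<open>b\<close> is integrated out, the exponent is quartic in \<open>a\<close>,
  which Gaussian exponential moments do not cover in general. The cutoff alone gives
  \<open>|q_n| \<le> B^2\<close> and leaves a harmonic sum, divergent logarithmically and hence not
  uniform in the truncation. A little smoothness of \<open>\<phi>\<close> removes the logarithm. The
  exponent \<open>1/4\<close> meets both demands: the gain \<open>n^(-1/2)\<close> in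
  \<open>|q_n|^2\<close> makes the sum of \<open>1 / (n * sqrt n)\<close> converge, and the
  quadratic form that pays for it has the summable expectations \<open>sqrt n / n^2\<close>.
  Uniformity in \<open>N\<close> comes from treating the truncated and the full Gaussian laws as one
  family \<open>gauss_law \<kappa> F\<close>, indexed by a symmetric set \<open>F\<close> of
  frequencies, with constants fixed before \<open>F\<close>. The interaction of the full measure is
  an iterated limit; its exponential moment is inherited from finite pairings by Fatou's lemma, used
  once for the truncation of \<open>\<phi>\<close> and once for that of \<open>\<psi>\<close>.
  Separating tail and weight squares the weight, so moments are needed with the coupling
  \<open>\<alpha>\<close>, although the measures carry \<open>\<alpha> / 2\<close>.\<close>

lemma nn_integral_normal_density:
  "0 < \<sigma> \<Longrightarrow> (\<integral>\<^sup>+x. ennreal (normal_density \<mu> \<sigma> x) \<partial>lborel) = 1"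
  by (subst nn_integral_eq_integral) auto

text \<open>The factor only changes the precision, from \<open>1 / \<sigma>\<^sup>2\<close> to
  \<open>1 / \<sigma>\<^sup>2 - 2 * t\<close>, so the integrand is a multiple of another centred
  Gaussian density; the second hypothesis says that the new precision is positive. Negative
  \<open>t\<close> gives Laplace transforms.\<close>

lemma nn_integral_normal_density_exp_square:
  assumes "0 < \<sigma>" "2 * t * \<sigma>\<^sup>2 < 1"
  shows "(\<integral>\<^sup>+x. ennreal (normal_density 0 \<sigma> x * exp (t * x\<^sup>2)) \<partial>lborel)
    = ennreal (1 / sqrt (1 - 2 * t * \<sigma>\<^sup>2))"
proof -
  define D where "D = 1 - 2 * t * \<sigma>\<^sup>2"
  have D: "D > 0" using assms by (simp add: D_def)
  define \<tau> where "\<tau> = \<sigma> / sqrt D"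
  have \<tau>: "\<tau> > 0" "\<tau>\<^sup>2 = \<sigma>\<^sup>2 / D" using assms D by (auto simp: \<tau>_def power_divide)
  have "normal_density 0 \<sigma> x * exp (t * x\<^sup>2) = 1 / sqrt D * normal_density 0 \<tau> x" for x
  proof -
    have "- x\<^sup>2 / (2 * \<sigma>\<^sup>2) + t * x\<^sup>2 = - x\<^sup>2 / (2 * \<tau>\<^sup>2)"
      unfolding \<tau> using assms D by (simp add: field_simps) (simp add: D_def algebra_simps)
    moreover have "sqrt (2 * pi * \<sigma>\<^sup>2) = sqrt D * sqrt (2 * pi * \<tau>\<^sup>2)"
      unfolding \<tau> using D by (simp flip: real_sqrt_mult)
    ultimately show ?thesis
      using D by (simp add: normal_density_def flip: exp_add)
  qed
  then have "(\<integral>\<^sup>+x. ennreal (normal_density 0 \<sigma> x * exp (t * x\<^sup>2)) \<partial>lborel)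
      = (\<integral>\<^sup>+x. ennreal (1 / sqrt D) * ennreal (normal_density 0 \<tau> x) \<partial>lborel)"
    using D by (simp flip: ennreal_mult)
  also have "\<dots> = ennreal (1 / sqrt D)"
    using \<tau> by (simp add: nn_integral_cmult nn_integral_normal_density)
  finally show ?thesis by (simp add: D_def)
qed

text \<open>Completing the square moves the mean to \<open>\<sigma>\<^sup>2 * u\<close> and leaves
  the constant on the right.\<close>

lemma nn_integral_normal_density_exp_linear:
  assumes "0 < \<sigma>"
  shows "(\<integral>\<^sup>+x. ennreal (normal_density 0 \<sigma> x * exp (u * x)) \<partial>lborel)
    = ennreal (exp (\<sigma>\<^sup>2 * u\<^sup>2 / 2))"
proof -
  have "normal_density 0 \<sigma> x * exp (u * x)
      = exp (\<sigma>\<^sup>2 * u\<^sup>2 / 2) * normal_density (\<sigma>\<^sup>2 * u) \<sigma> x" for x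
  proof -
    have "- x\<^sup>2 / (2 * \<sigma>\<^sup>2) + u * x = \<sigma>\<^sup>2 * u\<^sup>2 / 2 + - (x - \<sigma>\<^sup>2 * u)\<^sup>2 / (2 * \<sigma>\<^sup>2)"
      using assms by (simp add: field_simps power2_eq_square)
    then show ?thesis
      by (simp add: normal_density_def mult.assoc flip: exp_add) 
  qed
  then have "(\<integral>\<^sup>+x. ennreal (normal_density 0 \<sigma> x * exp (u * x)) \<partial>lborel)
      = (\<integral>\<^sup>+x. ennreal (exp (\<sigma>\<^sup>2 * u\<^sup>2 / 2)) * ennreal (normal_density (\<sigma>\<^sup>2 * u) \<sigma> x) \<partial>lborel)"
    by (simp flip: ennreal_mult)
  also have "\<dots> = ennreal (exp (\<sigma>\<^sup>2 * u\<^sup>2 / 2))"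
    using assms by (simp add: nn_integral_cmult nn_integral_normal_density)
  finally show ?thesis .
qed

lemma sets_complex_gaussian [simp, measurable_cong]: "sets (complex_gaussian v) = sets borel"
  by (simp add: complex_gaussian_def)

lemma space_complex_gaussian [simp]: "space (complex_gaussian v) = UNIV"
  by (simp add: complex_gaussian_def)

lemma nn_integral_complex_gaussian_mult:
  assumes f: "f \<in> borel_measurable borel" "\<And>x. 0 \<le> f x"
    and g: "g \<in> borel_measurable borel" "\<And>x. 0 \<le> g x"
  shows "(\<integral>\<^sup>+z. ennreal (f (Re z) * g (Im z)) \<partial>complex_gaussian v)
    = (\<integral>\<^sup>+x. ennreal (normal_density 0 (sqrt v) x * f x) \<partial>lborel) *
      (\<integral>\<^sup>+x. ennreal (normal_density 0 (sqrt v) x * g x) \<partial>lborel)"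
proof -
  note [measurable] = f(1) g(1)
  \<comment> \<open>Tonelli for \<open>lborel\<close> is a product over \<open>Basis\<close>, here
    \<open>{1, \<i>}\<close>; \<open>h\<close> turns the two factors into one family indexed by the
    basis vectors.\<close>
  define h where "h b x = (if b = (1::complex) then ennreal (normal_density 0 (sqrt v) x * f x)
     else ennreal (normal_density 0 (sqrt v) x * g x))" for b x
  have [measurable]: "h b \<in> borel_measurable borel" for b unfolding h_def by measurable
  have neq: "\<i> \<noteq> (1::complex)" "(1::complex) \<noteq> \<i>" by (auto simp: complex_eq_iff)
  have "(\<integral>\<^sup>+z. ennreal (f (Re z) * g (Im z)) \<partial>complex_gaussian v)
    = (\<integral>\<^sup>+z. ennreal (normal_density 0 (sqrt v) (Re z) * normal_density 0 (sqrt v) (Im z))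
         * ennreal (f (Re z) * g (Im z)) \<partial>lborel)"
    unfolding complex_gaussian_def by (subst nn_integral_density) auto
  also have "\<dots> = (\<integral>\<^sup>+z. (\<Prod>b\<in>Basis. h b (z \<bullet> b)) \<partial>(lborel::complex measure))"
    using f g neq by (intro nn_integral_cong)
      (simp add: Basis_complex_def h_def mult_ac flip: ennreal_mult)
  also have "\<dots> = (\<Prod>b\<in>(Basis::complex set). \<integral>\<^sup>+x. h b x \<partial>lborel)"
    by (rule nn_integral_lborel_prod) auto
  also have "\<dots> = (\<integral>\<^sup>+x. ennreal (normal_density 0 (sqrt v) x * f x) \<partial>lborel) *
      (\<integral>\<^sup>+x. ennreal (normal_density 0 (sqrt v) x * g x) \<partial>lborel)"
    using neq by (simp add: Basis_complex_def h_def)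
  finally show ?thesis .
qed

lemma complex_gaussian_exp_norm_square:
  assumes "0 < v" "2 * t * v < 1"
  shows "(\<integral>\<^sup>+z. ennreal (exp (t * (cmod z)\<^sup>2)) \<partial>complex_gaussian v) = ennreal (1 / (1 - 2 * t * v))"
proof -
  have "(\<integral>\<^sup>+z. ennreal (exp (t * (cmod z)\<^sup>2)) \<partial>complex_gaussian v)
      = (\<integral>\<^sup>+z. ennreal (exp (t * (Re z)\<^sup>2) * exp (t * (Im z)\<^sup>2)) \<partial>complex_gaussian v)"
    by (simp add: cmod_power2 distrib_left exp_add)
  also have "\<dots> = ennreal (1 / sqrt (1 - 2 * t * v)) * ennreal (1 / sqrt (1 - 2 * t * v))"
    using assms nn_integral_normal_density_exp_square[of "sqrt v" t]
    by (subst nn_integral_complex_gaussian_mult) auto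
  also have "\<dots> = ennreal (1 / (1 - 2 * t * v))"
    using assms by (simp flip: ennreal_mult)
  finally show ?thesis .
qed

text \<open>\<open>Re (w * cnj z)\<close> is the real inner product of \<open>w\<close> and
  \<open>z\<close>, so real and imaginary parts separate. This is the form in which a mode of
  \<open>\<psi>\<close> meets a coefficient of \<open>|\<phi>|^2\<close>.\<close>

lemma complex_gaussian_exp_linear:
  assumes "0 < v"
  shows "(\<integral>\<^sup>+z. ennreal (exp (Re (w * cnj z))) \<partial>complex_gaussian v)
    = ennreal (exp (v * (cmod w)\<^sup>2 / 2))"
proof -
  have "(\<integral>\<^sup>+z. ennreal (exp (Re (w * cnj z))) \<partial>complex_gaussian v)
      = (\<integral>\<^sup>+z. ennreal (exp (Re w * Re z) * exp (Im w * Im z)) \<partial>complex_gaussian v)"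
    by (simp flip: exp_add)
  also have "\<dots> = ennreal (exp (v * (Re w)\<^sup>2 / 2)) * ennreal (exp (v * (Im w)\<^sup>2 / 2))"
    using assms nn_integral_normal_density_exp_linear[of "sqrt v"]
    by (subst nn_integral_complex_gaussian_mult) auto
  also have "\<dots> = ennreal (exp (v * (cmod w)\<^sup>2 / 2))"
    by (simp add: cmod_power2 distrib_left add_divide_distrib flip: ennreal_mult exp_add)
  finally show ?thesis .
qed

lemma prob_space_complex_gaussian:
  assumes "0 < v" shows "prob_space (complex_gaussian v)"
proof
  show "emeasure (complex_gaussian v) (space (complex_gaussian v)) = 1"
    \<comment> \<open>At \<open>t = 0\<close> the exponential moment is the total mass.\<close>
    using complex_gaussian_exp_norm_square[of v 0] assms by simp
qed

text \<open>The index set \<open>I\<close> may be infinite, as it is for the full measure. Only the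
  coordinates in \<open>J\<close> occur, so the integral passes to the finite marginal, where
  Tonelli for finite products applies.\<close>

lemma (in product_prob_space) nn_integral_PiM_prod:
  assumes J: "finite J" "J \<subseteq> I" and f: "\<And>i. i \<in> J \<Longrightarrow> f i \<in> borel_measurable (M i)"
  shows "(\<integral>\<^sup>+x. (\<Prod>i\<in>J. f i (x i)) \<partial>PiM I M) = (\<Prod>i\<in>J. \<integral>\<^sup>+x. f i x \<partial>M i)"
proof -
  have "(\<integral>\<^sup>+x. (\<Prod>i\<in>J. f i (x i)) \<partial>PiM I M)
      = (\<integral>\<^sup>+x. (\<Prod>i\<in>J. f i (restrict x J i)) \<partial>PiM I M)"
    by (intro nn_integral_cong prod.cong) auto
  also have "\<dots> = (\<integral>\<^sup>+x. (\<Prod>i\<in>J. f i (x i)) \<partial>distr (PiM I M) (PiM J M) (\<lambda>x. restrict x J))"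
    using f J
    by (subst nn_integral_distr) (auto intro!: borel_measurable_prod_ennreal measurable_restrict_subset
         measurable_compose[OF measurable_component_singleton])
  also have "\<dots> = (\<integral>\<^sup>+x. (\<Prod>i\<in>J. f i (x i)) \<partial>PiM J M)"
    by (simp add: distr_PiM_restrict_finite J)
  also have "\<dots> = (\<Prod>i\<in>J. \<integral>\<^sup>+x. f i x \<partial>M i)"
    using J f by (intro product_nn_integral_prod) auto
  finally show ?thesis .
qed

text \<open>The coordinate laws take a set \<open>F\<close> of frequencies so that
  \<open>freqs N\<close> and \<open>UNIV\<close> are handled together.\<close>

definition a_law :: "int set \<Rightarrow> (int \<Rightarrow> complex) measure" where
  "a_law F = (\<Pi>\<^sub>M n\<in>F - {0}. complex_gaussian (1 / (of_int n)\<^sup>2))"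

definition b_law :: "real \<Rightarrow> int set \<Rightarrow> (int \<Rightarrow> complex) measure" where
  "b_law \<kappa> F = (\<Pi>\<^sub>M n\<in>{n \<in> F. n \<ge> 1}. complex_gaussian (1 / (2 * \<kappa> * of_int n)))"

lemma prob_space_a_law: "prob_space (a_law F)"
  unfolding a_law_def by (intro prob_space_PiM prob_space_complex_gaussian) auto

lemma prob_space_b_law: "\<kappa> > 0 \<Longrightarrow> prob_space (b_law \<kappa> F)"
  unfolding b_law_def by (intro prob_space_PiM prob_space_complex_gaussian) auto

lemma nn_integral_a_law_exp:
  assumes J: "finite J" "J \<subseteq> F - {0}" and t: "\<And>n. n \<in> J \<Longrightarrow> 2 * t n < (of_int n)\<^sup>2"
  shows "(\<integral>\<^sup>+x. ennreal (exp (\<Sum>n\<in>J. t n * (cmod (x n))\<^sup>2)) \<partial>a_law F)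
    = ennreal (\<Prod>n\<in>J. 1 / (1 - 2 * t n / (of_int n)\<^sup>2))"
proof -
  \<comment> \<open>The locale asks for a probability space at every index, whereas the variance at
    \<open>0\<close> would read \<open>1 / 0 = 0\<close>; \<open>M\<close> agrees with the given
    family on \<open>F - {0}\<close> and is patched at \<open>0\<close>.\<close>
  define M where "M n = complex_gaussian (if n = 0 then 1 else 1 / (of_int n)\<^sup>2)" for n :: int
  interpret product_prob_space M "F - {0}"
    by (simp add: product_prob_space_def product_sigma_finite_def product_prob_space_axioms_def M_def
       prob_space_complex_gaussian prob_space_imp_sigma_finite)
  have eq: "a_law F = PiM (F - {0}) M"
    unfolding a_law_def by (intro PiM_cong) (auto simp: M_def)
  have "(\<integral>\<^sup>+x. ennreal (exp (\<Sum>n\<in>J. t n * (cmod (x n))\<^sup>2)) \<partial>a_law F)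
     = (\<integral>\<^sup>+x. (\<Prod>n\<in>J. ennreal (exp (t n * (cmod (x n))\<^sup>2))) \<partial>PiM (F - {0}) M)"
    by (simp add: eq exp_sum J prod_ennreal)
  also have "\<dots> = (\<Prod>n\<in>J. \<integral>\<^sup>+z. ennreal (exp (t n * (cmod z)\<^sup>2)) \<partial>M n)"
    using J by (intro nn_integral_PiM_prod) (auto simp: M_def)
  also have "\<dots> = (\<Prod>n\<in>J. ennreal (1 / (1 - 2 * t n / (of_int n)\<^sup>2)))"
  proof (intro prod.cong refl)
    fix n assume n: "n \<in> J"
    then have "n \<noteq> 0" using J by auto
    then show "(\<integral>\<^sup>+z. ennreal (exp (t n * (cmod z)\<^sup>2)) \<partial>M n) = ennreal (1 / (1 - 2 * t n / (of_int n)\<^sup>2))"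
      using t[OF n] complex_gaussian_exp_norm_square[of "1 / (of_int n)\<^sup>2" "t n"]
      by (simp add: M_def field_simps)
  qed
  also have "\<dots> = ennreal (\<Prod>n\<in>J. 1 / (1 - 2 * t n / (of_int n)\<^sup>2))"
  proof (intro prod_ennreal)
    fix n assume n: "n \<in> J"
    then have "n \<noteq> 0" using J by auto
    then show "0 \<le> 1 / (1 - 2 * t n / (of_int n)\<^sup>2)"
      using t[OF n] by (simp add: field_simps)
  qed
  finally show ?thesis .
qed

lemma nn_integral_b_law_prod:
  assumes "\<kappa> > 0" and J: "finite J" "J \<subseteq> {n \<in> F. n \<ge> 1}"
    and f: "\<And>n. n \<in> J \<Longrightarrow> f n \<in> borel_measurable borel"
  shows "(\<integral>\<^sup>+y. (\<Prod>n\<in>J. f n (y n)) \<partial>b_law \<kappa> F)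
    = (\<Prod>n\<in>J. \<integral>\<^sup>+z. f n z \<partial>complex_gaussian (1 / (2 * \<kappa> * of_int n)))"
proof -
  define M where "M n = complex_gaussian (if n \<ge> 1 then 1 / (2 * \<kappa> * of_int n) else 1)" for n :: int
  interpret product_prob_space M "{n \<in> F. n \<ge> 1}"
    using assms(1)
    by (auto simp: product_prob_space_def product_sigma_finite_def product_prob_space_axioms_def M_def
       intro!: prob_space_complex_gaussian prob_space_imp_sigma_finite)
  have eq: "b_law \<kappa> F = PiM {n \<in> F. n \<ge> 1} M"
    unfolding b_law_def by (intro PiM_cong) (auto simp: M_def)
  have "(\<integral>\<^sup>+y. (\<Prod>n\<in>J. f n (y n)) \<partial>b_law \<kappa> F) = (\<Prod>n\<in>J. \<integral>\<^sup>+z. f n z \<partial>M n)"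
    unfolding eq using J f by (intro nn_integral_PiM_prod) (auto simp: M_def)
  also have "\<dots> = (\<Prod>n\<in>J. \<integral>\<^sup>+z. f n z \<partial>complex_gaussian (1 / (2 * \<kappa> * of_int n)))"
    using J by (intro prod.cong) (auto simp: M_def)
  finally show ?thesis .
qed

lemma nn_integral_b_law_exp_linear:
  assumes "\<kappa> > 0" and J: "finite J" "J \<subseteq> {n \<in> F. n \<ge> 1}"
  shows "(\<integral>\<^sup>+y. ennreal (exp (\<Sum>n\<in>J. Re (w n * cnj (y n)))) \<partial>b_law \<kappa> F)
    = ennreal (exp (\<Sum>n\<in>J. (cmod (w n))\<^sup>2 / (4 * \<kappa> * of_int n)))"
proof -
  have "(\<integral>\<^sup>+y. ennreal (exp (\<Sum>n\<in>J. Re (w n * cnj (y n)))) \<partial>b_law \<kappa> F)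
     = (\<integral>\<^sup>+y. (\<Prod>n\<in>J. ennreal (exp (Re (w n * cnj (y n))))) \<partial>b_law \<kappa> F)"
    by (simp add: exp_sum J prod_ennreal)
  also have "\<dots> = (\<Prod>n\<in>J. \<integral>\<^sup>+z. ennreal (exp (Re (w n * cnj z))) \<partial>complex_gaussian (1 / (2 * \<kappa> * of_int n)))"
    using assms by (intro nn_integral_b_law_prod) auto
  also have "\<dots> = (\<Prod>n\<in>J. ennreal (exp ((cmod (w n))\<^sup>2 / (4 * \<kappa> * of_int n))))"
    using assms by (intro prod.cong refl, subst complex_gaussian_exp_linear) (auto simp: field_simps)
  also have "\<dots> = ennreal (exp (\<Sum>n\<in>J. (cmod (w n))\<^sup>2 / (4 * \<kappa> * of_int n)))"
    by (simp add: exp_sum J prod_ennreal)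
  finally show ?thesis .
qed

lemma nn_integral_b_law_exp_square:
  assumes "\<kappa> > 0" "n \<in> F" "n \<ge> 1" "t < \<kappa> * of_int n"
  shows "(\<integral>\<^sup>+y. ennreal (exp (t * (cmod (y n))\<^sup>2)) \<partial>b_law \<kappa> F)
    = ennreal (1 / (1 - t / (\<kappa> * of_int n)))"
  using nn_integral_b_law_prod[of \<kappa> "{n}" F "\<lambda>_ z. ennreal (exp (t * (cmod z)\<^sup>2))"] assms
    complex_gaussian_exp_norm_square[of "1 / (2 * \<kappa> * of_int n)" t]
  by (simp add: field_simps)

section \<open>The Gaussian laws in independent coordinates\<close>

text \<open>Boxes determine a product of sigma-finite measures, and on a box the integral of the
  product density factorizes.\<close>

lemma PiM_density:
  assumes I: "finite I" and M: "\<And>i. sigma_finite_measure (M i)"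
    and f: "\<And>i. f i \<in> borel_measurable (M i)"
    and D: "\<And>i. sigma_finite_measure (density (M i) (f i))"
  shows "PiM I (\<lambda>i. density (M i) (f i)) = density (PiM I M) (\<lambda>x. \<Prod>i\<in>I. f i (x i))"
proof -
  interpret M: product_sigma_finite M using M by (simp add: product_sigma_finite_def)
  interpret D: product_sigma_finite "\<lambda>i. density (M i) (f i)" using D by (simp add: product_sigma_finite_def)
  have [measurable]: "(\<lambda>x. \<Prod>i\<in>I. f i (x i)) \<in> borel_measurable (PiM I M)"
    using I f by (intro borel_measurable_prod_ennreal measurable_compose[OF measurable_component_singleton]) auto
  show ?thesis
  proof (rule D.PiM_eqI[OF I, symmetric])
    show "sets (density (PiM I M) (\<lambda>x. \<Prod>i\<in>I. f i (x i))) = sets (PiM I (\<lambda>i. density (M i) (f i)))"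
      by (simp cong: sets_PiM_cong)
    fix A assume "\<And>i. i \<in> I \<Longrightarrow> A i \<in> sets (density (M i) (f i))"
    then have A: "\<And>i. i \<in> I \<Longrightarrow> A i \<in> sets (M i)" by simp
    have "emeasure (density (PiM I M) (\<lambda>x. \<Prod>i\<in>I. f i (x i))) (Pi\<^sub>E I A)
      = (\<integral>\<^sup>+x. (\<Prod>i\<in>I. f i (x i)) * indicator (Pi\<^sub>E I A) x \<partial>PiM I M)"
      using A I by (subst emeasure_density) (auto intro: sets_PiM_I_finite)
    also have "\<dots> = (\<integral>\<^sup>+x. (\<Prod>i\<in>I. f i (x i) * indicator (A i) (x i)) \<partial>PiM I M)"
    proof (intro nn_integral_cong)
      fix x assume "x \<in> space (PiM I M)"
      \<comment> \<open>Membership in the box also asks for extensionality outside \<open>I\<close>.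
        This holds on the whole space, so the indicator is a product over \<open>I\<close>
        alone.\<close>
      then have "x \<in> extensional I" by (simp add: space_PiM PiE_def)
      then have "indicator (Pi\<^sub>E I A) x = (\<Prod>i\<in>I. indicator (A i) (x i) :: ennreal)"
        using I by (cases "\<forall>i\<in>I. x i \<in> A i") (auto simp: PiE_iff indicator_def intro!: prod.neutral prod_zero)
      then show "(\<Prod>i\<in>I. f i (x i)) * indicator (Pi\<^sub>E I A) x = (\<Prod>i\<in>I. f i (x i) * indicator (A i) (x i))"
        by (simp add: prod.distrib)
    qed
    also have "\<dots> = (\<Prod>i\<in>I. \<integral>\<^sup>+x. f i x * indicator (A i) x \<partial>M i)"
      using A I f by (intro M.product_nn_integral_prod) auto
    also have "\<dots> = (\<Prod>i\<in>I. emeasure (density (M i) (f i)) (A i))"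
      using A f by (intro prod.cong refl) (simp add: emeasure_density)
    finally show "emeasure (density (PiM I M) (\<lambda>x. \<Prod>i\<in>I. f i (x i))) (Pi\<^sub>E I A)
       = (\<Prod>i\<in>I. emeasure (density (M i) (f i)) (A i))" .
  qed
qed

section \<open>Measurable structure on the space of modes\<close>

lemma measurable_modes_component [measurable]:
  "(\<lambda>p. fst p n) \<in> borel_measurable modes_space"
  "(\<lambda>p. snd p n) \<in> borel_measurable modes_space"
  unfolding modes_space_def by measurable

lemma measurable_into_modes_space:
  assumes "\<And>n. (\<lambda>x. fst (f x) n) \<in> borel_measurable M" "\<And>n. (\<lambda>x. snd (f x) n) \<in> borel_measurable M"
  shows "f \<in> measurable M modes_space"
  unfolding modes_space_def
  using assms by (intro measurable_pair) (auto intro!: measurable_PiM_single' simp: comp_def)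

lemma space_modes_space [simp]: "space modes_space = UNIV"
  by (auto simp: modes_space_def space_pair_measure space_PiM)

text \<open>The coordinate measures \<open>A\<close> and \<open>B\<close> are left open because the
  same map is applied to the Lebesgue products behind \<open>lebesgue_modes\<close> and to the
  Gaussian products.\<close>

lemma measurable_from_coords_gen:
  assumes F: "\<And>n. n \<in> F \<Longrightarrow> - n \<in> F"
    and A: "\<And>n. n \<in> F - {0} \<Longrightarrow> (\<lambda>x. x n) \<in> borel_measurable A"
    and B: "\<And>n. n \<in> F \<Longrightarrow> n \<ge> 1 \<Longrightarrow> (\<lambda>x. x n) \<in> borel_measurable B"
  shows "from_coords F \<in> measurable (A \<Otimes>\<^sub>M B) modes_space"
proof (rule measurable_into_modes_space)
  fix n
  show "(\<lambda>x. fst (from_coords F x) n) \<in> borel_measurable (A \<Otimes>\<^sub>M B)"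
    using A by (cases "n \<in> F - {0}")
      (auto simp: from_coords_def split_beta intro!: measurable_compose[OF measurable_fst])
  show "(\<lambda>x. snd (from_coords F x) n) \<in> borel_measurable (A \<Otimes>\<^sub>M B)"
  proof -
    consider "n \<notin> F \<or> n = 0" | "n \<in> F" "n \<ge> 1" | "n \<in> F" "n \<le> -1" by linarith
    then show ?thesis
    proof cases
      case 1
      then have "(\<lambda>x. snd (from_coords F x) n) = (\<lambda>_. 0)"
        by (auto simp: from_coords_def split_beta)
      then show ?thesis by simp
    next
      case 2
      then show ?thesis using B
        by (auto simp: from_coords_def split_beta intro!: measurable_compose[OF measurable_snd])
    next
      case 3
      have "(\<lambda>x. snd x (- n)) \<in> borel_measurable (A \<Otimes>\<^sub>M B)"
        using B[of "- n"] F 3 by (intro measurable_compose[OF measurable_snd]) auto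
      moreover have "cnj \<in> borel_measurable borel"
        by (intro borel_measurable_continuous_onI continuous_intros)
      ultimately have "(\<lambda>x. cnj (snd x (- n))) \<in> borel_measurable (A \<Otimes>\<^sub>M B)"
        by (rule measurable_compose)
      with 3 show ?thesis by (auto simp: from_coords_def split_beta)
    qed
  qed
qed

section \<open>Gaussian laws on symmetric sets of frequencies\<close>

lemma uminus_mem_freqs: "n \<in> freqs N \<Longrightarrow> - n \<in> freqs N"
  by (simp add: freqs_def)

lemma finite_freqs [simp]: "finite (freqs N)"
proof -
  have "freqs N = {- int N..int N}" by (auto simp: freqs_def)
  then show ?thesis by simp
qed

text \<open>One family for both reference measures: \<open>F = freqs N\<close> turns out to give
  \<open>rho_N\<close> and \<open>F = UNIV\<close> gives \<open>rho\<close>, so a bound uniform in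
  symmetric \<open>F\<close> serves all of them.\<close>

definition gauss_law :: "real \<Rightarrow> int set \<Rightarrow> modes measure" where
  "gauss_law \<kappa> F = distr (a_law F \<Otimes>\<^sub>M b_law \<kappa> F) modes_space (from_coords F)"

lemma rho_eq_gauss_law: "rho \<kappa> = gauss_law \<kappa> UNIV"
  by (simp add: rho_def gauss_law_def a_law_def b_law_def atLeast_def)

lemma measurable_a_law_component: "n \<in> F - {0} \<Longrightarrow> (\<lambda>x. x n) \<in> borel_measurable (a_law F)"
  unfolding a_law_def measurable_cong_sets[OF refl sets_complex_gaussian[symmetric, of "1 / (of_int n)\<^sup>2"]]
  by (rule measurable_component_singleton)

lemma measurable_b_law_component:
  "n \<in> F \<Longrightarrow> n \<ge> 1 \<Longrightarrow> (\<lambda>x. x n) \<in> borel_measurable (b_law \<kappa> F)"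
  unfolding b_law_def measurable_cong_sets[OF refl sets_complex_gaussian[symmetric, of "1 / (2 * \<kappa> * of_int n)"]]
  by (rule measurable_component_singleton) simp

lemma measurable_from_coords:
  assumes F: "\<And>n. n \<in> F \<Longrightarrow> - n \<in> F"
  shows "from_coords F \<in> measurable (a_law F \<Otimes>\<^sub>M b_law \<kappa> F) modes_space"
proof (rule measurable_from_coords_gen[OF F])
qed (auto intro: measurable_a_law_component measurable_b_law_component)

lemma prob_space_gauss_law:
  assumes "\<kappa> > 0" and F: "\<And>n. n \<in> F \<Longrightarrow> - n \<in> F"
  shows "prob_space (gauss_law \<kappa> F)"
proof -
  interpret A: prob_space "a_law F" by (rule prob_space_a_law)
  interpret B: prob_space "b_law \<kappa> F" using assms by (intro prob_space_b_law)
  interpret pair_prob_space "a_law F" "b_law \<kappa> F" ..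
  show ?thesis unfolding gauss_law_def
    by (intro prob_space_distr measurable_from_coords F)
qed

lemma complex_gaussian_exp:
  assumes "0 < v"
  shows "complex_gaussian v = density lborel (\<lambda>z. ennreal (1 / (2 * pi * v) * exp (- ((cmod z)\<^sup>2 / (2 * v)))))"
proof -
  have "normal_density 0 (sqrt v) (Re z) * normal_density 0 (sqrt v) (Im z)
     = 1 / (2 * pi * v) * exp (- ((cmod z)\<^sup>2 / (2 * v)))" for z
  proof -
    have "normal_density 0 (sqrt v) (Re z) * normal_density 0 (sqrt v) (Im z)
       = 1 / (sqrt (2 * pi * v) * sqrt (2 * pi * v)) * exp (- (Re z)\<^sup>2 / (2 * v) + - (Im z)\<^sup>2 / (2 * v))"
      using assms by (simp add: normal_density_def mult_exp_exp del: real_sqrt_mult_self)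
    also have "- (Re z)\<^sup>2 / (2 * v) + - (Im z)\<^sup>2 / (2 * v) = - ((cmod z)\<^sup>2 / (2 * v))"
      by (simp add: cmod_power2 add_divide_distrib)
    finally show ?thesis using assms by simp
  qed
  then show ?thesis by (simp add: complex_gaussian_def)
qed

lemma PiM_complex_gaussian:
  assumes I: "finite I" and v: "\<And>n. n \<in> I \<Longrightarrow> 0 < v n"
  shows "PiM I (\<lambda>n. complex_gaussian (v n)) =
    density (PiM I (\<lambda>_. lborel)) (\<lambda>x. ennreal ((\<Prod>n\<in>I. 1 / (2 * pi * v n)) * exp (- (\<Sum>n\<in>I. (cmod (x n))\<^sup>2 / (2 * v n)))))"
proof -
  define w where "w n = (if n \<in> I then v n else 1)" for n
  have w: "w n > 0" for n using v by (simp add: w_def)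
  let ?f = "\<lambda>n z. ennreal (1 / (2 * pi * w n) * exp (- ((cmod z)\<^sup>2 / (2 * w n))))"
  have "PiM I (\<lambda>n. complex_gaussian (v n)) = PiM I (\<lambda>n. density lborel (?f n))"
    using v by (intro PiM_cong refl, subst complex_gaussian_exp[symmetric]) (auto simp: w_def)
  also have "\<dots> = density (PiM I (\<lambda>_. lborel)) (\<lambda>x. \<Prod>n\<in>I. ?f n (x n))"
  proof (rule PiM_density[OF I])
    show "sigma_finite_measure (density lborel (?f n))" for n
      using complex_gaussian_exp[OF w[of n]] prob_space_complex_gaussian[OF w[of n]]
      by (metis prob_space_imp_sigma_finite)
  qed (auto simp: lborel.sigma_finite_measure_axioms)
  also have "(\<lambda>x. \<Prod>n\<in>I. ?f n (x n)) = (\<lambda>x. ennreal ((\<Prod>n\<in>I. 1 / (2 * pi * v n)) * exp (- (\<Sum>n\<in>I. (cmod (x n))\<^sup>2 / (2 * v n)))))"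
  proof
    fix x :: "'a \<Rightarrow> complex"
    have "(\<Prod>n\<in>I. ?f n (x n)) = ennreal (\<Prod>n\<in>I. 1 / (2 * pi * w n) * exp (- ((cmod (x n))\<^sup>2 / (2 * w n))))"
      using w by (intro prod_ennreal) (simp add: less_imp_le)
    also have "(\<Prod>n\<in>I. 1 / (2 * pi * w n) * exp (- ((cmod (x n))\<^sup>2 / (2 * w n))))
      = (\<Prod>n\<in>I. 1 / (2 * pi * v n)) * (\<Prod>n\<in>I. exp (- ((cmod (x n))\<^sup>2 / (2 * v n))))"
      unfolding prod.distrib[symmetric] by (intro prod.cong) (auto simp: w_def)
    also have "\<dots> = (\<Prod>n\<in>I. 1 / (2 * pi * v n)) * exp (- (\<Sum>n\<in>I. (cmod (x n))\<^sup>2 / (2 * v n)))"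
      by (simp add: I flip: exp_sum sum_negf)
    finally show "(\<Prod>n\<in>I. ?f n (x n)) = \<dots>" by simp
  qed
  finally show ?thesis .
qed

lemma sum_freqs_symmetric:
  fixes g :: "int \<Rightarrow> 'a::comm_monoid_add"
  shows "(\<Sum>n\<in>freqs N - {0}. g n) = (\<Sum>n\<in>{n \<in> freqs N. n \<ge> 1}. g n + g (- n))"
proof -
  let ?P = "{n \<in> freqs N. n \<ge> 1}"
  have "freqs N - {0} = ?P \<union> uminus ` ?P"
  proof (intro equalityI subsetI)
    fix n assume n: "n \<in> freqs N - {0}"
    show "n \<in> ?P \<union> uminus ` ?P"
    proof (cases "n \<ge> 1")
      case False
      then have "n = - (- n)" "- n \<in> ?P" using n by (auto simp: freqs_def)
      then show ?thesis by blast
    qed (use n in auto)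
  qed (auto simp: freqs_def)
  moreover have "?P \<inter> uminus ` ?P = {}" by auto
  ultimately have "(\<Sum>n\<in>freqs N - {0}. g n) = (\<Sum>n\<in>?P. g n) + (\<Sum>n\<in>uminus ` ?P. g n)"
    by (simp add: sum.union_disjoint)
  then show ?thesis by (simp add: sum.reindex sum.distrib)
qed

text \<open>In the exponent \<open>|b_n|^2\<close> occurs at \<open>n\<close> and at
  \<open>- n\<close>, so half of the sum is \<open>\<kappa> * n * |b_n|^2\<close> over
  \<open>n \<ge> 1\<close>, the exponent of a complex Gaussian of variance
  \<open>1 / (2 * \<kappa> * n)\<close>. The Gaussian law is therefore the unnormalized density
  times the constant \<open>ca * cb\<close>. As it has mass \<open>1\<close>, that constant must be
  the inverse of the total mass, which is the factor in \<open>normalized\<close>.\<close>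

lemma rho_N_eq_gauss_law:
  assumes \<kappa>: "\<kappa> > 0"
  shows "rho_N \<kappa> N = gauss_law \<kappa> (freqs N)"
proof -
  let ?F = "freqs N" and ?P = "{n \<in> freqs N. n \<ge> 1}"
  let ?LA = "\<Pi>\<^sub>M n\<in>?F - {0}. (lborel :: complex measure)"
  let ?LB = "\<Pi>\<^sub>M n\<in>?P. (lborel :: complex measure)"
  define g :: "modes \<Rightarrow> ennreal" where "g = (\<lambda>(a, b). ennreal (exp (- (1/2) * (\<Sum>n\<in>?F - {0}.
       (of_int n)\<^sup>2 * (cmod (a n))\<^sup>2 + \<kappa> * \<bar>of_int n\<bar> * (cmod (b n))\<^sup>2))))"
  define D where "D = density (lebesgue_modes N) g"
  have [measurable]: "g \<in> borel_measurable modes_space"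
    unfolding g_def split_beta by measurable
  have m: "from_coords ?F \<in> measurable (?LA \<Otimes>\<^sub>M ?LB) modes_space"
  proof (rule measurable_from_coords_gen[OF uminus_mem_freqs])
    show "(\<lambda>x. x n) \<in> borel_measurable ?LA" if "n \<in> ?F - {0}" for n
      using measurable_component_singleton[OF that, of "\<lambda>n. lborel"] by simp
    show "(\<lambda>x. x n) \<in> borel_measurable ?LB" if "n \<in> ?F" "n \<ge> 1" for n
      using measurable_component_singleton[of n ?P "\<lambda>n. lborel"] that by simp
  qed auto
  define ca where "ca = (\<Prod>n\<in>?F - {0}. 1 / (2 * pi * (1 / (real_of_int n)\<^sup>2)))"
  define cb where "cb = (\<Prod>n\<in>?P. 1 / (2 * pi * (1 / (2 * \<kappa> * real_of_int n))))"
  have ca: "ca \<ge> 0" unfolding ca_def by (intro prod_nonneg) auto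
  have cb: "cb \<ge> 0" unfolding cb_def using \<kappa> by (intro prod_nonneg) auto
  let ?fa = "\<lambda>x. ennreal (ca * exp (- (\<Sum>n\<in>?F - {0}. (cmod (x n))\<^sup>2 / (2 * (1 / (real_of_int n)\<^sup>2)))))"
  let ?fb = "\<lambda>y. ennreal (cb * exp (- (\<Sum>n\<in>?P. (cmod (y n))\<^sup>2 / (2 * (1 / (2 * \<kappa> * real_of_int n))))))"
  have A: "a_law ?F = density ?LA ?fa"
    unfolding a_law_def ca_def by (rule PiM_complex_gaussian) auto
  have B: "b_law \<kappa> ?F = density ?LB ?fb"
    unfolding b_law_def cb_def using \<kappa> by (intro PiM_complex_gaussian) auto
  interpret PA: product_sigma_finite "\<lambda>_::int. lborel :: complex measure"
    by (simp add: product_sigma_finite_def lborel.sigma_finite_measure_axioms)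
  have sA: "sigma_finite_measure ?LA" and sB: "sigma_finite_measure ?LB"
    by (auto intro!: PA.sigma_finite)
  have *: "gauss_law \<kappa> ?F = density (lebesgue_modes N) (\<lambda>p. ennreal (ca * cb) * g p)"
  proof -
    have "a_law ?F \<Otimes>\<^sub>M b_law \<kappa> ?F = density (?LA \<Otimes>\<^sub>M ?LB) (\<lambda>(x, y). ?fa x * ?fb y)"
      unfolding A B
    proof (rule pair_measure_density)
      show "sigma_finite_measure (density ?LB ?fb)"
        using B prob_space_b_law[OF \<kappa>] prob_space_imp_sigma_finite by metis
    qed (use sB in auto)
    also have "\<dots> = density (?LA \<Otimes>\<^sub>M ?LB) (\<lambda>x. ennreal (ca * cb) * g (from_coords ?F x))"
    proof (rule arg_cong[where f = "density _"], rule ext)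
      fix p :: modes
      obtain x y where p: "p = (x, y)" by force
      have 1: "(\<Sum>n\<in>?F - {0}. (of_int n)\<^sup>2 * (cmod (fst (from_coords ?F p) n))\<^sup>2) =
          2 * (\<Sum>n\<in>?F - {0}. (cmod (x n))\<^sup>2 / (2 * (1 / (real_of_int n)\<^sup>2)))"
        unfolding sum_distrib_left by (intro sum.cong) (auto simp: p from_coords_def)
      have 2: "(\<Sum>n\<in>?F - {0}. \<kappa> * \<bar>of_int n\<bar> * (cmod (snd (from_coords ?F p) n))\<^sup>2) =
          2 * (\<Sum>n\<in>?P. (cmod (y n))\<^sup>2 / (2 * (1 / (2 * \<kappa> * real_of_int n))))"
        unfolding sum_freqs_symmetric sum_distrib_left using \<kappa>
        by (intro sum.cong) (auto simp: p from_coords_def uminus_mem_freqs)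
      have "g (from_coords ?F p) = ennreal (exp (- (1/2) * (
          2 * (\<Sum>n\<in>?F - {0}. (cmod (x n))\<^sup>2 / (2 * (1 / (real_of_int n)\<^sup>2))) +
          2 * (\<Sum>n\<in>?P. (cmod (y n))\<^sup>2 / (2 * (1 / (2 * \<kappa> * real_of_int n)))))))"
        unfolding g_def split_beta sum.distrib 1 2 ..
      then show "(case p of (x, y) \<Rightarrow> ?fa x * ?fb y) = ennreal (ca * cb) * g (from_coords ?F p)"
        using ca cb by (simp add: p distrib_left exp_add exp_diff exp_minus field_simps flip: ennreal_mult)
    qed
    finally have "gauss_law \<kappa> ?F = distr (density (?LA \<Otimes>\<^sub>M ?LB) (\<lambda>x. ennreal (ca * cb) * g (from_coords ?F x))) modes_space (from_coords ?F)"
      by (simp add: gauss_law_def)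
    also have "\<dots> = density (lebesgue_modes N) (\<lambda>p. ennreal (ca * cb) * g p)"
      unfolding lebesgue_modes_def using m by (intro density_distr[symmetric]) auto
    finally show ?thesis .
  qed
  have sets: "sets (lebesgue_modes N) = sets modes_space" by (simp add: lebesgue_modes_def)
  have gm: "g \<in> borel_measurable (lebesgue_modes N)"
    using sets by (simp cong: measurable_cong_sets)
  have eq: "gauss_law \<kappa> ?F = scale_measure (ennreal (ca * cb)) D"
  proof (rule measure_eqI)
    show "sets (gauss_law \<kappa> ?F) = sets (scale_measure (ennreal (ca * cb)) D)"
      by (simp add: gauss_law_def D_def sets)
    fix X assume "X \<in> sets (gauss_law \<kappa> ?F)"
    then have X: "X \<in> sets (lebesgue_modes N)" by (simp add: gauss_law_def sets)
    show "emeasure (gauss_law \<kappa> ?F) X = emeasure (scale_measure (ennreal (ca * cb)) D) X"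
      using X gm by (simp add: * D_def emeasure_density nn_integral_cmult mult.assoc)
  qed
  interpret G: prob_space "gauss_law \<kappa> ?F" by (intro prob_space_gauss_law \<kappa> uminus_mem_freqs)
  have "ennreal (ca * cb) * emeasure D (space D) = 1"
    using G.emeasure_space_1 unfolding eq by (simp add: space_scale_measure)
  then have "inverse (emeasure D (space D)) = ennreal (ca * cb)"
  proof (cases "emeasure D (space D)")
    case (real m)
    with \<open>ennreal (ca * cb) * emeasure D (space D) = 1\<close> ca cb have "ca * cb * m = 1"
      by (simp flip: ennreal_mult)
    then have "m > 0" "ca * cb = inverse m"
      using real by (cases "m = 0", auto simp: less_le eq_divide_eq inverse_eq_divide)
    then show ?thesis by (simp add: real inverse_ennreal)
  next
    case top
    with \<open>ennreal (ca * cb) * emeasure D (space D) = 1\<close> have False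
      by (auto simp: ennreal_mult_top split: if_splits)
    then show ?thesis ..
  qed
  then show ?thesis
    unfolding rho_N_def normalized_def by (simp add: eq D_def g_def)
qed

definition modes_of :: "int set \<Rightarrow> complex \<times> real \<Rightarrow> (int \<Rightarrow> complex) \<Rightarrow> (int \<Rightarrow> complex) \<Rightarrow> modes" where
  "modes_of F z x y = ((fst (from_coords F (x, y)))(0 := fst z), (snd (from_coords F (x, y)))(0 := of_real (snd z)))"

section \<open>Integration in the coordinates\<close>

lemma measurable_zero_mode:
  assumes "sets R = sets modes_space"
  shows "(\<lambda>((a0, b0), (a, b)). (a(0 := a0), b(0 := complex_of_real b0)))
    \<in> measurable ((lborel :: (complex \<times> real) measure) \<Otimes>\<^sub>M R) modes_space"
proof -
  note [measurable_cong] = assms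
  have 1: "(\<lambda>x. fst (snd x) n) \<in> borel_measurable ((lborel :: (complex \<times> real) measure) \<Otimes>\<^sub>M R)" for n
    by measurable
  have 2: "(\<lambda>x. snd (snd x) n) \<in> borel_measurable ((lborel :: (complex \<times> real) measure) \<Otimes>\<^sub>M R)" for n
    by measurable
  have 3: "(\<lambda>x. complex_of_real (snd (fst x))) \<in> borel_measurable ((lborel :: (complex \<times> real) measure) \<Otimes>\<^sub>M R)"
    "(\<lambda>x. fst (fst x)) \<in> borel_measurable ((lborel :: (complex \<times> real) measure) \<Otimes>\<^sub>M R)"
    by (auto intro!: measurable_compose[OF measurable_fst] borel_measurable_continuous_onI continuous_intros)
  show ?thesis
    using 1 2 3 by (intro measurable_into_modes_space) (auto simp: split_beta fun_upd_def)
qed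

text \<open>Tonelli with \<open>b\<close> innermost: for a fixed zero mode \<open>z\<close> and
  fixed \<open>x\<close>, the integral over \<open>y\<close> is the one available in closed
  form.\<close>

lemma nn_integral_with_zero_mode:
  assumes \<kappa>: "\<kappa> > 0" and F: "\<And>n. n \<in> F \<Longrightarrow> - n \<in> F"
    and f: "f \<in> borel_measurable modes_space"
  shows "(\<integral>\<^sup>+p. f p \<partial>with_zero_mode (gauss_law \<kappa> F))
    = (\<integral>\<^sup>+z. \<integral>\<^sup>+x. \<integral>\<^sup>+y. f (modes_of F z x y) \<partial>b_law \<kappa> F \<partial>a_law F \<partial>lborel)"
proof -
  interpret A: prob_space "a_law F" by (rule prob_space_a_law)
  interpret B: prob_space "b_law \<kappa> F" using \<kappa> by (intro prob_space_b_law)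
  interpret G: prob_space "gauss_law \<kappa> F" by (intro prob_space_gauss_law \<kappa> F)
  let ?h = "\<lambda>((a0, b0), (a, b)). (a(0 := a0), b(0 := complex_of_real b0))"
  have s: "sets (gauss_law \<kappa> F) = sets modes_space" by (simp add: gauss_law_def)
  note h = measurable_zero_mode[OF s]
  have hf: "(\<lambda>w. f (?h w)) \<in> borel_measurable (lborel \<Otimes>\<^sub>M gauss_law \<kappa> F)"
    using measurable_compose[OF h f] .
  have hz: "(\<lambda>p. f (?h (z, p))) \<in> borel_measurable modes_space" for z
    using measurable_compose[OF measurable_Pair1' hf] s by (simp cong: measurable_cong_sets)
  have fc: "from_coords F \<in> measurable (a_law F \<Otimes>\<^sub>M b_law \<kappa> F) modes_space"
    by (intro measurable_from_coords F)
  have "(\<integral>\<^sup>+p. f p \<partial>with_zero_mode (gauss_law \<kappa> F))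
     = (\<integral>\<^sup>+w. f (?h w) \<partial>(lborel \<Otimes>\<^sub>M gauss_law \<kappa> F))"
    unfolding with_zero_mode_def by (rule nn_integral_distr[OF h]) (simp add: f)
  also have "\<dots> = (\<integral>\<^sup>+z. \<integral>\<^sup>+p. f (?h (z, p)) \<partial>gauss_law \<kappa> F \<partial>lborel)"
    by (rule G.nn_integral_fst[symmetric, OF hf])
  also have "\<dots> = (\<integral>\<^sup>+z. \<integral>\<^sup>+u. f (?h (z, from_coords F u)) \<partial>(a_law F \<Otimes>\<^sub>M b_law \<kappa> F) \<partial>lborel)"
    unfolding gauss_law_def by (intro nn_integral_cong nn_integral_distr fc) (use hz in simp)
  also have "\<dots> = (\<integral>\<^sup>+z. \<integral>\<^sup>+x. \<integral>\<^sup>+y. f (?h (z, from_coords F (x, y))) \<partial>b_law \<kappa> F \<partial>a_law F \<partial>lborel)"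
    by (intro nn_integral_cong B.nn_integral_fst[symmetric] measurable_compose[OF fc hz])
  finally show ?thesis by (simp add: modes_of_def split_beta)
qed

lemma measurable_modes_of:
  assumes F: "\<And>n. n \<in> F \<Longrightarrow> - n \<in> F" and f: "f \<in> borel_measurable modes_space"
  shows "(\<lambda>x. f (modes_of F z x y)) \<in> borel_measurable (a_law F)"
proof -
  have "(\<lambda>x. modes_of F z x y) \<in> measurable (a_law F) modes_space"
  proof (rule measurable_into_modes_space)
    fix n
    show "(\<lambda>x. fst (modes_of F z x y) n) \<in> borel_measurable (a_law F)"
      using measurable_a_law_component[of n F]
      by (cases "n = 0"; cases "n \<in> F") (auto simp: modes_of_def from_coords_def)
    show "(\<lambda>x. snd (modes_of F z x y) n) \<in> borel_measurable (a_law F)"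
      by (simp add: modes_of_def from_coords_def)
  qed
  from measurable_compose[OF this f] show ?thesis .
qed

section \<open>The interaction in Fourier coefficients\<close>

lemma integral_cis_period:
  "(LINT x:{0..<2*pi}|lborel. cis (of_int m * x)) = (if m = 0 then complex_of_real (2 * pi) else 0)"
proof -
  have [measurable]: "(\<lambda>x. cis (of_int m * x)) \<in> borel_measurable borel"
    by (intro borel_measurable_continuous_onI continuous_intros)
  \<comment> \<open>The fundamental theorem of calculus is applied on the closed interval, which
    differs from the half-open one by the null set \<open>{2 * pi}\<close>.\<close>
  have ae: "AE x in lborel. x \<noteq> 2 * pi"
    by (rule AE_lborel_singleton)
  have "(LINT x:{0..<2*pi}|lborel. cis (of_int m * x)) = (LINT x:{0..2*pi}|lborel. cis (of_int m * x))"
    unfolding set_lebesgue_integral_def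
  proof (rule integral_cong_AE)
    show "AE x in lborel. indicator {0..<2*pi} x *\<^sub>R cis (of_int m * x) = indicator {0..2*pi} x *\<^sub>R cis (of_int m * x)"
      using ae by eventually_elim (auto simp: indicator_def)
  qed measurable
  also have "\<dots> = (if m = 0 then complex_of_real (2 * pi) else 0)"
  proof (cases "m = 0")
    case True
    then show ?thesis by (simp add: set_lebesgue_integral_def scaleR_conv_of_real)
  next
    case False
    let ?F = "\<lambda>x. cis (of_int m * x) / (\<i> * of_int m)"
    have "(LINT x:{0..2*pi}|lborel. cis (of_int m * x)) = ?F (2 * pi) - ?F 0"
      unfolding set_lebesgue_integral_def
    proof (rule integral_FTC_Icc)
      show "continuous_on {0..2 * pi} (\<lambda>x. cis (of_int m * x))" by (intro continuous_intros)
      fix x :: real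
      have "((\<lambda>z. exp (\<i> * of_int m * z) / (\<i> * of_int m)) has_field_derivative exp (\<i> * of_int m * of_real x))
          (at (of_real x))"
        using False by (auto intro!: derivative_eq_intros)
      then have "((\<lambda>x. exp (\<i> * of_int m * of_real x) / (\<i> * of_int m)) has_vector_derivative exp (\<i> * of_int m * of_real x))
          (at x within {0..2 * pi})"
        by (rule has_vector_derivative_real_field)
      then show "(?F has_vector_derivative cis (of_int m * x)) (at x within {0..2 * pi})"
        by (simp add: cis_conv_exp mult.assoc)
    qed simp
    also have "cis (of_int m * (2 * pi)) = 1"
      using cis_multiple_2pi[of "of_int m"] by (simp add: mult_ac)
    finally show ?thesis using False by simp
  qed
  finally show ?thesis .
qed

lemma torus_integral_trig_sum:
  assumes "finite I"
  shows "torus_integral (\<lambda>x. \<Sum>i\<in>I. c i * cis (of_int (m i) * x)) = (\<Sum>i\<in>I. if m i = 0 then c i else 0)"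
proof -
  have int: "set_integrable lborel {0..<2*pi} (\<lambda>x. c i * cis (of_int (m i) * x))" for i
  proof (rule set_integrable_subset[of _ "{0..2*pi}"])
    show "set_integrable lborel {0..2*pi} (\<lambda>x. c i * cis (of_int (m i) * x))"
      unfolding set_integrable_def
      by (intro borel_integrable_compact compact_Icc continuous_intros)
  qed auto
  have "(LINT x:{0..<2*pi}|lborel. (\<Sum>i\<in>I. c i * cis (of_int (m i) * x)))
     = (\<Sum>i\<in>I. (LINT x:{0..<2*pi}|lborel. c i * cis (of_int (m i) * x)))"
    using int unfolding set_lebesgue_integral_def set_integrable_def scaleR_sum_right
    by (intro Bochner_Integration.integral_sum)
  also have "\<dots> = (\<Sum>i\<in>I. if m i = 0 then c i * of_real (2 * pi) else 0)"
    by (intro sum.cong) (auto simp: integral_cis_period)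
  also have "\<dots> = (\<Sum>i\<in>I. if m i = 0 then c i else 0) * of_real (2 * pi)"
    unfolding sum_distrib_right by (intro sum.cong) auto
  finally show ?thesis by (simp add: torus_integral_def)
qed

text \<open>These are the Fourier coefficients of \<open>|P_L \<phi>|^2\<close>, the finite version
  of the \<open>q_n\<close>. The double sum is the shape produced by multiplying out the
  square.\<close>

definition autocorr :: "nat \<Rightarrow> (int \<Rightarrow> complex) \<Rightarrow> int \<Rightarrow> complex" where
  "autocorr L a n = (\<Sum>k\<in>freqs L. \<Sum>l\<in>freqs L. if k - l = n then a k * cnj (a l) else 0)"

lemma abs_sq_partial_fourier:
  "complex_of_real ((cmod (partial_fourier L a x))\<^sup>2)
    = (\<Sum>(k, l)\<in>freqs L \<times> freqs L. a k * cnj (a l) * cis (of_int (k - l) * x))"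
  unfolding complex_norm_square partial_fourier_def cnj_sum sum_product sum.cartesian_product
  by (intro sum.cong) (auto simp: cis_cnj cis_mult algebra_simps)

lemma fourier_coeff_abs_sq: "fourier_coeff (\<lambda>x. of_real ((cmod (partial_fourier L a x))\<^sup>2)) n = autocorr L a n"
proof -
  have "fourier_coeff (\<lambda>x. of_real ((cmod (partial_fourier L a x))\<^sup>2)) n
    = torus_integral (\<lambda>x. \<Sum>i\<in>freqs L \<times> freqs L. (a (fst i) * cnj (a (snd i))) * cis (of_int (fst i - snd i - n) * x))"
    unfolding fourier_coeff_def abs_sq_partial_fourier sum_distrib_right
    by (intro arg_cong[where f = torus_integral] ext sum.cong)
      (auto simp: mult.assoc cis_mult algebra_simps)
  also have "\<dots> = autocorr L a n"
    unfolding autocorr_def sum.cartesian_product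
    by (subst torus_integral_trig_sum) (auto intro!: sum.cong)
  finally show ?thesis .
qed

text \<open>\<open>\<psi>\<close> is truncated at \<open>M\<close> and \<open>|\<phi>|^2\<close> at
  \<open>L\<close>, independently. The diagonal \<open>M = L = N\<close> is
  \<open>interaction_N\<close>; \<open>interaction\<close> is reached by letting \<open>L\<close>
  tend to infinity before \<open>M\<close>, since its coefficients of \<open>|\<phi>|^2\<close> are
  themselves limits.\<close>

definition pairing :: "nat \<Rightarrow> nat \<Rightarrow> modes \<Rightarrow> real" where
  "pairing M L p = Re (\<Sum>n\<in>freqs M. snd p (- n) * autocorr L (fst p) n)"

lemma interaction_N_eq_pairing: "interaction_N N p = pairing N N p"
proof -
  obtain a b where p: "p = (a, b)" by force
  have "torus_integral (\<lambda>x. partial_fourier N b x * of_real ((cmod (partial_fourier N a x))\<^sup>2))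
    = torus_integral (\<lambda>x. \<Sum>i\<in>freqs N \<times> (freqs N \<times> freqs N).
        (b (fst i) * (a (fst (snd i)) * cnj (a (snd (snd i))))) * cis (of_int (fst i + fst (snd i) - snd (snd i)) * x))"
    unfolding abs_sq_partial_fourier unfolding partial_fourier_def sum_product sum.cartesian_product
    by (intro arg_cong[where f = torus_integral] ext sum.cong)
      (auto simp: cis_mult algebra_simps)
  also have "\<dots> = (\<Sum>i\<in>freqs N \<times> (freqs N \<times> freqs N).
      if fst i + fst (snd i) - snd (snd i) = 0 then b (fst i) * (a (fst (snd i)) * cnj (a (snd (snd i)))) else 0)"
    by (subst torus_integral_trig_sum) auto
  also have "\<dots> = (\<Sum>m\<in>freqs N. b m * autocorr N a (- m))"
    unfolding autocorr_def sum_distrib_left sum.cartesian_product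
    by (intro sum.cong) (auto simp: algebra_simps)
  also have "\<dots> = (\<Sum>m\<in>freqs N. b (- m) * autocorr N a m)"
    by (rule sum.reindex_bij_witness[of _ uminus uminus]) (auto simp: uminus_mem_freqs)
  finally show ?thesis by (simp add: p interaction_N_def pairing_def)
qed

lemma autocorr_eq_sum: "autocorr L a n = (\<Sum>k\<in>{k \<in> freqs L. k - n \<in> freqs L}. a k * cnj (a (k - n)))"
proof -
  have "autocorr L a n = (\<Sum>k\<in>freqs L. if k - n \<in> freqs L then a k * cnj (a (k - n)) else 0)"
    unfolding autocorr_def
  proof (intro sum.cong refl)
    fix k
    have "(\<Sum>l\<in>freqs L. if k - l = n then a k * cnj (a l) else 0)
        = (\<Sum>l\<in>freqs L. if l = k - n then a k * cnj (a (k - n)) else 0)"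
      by (intro sum.cong) auto
    then show "(\<Sum>l\<in>freqs L. if k - l = n then a k * cnj (a l) else 0)
      = (if k - n \<in> freqs L then a k * cnj (a (k - n)) else 0)"
      by simp
  qed
  then show ?thesis by (simp add: sum.inter_filter)
qed

text \<open>This expresses that \<open>|P_L \<phi>|^2\<close> is real. Together with the conjugation
  rule for \<open>b\<close> it folds the pairing onto positive frequencies.\<close>

lemma autocorr_uminus: "autocorr L a (- n) = cnj (autocorr L a n)"
proof -
  have "autocorr L a (- n) = (\<Sum>k\<in>freqs L. \<Sum>l\<in>freqs L. if l - k = n then a k * cnj (a l) else 0)"
    unfolding autocorr_def by (intro sum.cong) auto
  also have "\<dots> = (\<Sum>l\<in>freqs L. \<Sum>k\<in>freqs L. if l - k = n then a k * cnj (a l) else 0)"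
    by (rule sum.swap)
  also have "\<dots> = cnj (autocorr L a n)"
    unfolding autocorr_def cnj_sum by (intro sum.cong) auto
  finally show ?thesis .
qed

section \<open>Removing the truncations\<close>

lemma summable_on_autocorr:
  fixes a :: "int \<Rightarrow> complex"
  assumes "(\<lambda>n. (cmod (a n))\<^sup>2) summable_on UNIV"
  shows "(\<lambda>k. a k * cnj (a (k - n))) summable_on UNIV"
proof -
  have "(\<lambda>k. (cmod (a (k - n)))\<^sup>2) summable_on UNIV"
    using assms summable_on_reindex_bij_betw[of "\<lambda>k. k - n" UNIV UNIV "\<lambda>n. (cmod (a n))\<^sup>2"]
    by (simp add: bij_betw_def inj_def surj_def)
  then have "(\<lambda>k. (cmod (a k))\<^sup>2 + (cmod (a (k - n)))\<^sup>2) summable_on UNIV"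
    using assms by (intro summable_on_add)
  then have "(\<lambda>k. norm (a k * cnj (a (k - n)))) summable_on UNIV"
  proof (rule summable_on_comparison_test)
    fix k
    have "2 * (cmod (a k) * cmod (a (k - n))) \<le> (cmod (a k))\<^sup>2 + (cmod (a (k - n)))\<^sup>2"
      using sum_squares_bound[of "cmod (a k)" "cmod (a (k - n))"] by simp
    moreover have "0 \<le> cmod (a k) * cmod (a (k - n))" by simp
    ultimately show "norm (a k * cnj (a (k - n))) \<le> (cmod (a k))\<^sup>2 + (cmod (a (k - n)))\<^sup>2"
      unfolding norm_mult complex_mod_cnj by linarith
  qed auto
  then show ?thesis by (rule abs_summable_summable)
qed

text \<open>Sums over all integers are limits along finite subsets, whereas truncations are
  sequences. The sets are general because two exhaustions occur: \<open>freqs L\<close>, and the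
  windows in which both \<open>k\<close> and \<open>k - n\<close> lie in
  \<open>freqs L\<close>.\<close>

lemma filterlim_finite_exhaustion:
  fixes S :: "nat \<Rightarrow> int set"
  assumes "\<And>L. finite (S L)" "mono S" "(\<Union>L. S L) = UNIV"
  shows "filterlim S (finite_subsets_at_top UNIV) sequentially"
  unfolding filterlim_finite_subsets_at_top
proof (intro allI impI)
  fix X :: "int set" assume X: "finite X \<and> X \<subseteq> UNIV"
  have "\<exists>L. X \<subseteq> S L"
  proof (rule finite_subset_Union_chain[of X "range S" UNIV])
    show "subset.chain UNIV (range S)"
      unfolding subset_chain_def using monoD[OF assms(2)] by (metis UNIV_I linear rangeE subsetI)
  qed (use X assms(3) in auto)
  then obtain L where "X \<subseteq> S L" ..
  then show "\<forall>\<^sub>F L in sequentially. finite (S L) \<and> X \<subseteq> S L \<and> S L \<subseteq> UNIV"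
    unfolding eventually_sequentially using assms(1) monoD[OF assms(2)] by blast
qed

lemma mem_freqs_large: "nat \<bar>n\<bar> \<le> L \<Longrightarrow> n \<in> freqs L"
  by (auto simp: freqs_def)

lemma freqs_mono: "L \<le> M \<Longrightarrow> freqs L \<subseteq> freqs M"
  by (auto simp: freqs_def)

lemma filterlim_freqs: "filterlim freqs (finite_subsets_at_top UNIV) sequentially"
  by (intro filterlim_finite_exhaustion monoI freqs_mono) (auto intro: mem_freqs_large)

text \<open>The windows of \<open>autocorr_eq_sum\<close> exhaust the integers, so the truncated
  coefficients converge to an absolutely convergent sum; in particular the \<open>lim\<close> in
  \<open>abs_sq_coeff\<close> is a genuine limit.\<close>

lemma autocorr_tendsto:
  fixes a :: "int \<Rightarrow> complex"
  assumes "(\<lambda>n. (cmod (a n))\<^sup>2) summable_on UNIV"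
  shows "(\<lambda>L. autocorr L a n) \<longlonglongrightarrow> abs_sq_coeff a n"
proof -
  let ?S = "\<lambda>L. {k \<in> freqs L. k - n \<in> freqs L}"
  obtain s where s: "((\<lambda>k. a k * cnj (a (k - n))) has_sum s) UNIV"
    using summable_on_autocorr[OF assms] by (auto simp: summable_on_def)
  have lim: "filterlim ?S (finite_subsets_at_top UNIV) sequentially"
  proof (rule filterlim_finite_exhaustion)
    show "mono ?S" using freqs_mono by (force intro!: monoI)
    have "k \<in> ?S (nat \<bar>k\<bar> + nat \<bar>k - n\<bar>)" for k by (simp add: freqs_def)
    then show "(\<Union>L. ?S L) = UNIV" by blast
  qed simp
  have "(\<lambda>L. autocorr L a n) \<longlonglongrightarrow> s"
    unfolding autocorr_eq_sum
    using filterlim_compose[OF s[unfolded has_sum_def] lim] .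
  then show ?thesis
    unfolding abs_sq_coeff_def fourier_coeff_abs_sq using limI by metis
qed

lemma pairing_tendsto_inner:
  assumes "(\<lambda>n. (cmod (fst p n))\<^sup>2) summable_on UNIV"
  shows "(\<lambda>L. pairing M L p) \<longlonglongrightarrow> Re (\<Sum>n\<in>freqs M. snd p (- n) * abs_sq_coeff (fst p) n)"
  unfolding pairing_def by (intro tendsto_intros autocorr_tendsto assms)

lemma pairing_tendsto_outer:
  assumes "(\<lambda>n. snd p (- n) * abs_sq_coeff (fst p) n) summable_on UNIV"
  shows "(\<lambda>M. Re (\<Sum>n\<in>freqs M. snd p (- n) * abs_sq_coeff (fst p) n)) \<longlonglongrightarrow> interaction p"
proof -
  have "((\<lambda>n. snd p (- n) * abs_sq_coeff (fst p) n) has_sum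
     (\<Sum>\<^sub>\<infinity>n\<in>UNIV. snd p (- n) * abs_sq_coeff (fst p) n)) UNIV"
    using assms by (rule has_sum_infsum)
  then have "(\<lambda>M. \<Sum>n\<in>freqs M. snd p (- n) * abs_sq_coeff (fst p) n) \<longlonglongrightarrow>
     (\<Sum>\<^sub>\<infinity>n\<in>UNIV. snd p (- n) * abs_sq_coeff (fst p) n)"
    unfolding has_sum_def using filterlim_freqs by (rule filterlim_compose)
  then show ?thesis unfolding interaction_def split_beta by (rule tendsto_Re)
qed

text \<open>The summand \<open>1\<close> covers a divergent series, for which \<^const>\<open>infsum\<close> is \<open>0\<close>.\<close>

lemma exp_interaction_le_liminf:
  assumes "(\<lambda>n. (cmod (fst p n))\<^sup>2) summable_on UNIV"
  shows "ennreal (exp (- c * interaction p))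
    \<le> 1 + liminf (\<lambda>M. liminf (\<lambda>L. ennreal (exp (- c * pairing M L p))))"
proof (cases "(\<lambda>n. snd p (- n) * abs_sq_coeff (fst p) n) summable_on UNIV")
  case True
  have "liminf (\<lambda>L. ennreal (exp (- c * pairing M L p)))
     = ennreal (exp (- c * Re (\<Sum>n\<in>freqs M. snd p (- n) * abs_sq_coeff (fst p) n)))" for M
    by (intro lim_imp_Liminf tendsto_intros pairing_tendsto_inner assms) simp
  moreover have "liminf (\<lambda>M. ennreal (exp (- c * Re (\<Sum>n\<in>freqs M. snd p (- n) * abs_sq_coeff (fst p) n))))
     = ennreal (exp (- c * interaction p))"
    by (intro lim_imp_Liminf tendsto_intros pairing_tendsto_outer True) simp
  ultimately show ?thesis by simp
next
  case False
  then have "interaction p = 0"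
    by (simp add: interaction_def split_beta infsum_not_exists)
  then show ?thesis by simp
qed

section \<open>Exponential integrability of the interaction\<close>

lemma summable_on_int_abs:
  fixes g :: "nat \<Rightarrow> real"
  assumes "summable g" "\<And>n. 0 \<le> g n"
  shows "(\<lambda>n::int. g (nat \<bar>n\<bar>)) summable_on UNIV"
proof -
  have g: "g summable_on UNIV"
    using assms by (intro norm_summable_imp_summable_on) simp
  have "(\<lambda>n::int. g (nat \<bar>n\<bar>)) summable_on range int"
    using g by (subst summable_on_reindex) (auto simp: o_def)
  moreover have "(\<lambda>n::int. g (nat \<bar>n\<bar>)) summable_on range (\<lambda>n. - int n)"
    using g by (subst summable_on_reindex) (auto simp: o_def inj_on_def)
  ultimately have "(\<lambda>n::int. g (nat \<bar>n\<bar>)) summable_on (range int \<union> range (\<lambda>n. - int n))"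
    by (rule summable_on_union)
  moreover have "range int \<union> range (\<lambda>n. - int n) = UNIV"
  proof (intro UNIV_eq_I[symmetric])
    fix n :: int
    show "n \<in> range int \<union> range (\<lambda>n. - int n)"
      by (cases n rule: int_cases2) auto
  qed
  ultimately show ?thesis by simp
qed

text \<open>The exponent arises as \<open>1 / n\<close> times the gain \<open>n^(-1/2)\<close> of
  the autocorrelations, and again as the energy weight \<open>sqrt n\<close> times the variance
  \<open>1 / n^2\<close>. At \<open>n = 0\<close> the value is \<open>0\<close>, by the convention
  for \<open>powr\<close>.\<close>

definition wt :: "int \<Rightarrow> real" where
  "wt n = \<bar>of_int n\<bar> powr (- 3 / 2)"

lemma wt_nonneg [simp]: "0 \<le> wt n"
  by (simp add: wt_def)

lemma wt_altdef: "n \<noteq> 0 \<Longrightarrow> wt n = 1 / (\<bar>of_int n\<bar> * sqrt \<bar>of_int n\<bar>)"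
proof -
  assume "n \<noteq> 0"
  then have "wt n = 1 / (\<bar>of_int n\<bar> powr (1 + 1/2))"
    by (simp add: wt_def powr_minus_divide flip: powr_minus)
  also have "\<bar>real_of_int n\<bar> powr (1 + 1/2) = \<bar>of_int n\<bar> * sqrt \<bar>of_int n\<bar>"
    using \<open>n \<noteq> 0\<close> unfolding powr_add by (simp add: powr_half_sqrt)
  finally show ?thesis .
qed

lemma wt_le_1: "wt n \<le> 1"
proof (cases "n = 0")
  case False
  then have "1 \<le> \<bar>real_of_int n\<bar>" by linarith
  then show ?thesis unfolding wt_def by (simp add: powr_le1 powr_minus_divide ge_one_powr_ge_zero flip: powr_minus)
qed (simp add: wt_def)

lemma summable_on_wt: "wt summable_on UNIV"
proof -
  have "summable (\<lambda>n. real n powr (- 3 / 2))"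
    by (subst summable_real_powr_iff) simp
  from summable_on_int_abs[OF this] show ?thesis
    by (simp add: wt_def[abs_def])
qed

definition wt_sum :: real where "wt_sum = infsum wt UNIV"

lemma sum_wt_le: "finite J \<Longrightarrow> sum wt J \<le> wt_sum"
  unfolding wt_sum_def by (intro finite_sum_le_infsum summable_on_wt) auto

lemma wt_sum_nonneg: "0 \<le> wt_sum"
  using sum_wt_le[of "{}"] by simp

lemma wt_tail:
  assumes "0 < \<epsilon>"
  obtains I where "finite I" "\<And>J. finite J \<Longrightarrow> J \<inter> I = {} \<Longrightarrow> sum wt J \<le> \<epsilon>"
proof -
  have "(sum wt \<longlongrightarrow> wt_sum) (finite_subsets_at_top UNIV)"
    using has_sum_infsum[OF summable_on_wt] by (simp add: has_sum_def wt_sum_def)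
  from order_tendstoD(1)[OF this, of "wt_sum - \<epsilon>"] assms
  obtain I where I: "finite I" "wt_sum - \<epsilon> < sum wt I"
    unfolding eventually_finite_subsets_at_top by auto
  show thesis
  proof (rule that[OF I(1)])
    fix J :: "int set" assume J: "finite J" "J \<inter> I = {}"
    have "sum wt J + sum wt I = sum wt (J \<union> I)"
      using I J by (simp add: sum.union_disjoint)
    also have "\<dots> \<le> wt_sum" using I J by (intro sum_wt_le) auto
    finally show "sum wt J \<le> \<epsilon>" using I by simp
  qed
qed

lemma zero_mem_freqs [simp]: "0 \<in> freqs N"
  by (simp add: freqs_def)

definition mass :: "nat \<Rightarrow> (int \<Rightarrow> complex) \<Rightarrow> real" where
  "mass L a = (\<Sum>k\<in>freqs L. (cmod (a k))\<^sup>2)"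

text \<open>The square of the homogeneous \<open>H^(1/4)\<close> seminorm. Its weight grows, which
  forces decay of the autocorrelations, yet slowly enough that the form keeps exponential moments
  under the Gaussian law, uniformly in \<open>L\<close>.\<close>

definition energy :: "nat \<Rightarrow> (int \<Rightarrow> complex) \<Rightarrow> real" where
  "energy L a = (\<Sum>k\<in>freqs L. sqrt \<bar>of_int k\<bar> * (cmod (a k))\<^sup>2)"

lemma energy_nonneg: "0 \<le> energy L a"
  by (auto simp: energy_def intro!: sum_nonneg)

text \<open>Cauchy-Schwarz; \<open>K\<close> and its translate by \<open>n\<close> both lie in
  \<open>freqs L\<close>, so each factor is at most the full sum. Two weights are carried so that
  either of the two modes can receive the growing one.\<close>

lemma weighted_correlation_le:
  fixes a :: "int \<Rightarrow> complex" and f g :: "int \<Rightarrow> real"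
  assumes K: "K = {k \<in> freqs L. k - n \<in> freqs L}"
  shows "(\<Sum>k\<in>K. \<bar>f k * cmod (a k)\<bar> * \<bar>g (k - n) * cmod (a (k - n))\<bar>)
    \<le> sqrt (\<Sum>k\<in>freqs L. (f k)\<^sup>2 * (cmod (a k))\<^sup>2) * sqrt (\<Sum>k\<in>freqs L. (g k)\<^sup>2 * (cmod (a k))\<^sup>2)"
proof -
  have "(\<Sum>k\<in>K. \<bar>f k * cmod (a k)\<bar> * \<bar>g (k - n) * cmod (a (k - n))\<bar>)
    \<le> L2_set (\<lambda>k. f k * cmod (a k)) K * L2_set (\<lambda>k. g (k - n) * cmod (a (k - n))) K"
    by (rule L2_set_mult_ineq)
  also have "\<dots> \<le> sqrt (\<Sum>k\<in>freqs L. (f k)\<^sup>2 * (cmod (a k))\<^sup>2) * sqrt (\<Sum>k\<in>freqs L. (g k)\<^sup>2 * (cmod (a k))\<^sup>2)"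
  proof (intro mult_mono)
    show "L2_set (\<lambda>k. f k * cmod (a k)) K \<le> sqrt (\<Sum>k\<in>freqs L. (f k)\<^sup>2 * (cmod (a k))\<^sup>2)"
      unfolding L2_set_def power_mult_distrib K
      by (intro real_sqrt_le_mono sum_mono2) auto
    have "(\<Sum>k\<in>K. (g (k - n))\<^sup>2 * (cmod (a (k - n)))\<^sup>2) = (\<Sum>k\<in>(\<lambda>k. k - n) ` K. (g k)\<^sup>2 * (cmod (a k))\<^sup>2)"
      by (subst sum.reindex) (auto simp: inj_on_def)
    also have "\<dots> \<le> (\<Sum>k\<in>freqs L. (g k)\<^sup>2 * (cmod (a k))\<^sup>2)"
      unfolding K by (intro sum_mono2) auto
    finally show "L2_set (\<lambda>k. g (k - n) * cmod (a (k - n))) K \<le> sqrt (\<Sum>k\<in>freqs L. (g k)\<^sup>2 * (cmod (a k))\<^sup>2)"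
      unfolding L2_set_def power_mult_distrib by (rule real_sqrt_le_mono)
  qed (auto intro!: sum_nonneg)
  finally show ?thesis .
qed

lemma norm_autocorr_le_mass: "cmod (autocorr L a n) \<le> mass L a"
proof -
  have "cmod (autocorr L a n) \<le> (\<Sum>k\<in>{k \<in> freqs L. k - n \<in> freqs L}. \<bar>1 * cmod (a k)\<bar> * \<bar>1 * cmod (a (k - n))\<bar>)"
    unfolding autocorr_eq_sum by (rule order_trans[OF norm_sum]) (simp add: norm_mult)
  also have "\<dots> \<le> sqrt (mass L a) * sqrt (mass L a)"
    using weighted_correlation_le[OF refl, where f = "\<lambda>_. 1" and g = "\<lambda>_. 1" and a = a and n = n and L = L] by (simp add: mass_def)
  also have "\<dots> = mass L a" by (simp add: mass_def sum_nonneg)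
  finally show ?thesis .
qed

text \<open>One of the two frequencies \<open>k\<close>, \<open>k - n\<close> of each summand is of size at least \<open>n / 2\<close>.\<close>

lemma sqrt_norm_autocorr_le: "sqrt \<bar>of_int n\<bar> * (cmod (autocorr L a n))\<^sup>2 \<le> 4 * mass L a * energy L a"
proof -
  \<comment> \<open>This is \<open>|k|^(1/4)\<close>, written as an iterated root so that
    subadditivity of \<open>sqrt\<close> can be applied twice.\<close>
  define w where "w k = sqrt (sqrt \<bar>real_of_int k\<bar>)" for k
  let ?K = "{k \<in> freqs L. k - n \<in> freqs L}"
  have w: "w n \<le> w k + w (k - n)" for k
  proof -
    have "\<bar>real_of_int n\<bar> \<le> \<bar>of_int k\<bar> + \<bar>of_int (k - n)\<bar>" by linarith
    then have "sqrt \<bar>real_of_int n\<bar> \<le> sqrt (\<bar>of_int k\<bar> + \<bar>of_int (k - n)\<bar>)" by (rule real_sqrt_le_mono)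
    also have "\<dots> \<le> sqrt \<bar>of_int k\<bar> + sqrt \<bar>of_int (k - n)\<bar>" by (rule sqrt_add_le_add_sqrt) auto
    finally have "w n \<le> sqrt (sqrt \<bar>of_int k\<bar> + sqrt \<bar>of_int (k - n)\<bar>)"
      unfolding w_def by (rule real_sqrt_le_mono)
    also have "\<dots> \<le> w k + w (k - n)" unfolding w_def by (rule sqrt_add_le_add_sqrt) auto
    finally show ?thesis .
  qed
  have w0: "0 \<le> w k" for k by (simp add: w_def)
  have w2: "(w k)\<^sup>2 = sqrt \<bar>of_int k\<bar>" for k by (simp add: w_def)
  have "w n * cmod (autocorr L a n) \<le> w n * (\<Sum>k\<in>?K. cmod (a k) * cmod (a (k - n)))"
    unfolding autocorr_eq_sum using w0
    by (intro mult_left_mono order_trans[OF norm_sum]) (simp_all add: norm_mult)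
  also have "\<dots> \<le> (\<Sum>k\<in>?K. (w k + w (k - n)) * (cmod (a k) * cmod (a (k - n))))"
    unfolding sum_distrib_left by (intro sum_mono mult_right_mono w) auto
  also have "\<dots> = (\<Sum>k\<in>?K. \<bar>w k * cmod (a k)\<bar> * \<bar>1 * cmod (a (k - n))\<bar>)
      + (\<Sum>k\<in>?K. \<bar>1 * cmod (a k)\<bar> * \<bar>w (k - n) * cmod (a (k - n))\<bar>)"
    using w0 by (simp add: abs_mult algebra_simps flip: sum.distrib)
  also have "\<dots> \<le> sqrt (energy L a) * sqrt (mass L a) + sqrt (mass L a) * sqrt (energy L a)"
    using weighted_correlation_le[OF refl, where f = w and g = "\<lambda>_. 1" and a = a and n = n and L = L] weighted_correlation_le[OF refl, where f = "\<lambda>_. 1" and g = w and a = a and n = n and L = L]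
    by (intro add_mono) (simp_all add: mass_def energy_def w2)
  also have "\<dots> = 2 * sqrt (mass L a * energy L a)"
    by (simp add: real_sqrt_mult)
  finally have "(w n * cmod (autocorr L a n))\<^sup>2 \<le> (2 * sqrt (mass L a * energy L a))\<^sup>2"
    using w0 by (intro power_mono) auto
  also have "\<dots> = 4 * mass L a * energy L a"
    by (simp add: power_mult_distrib mass_def energy_nonneg sum_nonneg)
  finally show ?thesis by (simp add: power_mult_distrib w2)
qed

text \<open>The finite set \<open>I\<close> of low frequencies depends only on
  \<open>\<epsilon>\<close> and \<open>B\<close>. On it the mass bound gives at most
  \<open>B^4\<close> per frequency; off it the tail of \<open>wt\<close> is at most
  \<open>\<epsilon> / (4 * B\<^sup>2)\<close>, which cancels the factor \<open>4 * mass L a\<close>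
  of the decay estimate. Hence \<open>C\<close> is uniform in \<open>J\<close>, \<open>L\<close> and
  \<open>a\<close>.\<close>

lemma autocorr_log_bound:
  fixes B \<epsilon> :: real
  assumes "0 < B" "0 < \<epsilon>"
  obtains C where "0 \<le> C" "\<And>J L a. finite J \<Longrightarrow> J \<subseteq> {1..} \<Longrightarrow> mass L a \<le> B\<^sup>2 \<Longrightarrow>
    (\<Sum>n\<in>J. (cmod (autocorr L a n))\<^sup>2 / of_int n) \<le> C + \<epsilon> * energy L a"
proof -
  have "0 < \<epsilon> / (4 * B\<^sup>2)" using assms by simp
  then obtain I where I: "finite I" "\<And>J. finite J \<Longrightarrow> J \<inter> I = {} \<Longrightarrow> sum wt J \<le> \<epsilon> / (4 * B\<^sup>2)"
    using wt_tail by metis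
  show thesis
  proof (rule that[of "card I * B^4"])
    fix J :: "int set" and L and a :: "int \<Rightarrow> complex" assume J: "finite J" "J \<subseteq> {1..}" and m: "mass L a \<le> B\<^sup>2"
    let ?q = "\<lambda>n. (cmod (autocorr L a n))\<^sup>2 / of_int n"
    have "sum ?q J = sum ?q (J \<inter> I) + sum ?q (J - I)"
      using J by (subst sum.Int_Diff[where B = I]) auto
    also have "sum ?q (J \<inter> I) \<le> (\<Sum>n\<in>J \<inter> I. B^4)"
    proof (rule sum_mono)
      fix n assume "n \<in> J \<inter> I"
      then have "1 \<le> n" using J by auto
      have "(cmod (autocorr L a n))\<^sup>2 \<le> (B\<^sup>2)\<^sup>2"
        using norm_autocorr_le_mass[of L a n] m by (intro power_mono) auto
      moreover have "?q n \<le> (cmod (autocorr L a n))\<^sup>2 / 1"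
        using \<open>1 \<le> n\<close> by (intro divide_left_mono) auto
      ultimately show "?q n \<le> B^4" by simp
    qed
    also have "\<dots> \<le> card I * B^4"
      using I(1) by (auto intro!: mult_right_mono card_mono)
    also have "sum ?q (J - I) \<le> (\<Sum>n\<in>J - I. 4 * B\<^sup>2 * energy L a * wt n)"
    proof (rule sum_mono)
      fix n assume "n \<in> J - I"
      then have n: "1 \<le> n" using J by auto
      have "sqrt \<bar>of_int n\<bar> * (cmod (autocorr L a n))\<^sup>2 \<le> 4 * mass L a * energy L a"
        by (rule sqrt_norm_autocorr_le)
      also have "\<dots> \<le> 4 * B\<^sup>2 * energy L a"
        using m by (intro mult_right_mono energy_nonneg) auto
      finally have "(sqrt \<bar>of_int n\<bar> * (cmod (autocorr L a n))\<^sup>2) * wt n \<le> 4 * B\<^sup>2 * energy L a * wt n"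
        by (intro mult_right_mono) auto
      then show "?q n \<le> 4 * B\<^sup>2 * energy L a * wt n"
        using n by (simp add: wt_altdef)
    qed
    also have "\<dots> = 4 * B\<^sup>2 * energy L a * sum wt (J - I)"
      by (simp add: sum_distrib_left)
    also have "\<dots> \<le> 4 * B\<^sup>2 * energy L a * (\<epsilon> / (4 * B\<^sup>2))"
      using I(2)[of "J - I"] J by (intro mult_left_mono) (auto simp: energy_nonneg)
    finally show "sum ?q J \<le> card I * B^4 + \<epsilon> * energy L a" using assms by (simp add: mult.commute)
  qed simp
qed

section \<open>Integrating out first \<open>b\<close>, then \<open>a\<close>\<close>

definition mode_a :: "int set \<Rightarrow> complex \<Rightarrow> (int \<Rightarrow> complex) \<Rightarrow> int \<Rightarrow> complex" where
  "mode_a F a0 x n = (if n = 0 then a0 else if n \<in> F then x n else 0)"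

lemma fst_modes_of: "fst (modes_of F z x y) = mode_a F (fst z) x"
  by (auto simp: modes_of_def from_coords_def mode_a_def)

lemma snd_modes_of_0: "snd (modes_of F z x y) 0 = of_real (snd z)"
  by (simp add: modes_of_def)

text \<open>The terms at \<open>n\<close> and \<open>- n\<close> are conjugate, whence the factor
  \<open>2\<close>. The zero mode is kept apart because \<open>b_0\<close> carries Lebesgue measure
  and a cutoff instead of a Gaussian law.\<close>

lemma pairing_modes_of:
  fixes z :: "complex \<times> real" and x :: "int \<Rightarrow> complex" and L :: nat
  assumes F: "\<And>n. n \<in> F \<Longrightarrow> - n \<in> F"
  defines "q \<equiv> autocorr L (mode_a F (fst z) x)"
  shows "pairing M L (modes_of F z x y) =
    snd z * Re (q 0) + (\<Sum>n\<in>{n \<in> F \<inter> freqs M. n \<ge> 1}. 2 * Re (q n * cnj (y n)))"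
proof -
  let ?p = "modes_of F z x y" and ?P = "{n \<in> freqs M. n \<ge> 1}"
  have F': "- n \<in> F \<longleftrightarrow> n \<in> F" for n using F[of n] F[of "- n"] by auto
  have q: "q (- n) = cnj (q n)" for n unfolding q_def by (rule autocorr_uminus)
  have "0 \<in> freqs M" by (simp add: freqs_def)
  then have "pairing M L ?p = Re (snd ?p 0 * q 0 + (\<Sum>n\<in>freqs M - {0}. snd ?p (- n) * q n))"
    unfolding pairing_def fst_modes_of q_def[symmetric]
    by (subst sum.remove[of _ 0]) auto
  also have "\<dots> = snd z * Re (q 0) + (\<Sum>n\<in>?P. Re (snd ?p (- n) * q n + snd ?p n * cnj (q n)))"
    by (simp add: sum_freqs_symmetric snd_modes_of_0 q)
  also have "(\<Sum>n\<in>?P. Re (snd ?p (- n) * q n + snd ?p n * cnj (q n)))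
     = (\<Sum>n\<in>?P. if n \<in> F then 2 * Re (q n * cnj (y n)) else 0)"
    by (intro sum.cong) (auto simp: modes_of_def from_coords_def F')
  also have "\<dots> = (\<Sum>n\<in>{n \<in> F \<inter> freqs M. n \<ge> 1}. 2 * Re (q n * cnj (y n)))"
    by (subst sum.inter_filter[symmetric]) (auto intro!: sum.cong)
  finally show ?thesis .
qed

text \<open>The coefficient of \<open>y n\<close> is \<open>- 2 * c * q_n\<close>, and the Gaussian
  formula turns it into \<open>c^2 * |q_n|^2 / (\<kappa> * n)\<close>. Having an identity matters:
  it yields the upper bound on the moments and, because the last sum is nonnegative, the lower bound
  on the partition functions.\<close>

lemma nn_integral_b_law_pairing:
  fixes L :: nat
  assumes \<kappa>: "\<kappa> > 0" and F: "\<And>n. n \<in> F \<Longrightarrow> - n \<in> F"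
  defines "q \<equiv> \<lambda>z x. autocorr L (mode_a F (fst z) x)"
  shows "(\<integral>\<^sup>+y. ennreal (exp (- c * pairing M L (modes_of F z x y))) \<partial>b_law \<kappa> F)
    = ennreal (exp (- c * snd z * Re (q z x 0) +
        c\<^sup>2 / \<kappa> * (\<Sum>n\<in>{n \<in> F \<inter> freqs M. n \<ge> 1}. (cmod (q z x n))\<^sup>2 / of_int n)))"
proof -
  let ?J = "{n \<in> F \<inter> freqs M. n \<ge> 1}"
  have J: "finite ?J" by (rule finite_subset[of _ "freqs M"]) auto
  have "- c * pairing M L (modes_of F z x y) = - c * snd z * Re (q z x 0) +
     (\<Sum>n\<in>?J. Re ((- 2 * of_real c * q z x n) * cnj (y n)))" for y
  proof -
    have "pairing M L (modes_of F z x y) = snd z * Re (q z x 0) + (\<Sum>n\<in>?J. 2 * Re (q z x n * cnj (y n)))"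
      unfolding q_def by (rule pairing_modes_of[OF F])
    then show ?thesis
      by (simp add: distrib_left sum_distrib_left algebra_simps flip: sum_negf)
  qed
  note eq = this
  have "(\<integral>\<^sup>+y. ennreal (exp (- c * pairing M L (modes_of F z x y))) \<partial>b_law \<kappa> F)
    = (\<integral>\<^sup>+y. ennreal (exp (- c * snd z * Re (q z x 0))) *
        ennreal (exp (\<Sum>n\<in>?J. Re ((- 2 * of_real c * q z x n) * cnj (y n)))) \<partial>b_law \<kappa> F)"
    by (simp only: eq exp_add ennreal_mult exp_ge_zero)
  also have "\<dots> = ennreal (exp (- c * snd z * Re (q z x 0))) *
       (\<integral>\<^sup>+y. ennreal (exp (\<Sum>n\<in>?J. Re ((- 2 * of_real c * q z x n) * cnj (y n)))) \<partial>b_law \<kappa> F)"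
  proof (rule nn_integral_cmult)
    have "(\<lambda>y. Re ((- 2 * of_real c * q z x n) * cnj (y n))) \<in> borel_measurable (b_law \<kappa> F)"
      if "n \<in> ?J" for n
      using that measurable_b_law_component[of n F \<kappa>]
      by (intro borel_measurable_continuous_on[where f = "\<lambda>w. Re ((- 2 * of_real c * q z x n) * cnj w)"])
        (auto intro!: continuous_intros)
    then have "(\<lambda>y. \<Sum>n\<in>?J. Re ((- 2 * of_real c * q z x n) * cnj (y n))) \<in> borel_measurable (b_law \<kappa> F)"
      by (intro borel_measurable_sum)
    then show "(\<lambda>y. ennreal (exp (\<Sum>n\<in>?J. Re ((- 2 * of_real c * q z x n) * cnj (y n))))) \<in> borel_measurable (b_law \<kappa> F)"
      by measurable
  qed
  also have "\<dots> = ennreal (exp (- c * snd z * Re (q z x 0))) *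
       ennreal (exp (\<Sum>n\<in>?J. (cmod (- 2 * of_real c * q z x n))\<^sup>2 / (4 * \<kappa> * of_int n)))"
    by (subst nn_integral_b_law_exp_linear[OF \<kappa> J]) auto
  also have "(\<Sum>n\<in>?J. (cmod (- 2 * of_real c * q z x n))\<^sup>2 / (4 * \<kappa> * of_int n))
     = c\<^sup>2 / \<kappa> * (\<Sum>n\<in>?J. (cmod (q z x n))\<^sup>2 / of_int n)"
    unfolding sum_distrib_left by (intro sum.cong) (auto simp: norm_mult power_mult_distrib)
  finally show ?thesis by (simp only: exp_add ennreal_mult exp_ge_zero)
qed

lemma energy_mode_a:
  "energy L (mode_a F a0 x) = (\<Sum>k\<in>F \<inter> freqs L - {0}. sqrt \<bar>of_int k\<bar> * (cmod (x k))\<^sup>2)"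
  unfolding energy_def
  by (rule sum.mono_neutral_cong_right) (auto simp: mode_a_def)

text \<open>Each mode contributes \<open>1 / (1 - u)\<close> with
  \<open>u = 2 * \<eta> * wt n\<close>. The bounds on \<open>\<eta>\<close> and \<open>wt\<close>
  give \<open>u \<le> 1 / 2\<close>, where \<open>1 / (1 - u) \<le> exp (2 * u)\<close>; the product
  is then controlled by the sum of \<open>wt\<close>, uniformly in \<open>F\<close> and
  \<open>L\<close>.\<close>

lemma nn_integral_a_law_exp_energy:
  assumes "0 \<le> \<eta>" "\<eta> \<le> 1 / 4"
  shows "(\<integral>\<^sup>+x. ennreal (exp (\<eta> * energy L (mode_a F a0 x))) \<partial>a_law F) \<le> ennreal (exp (4 * \<eta> * wt_sum))"
proof -
  let ?J = "F \<inter> freqs L - {0}"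
  have J: "finite ?J" by (rule finite_subset[of _ "freqs L"]) auto
  have t: "2 * (\<eta> * sqrt \<bar>of_int n\<bar>) / (of_int n)\<^sup>2 = 2 * \<eta> * wt n" if "n \<noteq> 0" for n
  proof -
    have "sqrt \<bar>real_of_int n\<bar> * sqrt \<bar>of_int n\<bar> = \<bar>of_int n\<bar>" by simp
    then have "sqrt \<bar>real_of_int n\<bar> / (of_int n)\<^sup>2 = wt n"
      using that by (simp add: wt_altdef divide_simps power2_eq_square) (simp add: mult_ac)
    then show ?thesis by (simp add: mult.assoc flip: times_divide_eq_right)
  qed
  have le: "2 * \<eta> * wt n \<le> 1 / 2" for n
    using mult_mono[OF assms(2) wt_le_1[of n]] assms by simp
  have "(\<integral>\<^sup>+x. ennreal (exp (\<eta> * energy L (mode_a F a0 x))) \<partial>a_law F)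
    = (\<integral>\<^sup>+x. ennreal (exp (\<Sum>n\<in>?J. (\<eta> * sqrt \<bar>of_int n\<bar>) * (cmod (x n))\<^sup>2)) \<partial>a_law F)"
    by (simp add: energy_mode_a sum_distrib_left mult.assoc)
  also have "\<dots> = ennreal (\<Prod>n\<in>?J. 1 / (1 - 2 * (\<eta> * sqrt \<bar>of_int n\<bar>) / (of_int n)\<^sup>2))"
  proof (rule nn_integral_a_law_exp[OF J])
    fix n assume "n \<in> ?J"
    then have n: "n \<noteq> 0" by auto
    have "2 * (\<eta> * sqrt \<bar>of_int n\<bar>) / (of_int n)\<^sup>2 < 1" using t[OF n] le[of n] by linarith
    then show "2 * (\<eta> * sqrt \<bar>of_int n\<bar>) < (of_int n)\<^sup>2" using n by (simp add: divide_simps split: if_splits)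
  qed auto
  also have "(\<Prod>n\<in>?J. 1 / (1 - 2 * (\<eta> * sqrt \<bar>of_int n\<bar>) / (of_int n)\<^sup>2)) \<le> (\<Prod>n\<in>?J. exp (4 * \<eta> * wt n))"
  proof (intro prod_mono conjI)
    fix n assume "n \<in> ?J"
    then have n: "n \<noteq> 0" by auto
    define u where "u = 2 * \<eta> * wt n"
    have u: "0 \<le> u" "u \<le> 1 / 2" using le[of n] assms by (auto simp: u_def)
    have "u * u \<le> u * (1 / 2)" using u by (intro mult_left_mono)
    then have "1 \<le> (1 + 2 * u) * (1 - u)" by (simp add: algebra_simps)
    then have "1 / (1 - u) \<le> 1 + 2 * u" using u by (simp add: divide_simps)
    also have "\<dots> \<le> exp (2 * u)" by (rule exp_ge_add_one_self)
    finally show "1 / (1 - 2 * (\<eta> * sqrt \<bar>of_int n\<bar>) / (of_int n)\<^sup>2) \<le> exp (4 * \<eta> * wt n)"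
      unfolding t[OF n] u_def by (simp add: mult.assoc)
    show "0 \<le> 1 / (1 - 2 * (\<eta> * sqrt \<bar>of_int n\<bar>) / (of_int n)\<^sup>2)"
      unfolding t[OF n] using u by (simp add: u_def)
  qed
  also have "(\<Prod>n\<in>?J. exp (4 * \<eta> * wt n)) = exp (4 * \<eta> * sum wt ?J)"
    by (simp add: exp_sum J sum_distrib_left)
  also have "\<dots> \<le> exp (4 * \<eta> * wt_sum)"
    using assms by (intro exp_mono mult_left_mono sum_wt_le J) auto
  finally show ?thesis by (simp add: ennreal_leI)
qed

lemma measurable_autocorr [measurable]: "(\<lambda>p. autocorr L (fst p) n) \<in> borel_measurable modes_space"
proof -
  have "(\<lambda>p. fst p k * cnj (fst p l)) \<in> borel_measurable modes_space" for k l
    by (intro borel_measurable_continuous_Pair[where H = "\<lambda>x y. x * cnj y"] measurable_modes_component continuous_intros)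
  then show ?thesis unfolding autocorr_def
    by (intro borel_measurable_sum) auto
qed

lemma measurable_pairing [measurable]: "pairing M L \<in> borel_measurable modes_space"
  unfolding pairing_def by measurable

text \<open>A measurable set depending on finitely many modes. It contains
  \<open>Omega_N L B\<close>, and it contains \<open>Omega B\<close> for every \<open>L\<close>,
  which is what the limit \<open>L\<close> to infinity requires.\<close>

definition cutoff :: "real \<Rightarrow> nat \<Rightarrow> modes set" where
  "cutoff B L = {p. cmod (snd p 0) \<le> B \<and> mass L (fst p) \<le> B\<^sup>2}"

lemma cutoff_sets [measurable]: "cutoff B L \<in> sets modes_space"
proof -
  have "{p \<in> space modes_space. cmod (snd p 0) \<le> B \<and> mass L (fst p) \<le> B\<^sup>2} \<in> sets modes_space"
    unfolding mass_def by measurable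
  then show ?thesis by (simp add: cutoff_def)
qed

text \<open>Lebesgue measure of the zero mode is infinite, so every estimate keeps the zero mode in
  this box of finite measure.\<close>

definition zero_box :: "real \<Rightarrow> (complex \<times> real) set" where
  "zero_box B = cball 0 B \<times> cball 0 B"

lemma zero_box_sets [measurable]: "zero_box B \<in> sets borel"
  unfolding zero_box_def by (intro borel_closed closed_Times) auto

lemma emeasure_zero_box_finite: "emeasure lborel (zero_box B) < \<infinity>"
  unfolding zero_box_def by (intro emeasure_bounded_finite bounded_Times bounded_cball)

lemma cutoff_modes_of: 
  assumes "0 < B" shows "modes_of F z x y \<in> cutoff B L \<longleftrightarrow> \<bar>snd z\<bar> \<le> B \<and> mass L (mode_a F (fst z) x) \<le> B\<^sup>2"
    and "modes_of F z x y \<in> cutoff B L \<Longrightarrow> z \<in> zero_box B"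
proof -
  show *: "modes_of F z x y \<in> cutoff B L \<longleftrightarrow> \<bar>snd z\<bar> \<le> B \<and> mass L (mode_a F (fst z) x) \<le> B\<^sup>2"
    by (simp add: cutoff_def fst_modes_of snd_modes_of_0)
  assume "modes_of F z x y \<in> cutoff B L"
  then have **: "\<bar>snd z\<bar> \<le> B" "mass L (mode_a F (fst z) x) \<le> B\<^sup>2" using * by auto
  have "(cmod (mode_a F (fst z) x 0))\<^sup>2 \<le> mass L (mode_a F (fst z) x)"
    unfolding mass_def by (rule member_le_sum) auto
  also have "\<dots> \<le> B\<^sup>2" by (rule **)
  also have "mode_a F (fst z) x 0 = fst z" by (simp add: mode_a_def)
  finally have "cmod (fst z) \<le> B" using assms by (rule power2_le_imp_le[OF _ less_imp_le])
  then show "z \<in> zero_box B" using ** assms by (cases z) (auto simp: zero_box_def)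
qed

text \<open>The constant is uniform in \<open>F\<close>, for the family of truncated measures, and
  separately in \<open>M\<close> and \<open>L\<close>, for the two limits behind the full
  interaction.\<close>

lemma exp_pairing_bound:
  fixes \<kappa> B c :: real
  assumes \<kappa>: "\<kappa> > 0" and B: "B > 0"
  obtains C where "0 \<le> C" "\<And>F M L. (\<And>n. n \<in> F \<Longrightarrow> - n \<in> F) \<Longrightarrow>
     (\<integral>\<^sup>+p. ennreal (exp (- c * pairing M L p)) * indicator (cutoff B L) p \<partial>with_zero_mode (gauss_law \<kappa> F)) \<le> ennreal C"
proof -
  \<comment> \<open>Chosen so that the resulting energy coefficient
    \<open>\<eta> = c^2 / (4 * (1 + c^2))\<close> stays below the threshold \<open>1 / 4\<close>;
    the summand \<open>1\<close> keeps the denominator positive when \<open>c = 0\<close>.\<close>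
  define \<epsilon> where "\<epsilon> = \<kappa> / (4 * (1 + c\<^sup>2))"
  have \<epsilon>: "0 < \<epsilon>" using \<kappa> by (simp add: \<epsilon>_def add_pos_nonneg)
  define \<eta> where "\<eta> = c\<^sup>2 / \<kappa> * \<epsilon>"
  have "\<eta> = c\<^sup>2 / (4 * (1 + c\<^sup>2))" using \<kappa> by (simp add: \<eta>_def \<epsilon>_def)
  moreover have "0 < 1 + c\<^sup>2" by (simp add: add_pos_nonneg)
  ultimately have \<eta>: "0 \<le> \<eta>" "\<eta> \<le> 1 / 4"
    by (simp_all add: pos_divide_le_eq)
  obtain C0 where C0: "0 \<le> C0" "\<And>J L a. finite J \<Longrightarrow> J \<subseteq> {1..} \<Longrightarrow> mass L a \<le> B\<^sup>2 \<Longrightarrow>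
    (\<Sum>n\<in>J. (cmod (autocorr L a n))\<^sup>2 / of_int n) \<le> C0 + \<epsilon> * energy L a"
    by (rule autocorr_log_bound[OF B \<epsilon>]) blast
  \<comment> \<open>The first term bounds the zero mode, where \<open>|b_0| \<le> B\<close> and
    \<open>|q_0| \<le> B^2\<close>; the second is the part of the autocorrelation sum not charged to
    the energy.\<close>
  define D where "D = \<bar>c\<bar> * B * B\<^sup>2 + c\<^sup>2 / \<kappa> * C0"
  define V where "V = measure lborel (zero_box B)"
  have V: "emeasure lborel (zero_box B) = ennreal V"
    unfolding V_def using emeasure_zero_box_finite[of B] by (intro emeasure_eq_ennreal_measure) auto
  show thesis
  proof (rule that[of "exp D * exp (4 * \<eta> * wt_sum) * V"])
    show "0 \<le> exp D * exp (4 * \<eta> * wt_sum) * V" by (simp add: V_def)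
    fix F :: "int set" and M L assume F: "\<And>n. n \<in> F \<Longrightarrow> - n \<in> F"
    let ?J = "{n \<in> F \<inter> freqs M. n \<ge> 1}"
    have J: "finite ?J" by (rule finite_subset[of _ "freqs M"]) auto
    have inner: "(\<integral>\<^sup>+y. ennreal (exp (- c * pairing M L (modes_of F z x y))) * indicator (cutoff B L) (modes_of F z x y) \<partial>b_law \<kappa> F)
      \<le> ennreal (exp D) * ennreal (exp (\<eta> * energy L (mode_a F (fst z) x))) * indicator (zero_box B) z" for z x
    proof (cases "\<bar>snd z\<bar> \<le> B \<and> mass L (mode_a F (fst z) x) \<le> B\<^sup>2")
      case True
      let ?q = "autocorr L (mode_a F (fst z) x)"
      have z: "z \<in> zero_box B" using True cutoff_modes_of[OF B, of F z x undefined L] by simp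
      have "\<bar>Re (?q 0)\<bar> \<le> B\<^sup>2"
        using abs_Re_le_cmod[of "?q 0"] norm_autocorr_le_mass[of L "mode_a F (fst z) x" 0] True by linarith
      then have "\<bar>c * snd z * Re (?q 0)\<bar> \<le> \<bar>c\<bar> * B * B\<^sup>2"
        unfolding abs_mult using True B by (intro mult_mono) auto
      then have 1: "- c * snd z * Re (?q 0) \<le> \<bar>c\<bar> * B * B\<^sup>2" by (simp add: abs_le_iff)
      have "(\<Sum>n\<in>?J. (cmod (?q n))\<^sup>2 / of_int n) \<le> C0 + \<epsilon> * energy L (mode_a F (fst z) x)"
        using True by (intro C0 J) auto
      then have "c\<^sup>2 / \<kappa> * (\<Sum>n\<in>?J. (cmod (?q n))\<^sup>2 / of_int n) \<le> c\<^sup>2 / \<kappa> * (C0 + \<epsilon> * energy L (mode_a F (fst z) x))"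
        using \<kappa> by (intro mult_left_mono) auto
      also have "\<dots> = c\<^sup>2 / \<kappa> * C0 + \<eta> * energy L (mode_a F (fst z) x)"
        by (simp add: \<eta>_def distrib_left mult.assoc)
      finally have 2: "c\<^sup>2 / \<kappa> * (\<Sum>n\<in>?J. (cmod (?q n))\<^sup>2 / of_int n) \<le> \<dots>" .
      have "(\<integral>\<^sup>+y. ennreal (exp (- c * pairing M L (modes_of F z x y))) * indicator (cutoff B L) (modes_of F z x y) \<partial>b_law \<kappa> F)
        \<le> (\<integral>\<^sup>+y. ennreal (exp (- c * pairing M L (modes_of F z x y))) \<partial>b_law \<kappa> F)"
        by (intro nn_integral_mono) (auto simp: indicator_def)
      also have "\<dots> \<le> ennreal (exp (D + \<eta> * energy L (mode_a F (fst z) x)))"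
      proof (rule order_trans[OF eq_refl[OF nn_integral_b_law_pairing[OF \<kappa>]]])
        show "- n \<in> F" if "n \<in> F" for n using F that .
      qed (use 1 2 in \<open>auto simp: D_def intro!: ennreal_leI\<close>)
      also have "\<dots> = ennreal (exp D) * ennreal (exp (\<eta> * energy L (mode_a F (fst z) x))) * indicator (zero_box B) z"
        using z by (simp add: exp_add ennreal_mult)
      finally show ?thesis .
    next
      case False
      then have "modes_of F z x y \<notin> cutoff B L" for y using cutoff_modes_of(1)[OF B, of F z x y L] by blast
      then show ?thesis by simp
    qed
    have mE: "(\<lambda>x. ennreal (exp (\<eta> * energy L (mode_a F (fst z) x)))) \<in> borel_measurable (a_law F)"
      for z :: "complex \<times> real"
    proof -
      have [measurable]: "(\<lambda>p. ennreal (exp (\<eta> * energy L (fst p)))) \<in> borel_measurable modes_space"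
        unfolding energy_def by measurable
      \<comment> \<open>The \<open>a\<close> part of \<open>modes_of\<close> does not depend on
        \<open>y\<close>, so \<open>undefined\<close> serves as a dummy.\<close>
      have "(\<lambda>x. ennreal (exp (\<eta> * energy L (fst (modes_of F z x undefined))))) \<in> borel_measurable (a_law F)"
        by (rule measurable_modes_of[OF F]) (assumption, measurable)
      then show ?thesis by (simp add: fst_modes_of)
    qed
    have "(\<integral>\<^sup>+p. ennreal (exp (- c * pairing M L p)) * indicator (cutoff B L) p \<partial>with_zero_mode (gauss_law \<kappa> F))
      = (\<integral>\<^sup>+z. \<integral>\<^sup>+x. \<integral>\<^sup>+y. ennreal (exp (- c * pairing M L (modes_of F z x y))) * indicator (cutoff B L) (modes_of F z x y)
         \<partial>b_law \<kappa> F \<partial>a_law F \<partial>lborel)"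
      by (rule nn_integral_with_zero_mode[OF \<kappa> F]) measurable
    also have "\<dots> \<le> (\<integral>\<^sup>+z. \<integral>\<^sup>+x. ennreal (exp D) * ennreal (exp (\<eta> * energy L (mode_a F (fst z) x))) * indicator (zero_box B) z
         \<partial>a_law F \<partial>lborel)"
      by (intro nn_integral_mono inner)
    also have "\<dots> = (\<integral>\<^sup>+z. ennreal (exp D) * (\<integral>\<^sup>+x. ennreal (exp (\<eta> * energy L (mode_a F (fst z) x))) \<partial>a_law F) * indicator (zero_box B) z
         \<partial>lborel)"
      using mE by (intro nn_integral_cong)
        (subst nn_integral_multc nn_integral_cmult; (intro borel_measurable_times_ennreal borel_measurable_const)?; simp)+
    also have "\<dots> \<le> (\<integral>\<^sup>+z. ennreal (exp D) * ennreal (exp (4 * \<eta> * wt_sum)) * indicator (zero_box B) z \<partial>lborel)"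
      by (intro nn_integral_mono mult_right_mono mult_left_mono nn_integral_a_law_exp_energy \<eta>) auto
    also have "\<dots> = ennreal (exp D * exp (4 * \<eta> * wt_sum) * V)"
      by (simp add: nn_integral_cmult_indicator V V_def ennreal_mult)
    finally show "(\<integral>\<^sup>+p. ennreal (exp (- c * pairing M L p)) * indicator (cutoff B L) p \<partial>with_zero_mode (gauss_law \<kappa> F))
      \<le> ennreal (exp D * exp (4 * \<eta> * wt_sum) * V)" .
  qed
qed

section \<open>Tails of the weighted supremum norms\<close>

lemma jbracket_ge_1: "1 \<le> jbracket n"
  by (simp add: jbracket_def)

lemma summable_on_jbracket:
  assumes "s < - 1"
  shows "(\<lambda>n. jbracket n powr s) summable_on UNIV"
proof -
  have "summable (\<lambda>n. (1 + real n) powr s)"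
    using assms summable_Suc_iff[of "\<lambda>n. real n powr s"] summable_real_powr_iff[of s] by simp
  from summable_on_int_abs[OF this] show ?thesis
    by (simp add: jbracket_def)
qed

text \<open>The supremum bound gives \<open>|u n| \<le> K * jbracket n powr (- r)\<close>, so the
  Sobolev sum is at most \<open>K^2\<close> times a series with exponent
  \<open>2 * (r1 - r)\<close>, which must be below \<open>- 1\<close>.\<close>

lemma in_H_of_sup_bound:
  assumes K: "0 \<le> K" "\<And>n. jbracket n powr r * cmod (u n) \<le> K"
    and r: "r2 \<le> r" "r1 - r < - 1 / 2"
  shows "in_H r1 r2 u"
    and "H_norm r1 r2 u \<le> (1 + sqrt (\<Sum>\<^sub>\<infinity>n\<in>UNIV. jbracket n powr (2 * (r1 - r)))) * K"
proof -
  let ?w = "\<lambda>n. jbracket n powr (2 * (r1 - r))"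
  have w: "?w summable_on UNIV" using r by (intro summable_on_jbracket) simp
  have le: "jbracket n powr (2 * r1) * (cmod (u n))\<^sup>2 \<le> K\<^sup>2 * ?w n" for n
  proof -
    have j: "0 < jbracket n" using jbracket_ge_1[of n] by linarith
    have "jbracket n powr (2 * r1) = ?w n * (jbracket n powr r)\<^sup>2"
      using j by (simp flip: powr_add add: power2_eq_square)
    then have "jbracket n powr (2 * r1) * (cmod (u n))\<^sup>2 = ?w n * (jbracket n powr r * cmod (u n))\<^sup>2"
      by (simp add: power_mult_distrib)
    also have "\<dots> \<le> ?w n * K\<^sup>2"
      using K by (intro mult_left_mono power_mono) auto
    finally show ?thesis by (simp add: mult.commute)
  qed
  have sob: "(\<lambda>n. jbracket n powr (2 * r1) * (cmod (u n))\<^sup>2) summable_on UNIV"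
    by (rule summable_on_comparison_test[OF summable_on_cmult_right[OF w] le]) simp
  have sup: "jbracket n powr r2 * cmod (u n) \<le> K" for n
  proof -
    have "jbracket n powr r2 * cmod (u n) \<le> jbracket n powr r * cmod (u n)"
      using r jbracket_ge_1 by (intro mult_right_mono powr_mono) auto
    then show ?thesis using K(2)[of n] by linarith
  qed
  show "in_H r1 r2 u"
    using sob sup by (auto simp: in_H_def in_sobolev_def intro!: bdd_aboveI[of _ K])
  have "sobolev_norm r1 u \<le> sqrt (\<Sum>\<^sub>\<infinity>n\<in>UNIV. K\<^sup>2 * ?w n)"
    unfolding sobolev_norm_def
    by (intro real_sqrt_le_mono infsum_mono sob summable_on_cmult_right w le)
  also have "\<dots> = K * sqrt (infsum ?w UNIV)"
    using K by (simp add: infsum_cmult_right' real_sqrt_mult)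
  finally have "sobolev_norm r1 u \<le> K * sqrt (infsum ?w UNIV)" .
  moreover have "(SUP n. jbracket n powr r2 * cmod (u n)) \<le> K"
    using sup by (intro cSUP_least) auto
  ultimately show "H_norm r1 r2 u \<le> (1 + sqrt (infsum ?w UNIV)) * K"
    by (simp add: H_norm_def algebra_simps)
qed

definition zero_mode_bounded :: "real \<Rightarrow> modes set" where
  "zero_mode_bounded B = {p. cmod (fst p 0) \<le> B \<and> cmod (snd p 0) \<le> B}"

lemma zero_mode_bounded_sets [measurable]: "zero_mode_bounded B \<in> sets modes_space"
proof -
  have "{p \<in> space modes_space. cmod (fst p 0) \<le> B \<and> cmod (snd p 0) \<le> B} \<in> sets modes_space"
    by measurable
  then show ?thesis by (simp add: zero_mode_bounded_def)
qed

lemma zero_mode_bounded_modes_of: "modes_of F z x y \<in> zero_mode_bounded B \<longleftrightarrow> z \<in> zero_box B"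
  by (cases z) (simp add: zero_mode_bounded_def zero_box_def modes_of_def)

text \<open>On the support of the measures \<open>b (- n)\<close> is conjugate to \<open>b n\<close>, so negative frequencies of \<open>b\<close> are omitted.\<close>

definition sup_large :: "real \<Rightarrow> real \<Rightarrow> modes set" where
  "sup_large r K = {p. (\<exists>n. n \<noteq> 0 \<and> K < jbracket n powr r * cmod (fst p n)) \<or>
     (\<exists>n. n \<ge> 1 \<and> K < jbracket n powr (r - 1 / 2) * cmod (snd p n))}"

lemma sup_large_sets [measurable]: "sup_large r K \<in> sets modes_space"
proof -
  have "{p \<in> space modes_space. (\<exists>n. n \<noteq> 0 \<and> K < jbracket n powr r * cmod (fst p n)) \<or>
     (\<exists>n. n \<ge> 1 \<and> K < jbracket n powr (r - 1 / 2) * cmod (snd p n))} \<in> sets modes_space"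
    by measurable
  then show ?thesis by (simp add: sup_large_def)
qed

text \<open>Passing from \<open>a\<close> to \<open>b\<close> lowers all exponents by
  \<open>1 / 2\<close>, so the difference \<open>s1 - r\<close> and the constant are the same for
  both and the total is twice one of them. At frequency \<open>0\<close> the bracket is
  \<open>1\<close>, and \<open>B \<le> K\<close> covers it.\<close>

lemma not_sup_large_HH_norm:
  assumes p: "p \<notin> sup_large r K" "p \<in> zero_mode_bounded B" "B \<le> K" "0 \<le> K" "real_valued (snd p)"
    and r: "s2 \<le> r" "s1 - r < - 1 / 2"
  shows "in_HH s1 s2 p"
    and "HH_norm s1 s2 p \<le> 2 * (1 + sqrt (\<Sum>\<^sub>\<infinity>n\<in>UNIV. jbracket n powr (2 * (s1 - r)))) * K"
proof -
  have a: "jbracket n powr r * cmod (fst p n) \<le> K" for n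
    using p by (cases "n = 0") (auto simp: sup_large_def zero_mode_bounded_def jbracket_def not_less)
  have b: "jbracket n powr (r - 1 / 2) * cmod (snd p n) \<le> K" for n
  proof -
    have "cmod (snd p n) = cmod (snd p \<bar>n\<bar>)"
      using p(5) by (cases "n \<ge> 0") (auto simp: real_valued_def)
    moreover have "jbracket \<bar>n\<bar> powr (r - 1 / 2) * cmod (snd p \<bar>n\<bar>) \<le> K"
    proof (cases "n = 0")
      case False
      have "jbracket m powr (r - 1 / 2) * cmod (snd p m) \<le> K" if "m \<ge> 1" for m
        using p(1) that by (auto simp: sup_large_def not_less)
      then show ?thesis using False by simp
    qed (use p in \<open>auto simp: zero_mode_bounded_def jbracket_def\<close>)
    ultimately show ?thesis by (simp add: jbracket_def)
  qed
  have r': "s2 - 1 / 2 \<le> r - 1 / 2" "(s1 - 1 / 2) - (r - 1 / 2) < - 1 / 2" using r by auto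
  note A = in_H_of_sup_bound[OF p(4) a r] and B = in_H_of_sup_bound[OF p(4) b r']
  show "in_HH s1 s2 p" using A(1) B(1) by (simp add: in_HH_def split_beta)
  show "HH_norm s1 s2 p \<le> 2 * (1 + sqrt (\<Sum>\<^sub>\<infinity>n\<in>UNIV. jbracket n powr (2 * (s1 - r)))) * K"
    using add_mono[OF A(2) B(2)] by (simp add: HH_norm_def split_beta algebra_simps)
qed

text \<open>The exponent is half of the critical one, so the moment is
  \<open>1 / (1 - 1/2) = 2\<close> for each mode in \<open>F\<close>; a mode outside
  \<open>F\<close> vanishes and gives \<open>1\<close>.\<close>

lemma exp_moment_a:
  assumes "n \<noteq> 0"
  shows "(\<integral>\<^sup>+x. ennreal (exp ((of_int n)\<^sup>2 / 4 * (cmod (mode_a F a0 x n))\<^sup>2)) \<partial>a_law F) \<le> 2"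
proof -
  interpret prob_space "a_law F" by (rule prob_space_a_law)
  show ?thesis
  proof (cases "n \<in> F")
    case True
    then have "(\<integral>\<^sup>+x. ennreal (exp ((of_int n)\<^sup>2 / 4 * (cmod (mode_a F a0 x n))\<^sup>2)) \<partial>a_law F) = ennreal 2"
      using assms nn_integral_a_law_exp[of "{n}" F "\<lambda>n. (of_int n)\<^sup>2 / 4"] by (simp add: mode_a_def)
    then show ?thesis by simp
  next
    case False
    then show ?thesis using assms emeasure_space_1 by (simp add: mode_a_def)
  qed
qed

lemma exp_moment_b:
  assumes "n \<ge> 1" "\<kappa> > 0"
  shows "(\<integral>\<^sup>+y. ennreal (exp (\<kappa> * of_int n / 2 * (cmod (snd (modes_of F z x y) n))\<^sup>2)) \<partial>b_law \<kappa> F) \<le> 2"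
proof -
  interpret prob_space "b_law \<kappa> F" by (rule prob_space_b_law[OF assms(2)])
  show ?thesis
  proof (cases "n \<in> F")
    case True
    then have "(\<integral>\<^sup>+y. ennreal (exp (\<kappa> * of_int n / 2 * (cmod (snd (modes_of F z x y) n))\<^sup>2)) \<partial>b_law \<kappa> F) = ennreal 2"
      using assms nn_integral_b_law_exp_square[of \<kappa> n F "\<kappa> * of_int n / 2"]
      by (simp add: modes_of_def from_coords_def)
    then show ?thesis by simp
  next
    case False
    then show ?thesis using assms emeasure_space_1 by (simp add: modes_of_def from_coords_def)
  qed
qed

lemma nn_integral_exp_norm_le:
  assumes \<kappa>: "\<kappa> > 0" and F: "\<And>n. n \<in> F \<Longrightarrow> - n \<in> F"
  shows "n \<noteq> 0 \<Longrightarrow> (\<integral>\<^sup>+p. ennreal (exp ((of_int n)\<^sup>2 / 4 * (cmod (fst p n))\<^sup>2)) * indicator (zero_mode_bounded B) p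
      \<partial>with_zero_mode (gauss_law \<kappa> F)) \<le> 2 * emeasure lborel (zero_box B)" (is "_ \<Longrightarrow> ?A")
    and "n \<ge> 1 \<Longrightarrow> (\<integral>\<^sup>+p. ennreal (exp (\<kappa> * of_int n / 2 * (cmod (snd p n))\<^sup>2)) * indicator (zero_mode_bounded B) p
      \<partial>with_zero_mode (gauss_law \<kappa> F)) \<le> 2 * emeasure lborel (zero_box B)" (is "_ \<Longrightarrow> ?B")
proof -
  interpret A: prob_space "a_law F" by (rule prob_space_a_law)
  interpret B: prob_space "b_law \<kappa> F" by (rule prob_space_b_law[OF \<kappa>])
  show ?A if n: "n \<noteq> 0"
  proof -
    have "(\<integral>\<^sup>+p. ennreal (exp ((of_int n)\<^sup>2 / 4 * (cmod (fst p n))\<^sup>2)) * indicator (zero_mode_bounded B) p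
      \<partial>with_zero_mode (gauss_law \<kappa> F))
      = (\<integral>\<^sup>+z. \<integral>\<^sup>+x. \<integral>\<^sup>+y. ennreal (exp ((of_int n)\<^sup>2 / 4 * (cmod (fst (modes_of F z x y) n))\<^sup>2)) *
          indicator (zero_mode_bounded B) (modes_of F z x y) \<partial>b_law \<kappa> F \<partial>a_law F \<partial>lborel)"
      by (rule nn_integral_with_zero_mode[OF \<kappa> F]) (assumption, measurable)
    also have "\<dots> \<le> (\<integral>\<^sup>+z. 2 * indicator (zero_box B) z \<partial>lborel)"
    proof (rule nn_integral_mono)
      fix z :: "complex \<times> real"
      show "(\<integral>\<^sup>+x. \<integral>\<^sup>+y. ennreal (exp ((of_int n)\<^sup>2 / 4 * (cmod (fst (modes_of F z x y) n))\<^sup>2)) *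
          indicator (zero_mode_bounded B) (modes_of F z x y) \<partial>b_law \<kappa> F \<partial>a_law F) \<le> 2 * indicator (zero_box B) z"
        using exp_moment_a[OF n, of F "fst z"] B.emeasure_space_1
        by (cases "z \<in> zero_box B") (simp_all add: zero_mode_bounded_modes_of indicator_def fst_modes_of)
    qed
    also have "\<dots> = 2 * emeasure lborel (zero_box B)" by (simp add: nn_integral_cmult_indicator)
    finally show ?thesis .
  qed
  show ?B if n: "n \<ge> 1"
  proof -
    have "(\<integral>\<^sup>+p. ennreal (exp (\<kappa> * of_int n / 2 * (cmod (snd p n))\<^sup>2)) * indicator (zero_mode_bounded B) p
      \<partial>with_zero_mode (gauss_law \<kappa> F))
      = (\<integral>\<^sup>+z. \<integral>\<^sup>+x. \<integral>\<^sup>+y. ennreal (exp (\<kappa> * of_int n / 2 * (cmod (snd (modes_of F z x y) n))\<^sup>2)) *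
          indicator (zero_mode_bounded B) (modes_of F z x y) \<partial>b_law \<kappa> F \<partial>a_law F \<partial>lborel)"
      by (rule nn_integral_with_zero_mode[OF \<kappa> F]) (assumption, measurable)
    also have "\<dots> \<le> (\<integral>\<^sup>+z. \<integral>\<^sup>+x. 2 * indicator (zero_box B) z \<partial>a_law F \<partial>lborel)"
    proof (intro nn_integral_mono)
      fix z :: "complex \<times> real" and x
      show "(\<integral>\<^sup>+y. ennreal (exp (\<kappa> * of_int n / 2 * (cmod (snd (modes_of F z x y) n))\<^sup>2)) *
          indicator (zero_mode_bounded B) (modes_of F z x y) \<partial>b_law \<kappa> F) \<le> 2 * indicator (zero_box B) z"
        using exp_moment_b[OF n \<kappa>, of F z x]
        by (cases "z \<in> zero_box B") (simp_all add: zero_mode_bounded_modes_of indicator_def)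
    qed
    also have "\<dots> = 2 * emeasure lborel (zero_box B)"
      by (simp add: nn_integral_cmult_indicator A.emeasure_space_1)
    finally show ?thesis .
  qed
qed

lemma summable_exp_powr:
  fixes c \<theta> :: real
  assumes "0 < c" "0 < \<theta>"
  shows "summable (\<lambda>m. exp (- c * (2 + real m) powr \<theta>))"
proof (rule summable_comparison_test_bigo)
  show "summable (\<lambda>m. norm (real m powr (- 2)))"
    by (simp add: summable_real_powr_iff)
  show "(\<lambda>m. exp (- c * (2 + real m) powr \<theta>)) \<in> O(\<lambda>m. real m powr (- 2))"
    using assms by real_asymp
qed

text \<open>Exponential Chebyshev inequality in each mode, then a union bound. When
  \<open>a_n\<close> exceeds its threshold, \<open>n^2 * |a_n|^2\<close> is at least of order
  \<open>K^2 * n^(2 - 2 * r)\<close>; for \<open>b_n\<close> the larger variance and the exponent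
  \<open>r - 1/2\<close> lead to the same power. As \<open>r < 1\<close>, the exponent grows with
  \<open>n\<close> and the bounds are summable.\<close>

lemma sup_large_tail:
  fixes \<kappa> B r :: real
  assumes \<kappa>: "\<kappa> > 0" and r: "r < 1"
  obtains c C where "0 < c" "0 \<le> C" "\<And>F K. (\<And>n. n \<in> F \<Longrightarrow> - n \<in> F) \<Longrightarrow> 1 \<le> K \<Longrightarrow>
     (\<integral>\<^sup>+p. indicator (sup_large r K \<inter> zero_mode_bounded B) p \<partial>with_zero_mode (gauss_law \<kappa> F))
       \<le> ennreal (C * exp (- c * K\<^sup>2))"
proof -
  define \<theta> where "\<theta> = 2 - 2 * r"
  have \<theta>: "0 < \<theta>" using r by (simp add: \<theta>_def)
  \<comment> \<open>With \<open>jbracket n \<le> 2 * |n|\<close> for \<open>n \<noteq> 0\<close>,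
    the moment exponent \<open>n^2 / 4\<close> loses a factor \<open>4\<close> and
    \<open>\<kappa> * n / 2\<close> loses a factor \<open>2\<close>.\<close>
  define d where "d = min (1 / 16) (\<kappa> / 4)"
  have d: "0 < d" "d \<le> 1 / 16" "d \<le> \<kappa> / 4" using \<kappa> by (auto simp: d_def)
  define V where "V = measure lborel (zero_box B)"
  have V: "emeasure lborel (zero_box B) = ennreal V" "0 \<le> V"
    using emeasure_zero_box_finite[of B] unfolding V_def by (auto intro!: emeasure_eq_ennreal_measure)
  define S where "S = (\<Sum>m. exp (- (d / 2) * (2 + real m) powr \<theta>))"
  have summ: "summable (\<lambda>m. exp (- (d / 2) * (2 + real m) powr \<theta>))"
    using d \<theta> by (intro summable_exp_powr) auto
  have S: "0 \<le> S" unfolding S_def by (intro suminf_nonneg summ) auto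
  show thesis
  \<comment> \<open>The \<open>6\<close> counts three modes per index, each with exponential moment
    at most \<open>2 * V\<close>.\<close>
  proof (rule that[of "d / 2" "6 * V * S"])
    show "0 < d / 2" "0 \<le> 6 * V * S" using d V S by auto
    fix F :: "int set" and K :: real
    assume F: "\<And>n. n \<in> F \<Longrightarrow> - n \<in> F" and K: "1 \<le> K"
    let ?W = "with_zero_mode (gauss_law \<kappa> F)"
    \<comment> \<open>The index \<open>m\<close> stands for the frequencies \<open>m + 1\<close> and
      \<open>- (m + 1)\<close>, whose bracket is \<open>2 + m\<close>; \<open>G m\<close> below
      collects the two modes of \<open>a\<close> and the one of \<open>b\<close>.\<close>
    define e where "e m = exp (- (d * K\<^sup>2) * (2 + real m) powr \<theta>)" for m
    define Ga where "Ga n p = ennreal (exp ((of_int n)\<^sup>2 / 4 * (cmod (fst p n))\<^sup>2)) * indicator (zero_mode_bounded B) p"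
      for n :: int and p :: modes
    define Gb where "Gb n p = ennreal (exp (\<kappa> * of_int n / 2 * (cmod (snd p n))\<^sup>2)) * indicator (zero_mode_bounded B) p"
      for n :: int and p :: modes
    define G where "G m p = ennreal (e m) * (Ga (int m + 1) p + Ga (- (int m + 1)) p + Gb (int m + 1) p)" for m p
    have [measurable]: "Ga n \<in> borel_measurable modes_space" "Gb n \<in> borel_measurable modes_space" for n
      unfolding Ga_def Gb_def by measurable
    have sets: "sets ?W = sets modes_space" by (simp add: with_zero_mode_def)
    note [measurable_cong] = sets
    have ea: "1 \<le> ennreal (e m) * ennreal (exp ((of_int n)\<^sup>2 / 4 * (cmod u)\<^sup>2))"
      if n: "\<bar>n\<bar> = int m + 1" and u: "K < jbracket n powr r * cmod u" for n m u
    proof -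
      have N: "\<bar>real_of_int n\<bar> = real m + 1" using arg_cong[OF n, of real_of_int] by simp
      then have j: "jbracket n = 2 + real m" by (simp add: jbracket_def)
      have pos: "0 < jbracket n" by (simp add: j)
      have "jbracket n powr \<theta> = (jbracket n)\<^sup>2 * (jbracket n powr (- r))\<^sup>2"
      proof -
        have "\<theta> = 2 + (- r + - r)" by (simp add: \<theta>_def)
        then show ?thesis using pos by (simp only: powr_add powr_numeral power2_eq_square)
      qed
      also have "\<dots> \<le> (4 * (of_int n)\<^sup>2) * (jbracket n powr (- r))\<^sup>2"
      proof (rule mult_right_mono)
        have "(jbracket n)\<^sup>2 \<le> (2 * \<bar>real_of_int n\<bar>)\<^sup>2" by (intro power_mono) (auto simp: j N)
        then show "(jbracket n)\<^sup>2 \<le> 4 * (of_int n)\<^sup>2" by (simp add: power_mult_distrib)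
      qed simp
      finally have 1: "jbracket n powr \<theta> \<le> 4 * (of_int n)\<^sup>2 * (jbracket n powr (- r))\<^sup>2" .
      have "K * jbracket n powr (- r) \<le> cmod u"
        using u pos by (simp add: powr_minus field_simps)
      then have 2: "(K * jbracket n powr (- r))\<^sup>2 \<le> (cmod u)\<^sup>2"
        using K by (intro power_mono) auto
      have "d * K\<^sup>2 * jbracket n powr \<theta> \<le> 1 / 16 * K\<^sup>2 * (4 * (of_int n)\<^sup>2 * (jbracket n powr (- r))\<^sup>2)"
        using d 1 by (intro mult_mono) auto
      also have "\<dots> = (of_int n)\<^sup>2 / 4 * (K * jbracket n powr (- r))\<^sup>2" by (simp add: power_mult_distrib)
      also have "\<dots> \<le> (of_int n)\<^sup>2 / 4 * (cmod u)\<^sup>2" by (intro mult_left_mono 2) simp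
      finally have "0 \<le> - (d * K\<^sup>2) * jbracket n powr \<theta> + (of_int n)\<^sup>2 / 4 * (cmod u)\<^sup>2" by simp
      then have "1 \<le> exp (- (d * K\<^sup>2) * jbracket n powr \<theta> + (of_int n)\<^sup>2 / 4 * (cmod u)\<^sup>2)" by simp
      then show ?thesis by (simp only: e_def j exp_add ennreal_1[symmetric] ennreal_mult[symmetric] exp_ge_zero ennreal_leI)
    qed
    have eb: "1 \<le> ennreal (e m) * ennreal (exp (\<kappa> * of_int n / 2 * (cmod u)\<^sup>2))"
      if n: "n = int m + 1" and u: "K < jbracket n powr (r - 1 / 2) * cmod u" for n m u
    proof -
      have j: "jbracket n = 2 + real m" using n by (simp add: jbracket_def)
      have pos: "0 < jbracket n" by (simp add: j)
      have "jbracket n powr \<theta> = jbracket n * (jbracket n powr (1 / 2 - r))\<^sup>2"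
        using pos by (simp add: \<theta>_def power2_eq_square powr_mult_base flip: powr_add)
      also have "\<dots> \<le> (2 * of_int n) * (jbracket n powr (1 / 2 - r))\<^sup>2"
        using n by (intro mult_right_mono) (auto simp: jbracket_def)
      finally have 1: "jbracket n powr \<theta> \<le> 2 * of_int n * (jbracket n powr (1 / 2 - r))\<^sup>2" .
      have one: "jbracket n powr (1 / 2 - r) * jbracket n powr (r - 1 / 2) = 1"
        using pos unfolding powr_add[symmetric] by simp
      have "K * jbracket n powr (1 / 2 - r) \<le> (jbracket n powr (r - 1 / 2) * cmod u) * jbracket n powr (1 / 2 - r)"
        using u by (intro mult_right_mono) auto
      also have "\<dots> = cmod u * (jbracket n powr (1 / 2 - r) * jbracket n powr (r - 1 / 2))"
        by (simp only: mult_ac)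
      finally have "K * jbracket n powr (1 / 2 - r) \<le> cmod u"
        unfolding one by simp
      then have 2: "(K * jbracket n powr (1 / 2 - r))\<^sup>2 \<le> (cmod u)\<^sup>2"
        using K by (intro power_mono) auto
      have "d * K\<^sup>2 * jbracket n powr \<theta> \<le> \<kappa> / 4 * K\<^sup>2 * (2 * of_int n * (jbracket n powr (1 / 2 - r))\<^sup>2)"
        using d 1 \<kappa> by (intro mult_mono) auto
      also have "\<dots> = \<kappa> * of_int n / 2 * (K * jbracket n powr (1 / 2 - r))\<^sup>2" by (simp add: power_mult_distrib)
      also have "\<dots> \<le> \<kappa> * of_int n / 2 * (cmod u)\<^sup>2" using \<kappa> n by (intro mult_left_mono 2) simp
      finally have "0 \<le> - (d * K\<^sup>2) * jbracket n powr \<theta> + \<kappa> * of_int n / 2 * (cmod u)\<^sup>2" by simp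
      then have "1 \<le> exp (- (d * K\<^sup>2) * jbracket n powr \<theta> + \<kappa> * of_int n / 2 * (cmod u)\<^sup>2)" by simp
      then show ?thesis by (simp only: e_def j exp_add ennreal_1[symmetric] ennreal_mult[symmetric] exp_ge_zero ennreal_leI)
    qed
    have pt: "indicator (sup_large r K \<inter> zero_mode_bounded B) p \<le> (\<Sum>m. G m p)" for p
    proof (cases "p \<in> sup_large r K \<inter> zero_mode_bounded B")
      case True
      have "\<exists>m. 1 \<le> G m p"
      proof -
        consider n where "n \<noteq> 0" "K < jbracket n powr r * cmod (fst p n)"
          | n where "n \<ge> 1" "K < jbracket n powr (r - 1 / 2) * cmod (snd p n)"
          using True by (auto simp: sup_large_def)
        then show ?thesis
        proof cases
          case 1
          define m where "m = nat (\<bar>n\<bar> - 1)"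
          have m: "\<bar>n\<bar> = int m + 1" using 1 by (simp add: m_def)
          have "1 \<le> ennreal (e m) * Ga n p"
            using ea[OF m 1(2)] True by (simp add: Ga_def)
          also have "\<dots> \<le> G m p"
            unfolding G_def
          proof (rule mult_left_mono)
            have "n = int m + 1 \<or> n = - (int m + 1)" using m by linarith
            then show "Ga n p \<le> Ga (int m + 1) p + Ga (- (int m + 1)) p + Gb (int m + 1) p"
            proof
              assume "n = - (int m + 1)"
              then show ?thesis by (simp only: add.assoc) (intro add_increasing add_increasing2; simp)
            qed (simp add: add.assoc)
          qed simp
          finally show ?thesis by blast
        next
          case 2
          define m where "m = nat (n - 1)"
          have m: "n = int m + 1" using 2 by (simp add: m_def)
          have "1 \<le> ennreal (e m) * Gb n p"
            using eb[OF m 2(2)] True by (simp add: Gb_def)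
          also have "\<dots> \<le> G m p"
            unfolding G_def using m by (intro mult_left_mono) (auto intro: add_increasing)
          finally show ?thesis by blast
        qed
      qed
      then obtain m where "1 \<le> G m p" ..
      also have "G m p = (\<Sum>i\<in>{m}. G i p)" by simp
      also have "\<dots> \<le> (\<Sum>m. G m p)" by (intro sum_le_suminf) auto
      finally show ?thesis using True by simp
    qed simp
    have IG: "(\<integral>\<^sup>+p. G m p \<partial>?W) \<le> ennreal (6 * V * exp (- (d / 2) * K\<^sup>2) * exp (- (d / 2) * (2 + real m) powr \<theta>))" for m
    proof -
      have "(\<integral>\<^sup>+p. G m p \<partial>?W) = ennreal (e m) *
         ((\<integral>\<^sup>+p. Ga (int m + 1) p \<partial>?W) + (\<integral>\<^sup>+p. Ga (- (int m + 1)) p \<partial>?W) + (\<integral>\<^sup>+p. Gb (int m + 1) p \<partial>?W))"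
        unfolding G_def by (simp add: nn_integral_cmult nn_integral_add)
      also have "\<dots> \<le> ennreal (e m) * (2 * ennreal V + 2 * ennreal V + 2 * ennreal V)"
        unfolding Ga_def Gb_def V(1)[symmetric]
        by (intro mult_left_mono add_mono nn_integral_exp_norm_le \<kappa> F) auto
      also have "\<dots> = ennreal (6 * V * e m)"
      proof -
        have "2 * ennreal V + 2 * ennreal V + 2 * ennreal V = ennreal (6 * V)"
          using V(2) by (simp add: ennreal_mult'' flip: distrib_right ennreal_plus ennreal_numeral)
        then show ?thesis using V(2) by (simp add: ennreal_mult'' e_def mult.commute)
      qed
      also have "e m \<le> exp (- (d / 2) * K\<^sup>2) * exp (- (d / 2) * (2 + real m) powr \<theta>)"
      proof -
        define t where "t = (2 + real m) powr \<theta>"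
        have t: "1 \<le> t" unfolding t_def using \<theta> by (intro ge_one_powr_ge_zero) auto
        have K2: "1 \<le> K\<^sup>2" using K by simp
        \<comment> \<open>A product of numbers that are at least \<open>1\<close> dominates their
          mean. This splits the exponent into a decay in \<open>K\<close> and a summable factor in
          \<open>m\<close>.\<close>
        have "K\<^sup>2 * 1 \<le> K\<^sup>2 * t" "1 * t \<le> K\<^sup>2 * t"
          using t K2 by (intro mult_left_mono mult_right_mono; simp)+
        then have "(d / 2) * (K\<^sup>2 + t) \<le> (d / 2) * (2 * (K\<^sup>2 * t))"
          using d by (intro mult_left_mono) auto
        then have "- (d * K\<^sup>2) * t \<le> - (d / 2) * K\<^sup>2 + - (d / 2) * t"
          by (simp add: algebra_simps)
        then show ?thesis unfolding e_def t_def[symmetric] exp_add[symmetric] by simp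
      qed
      finally show ?thesis using V(2)
        by (simp add: mult_left_mono ennreal_leI mult.assoc)
    qed
    have "(\<integral>\<^sup>+p. indicator (sup_large r K \<inter> zero_mode_bounded B) p \<partial>?W) \<le> (\<integral>\<^sup>+p. (\<Sum>m. G m p) \<partial>?W)"
      by (intro nn_integral_mono pt)
    also have "\<dots> = (\<Sum>m. \<integral>\<^sup>+p. G m p \<partial>?W)"
      by (rule nn_integral_suminf) (simp add: G_def[abs_def])
    also have "\<dots> \<le> (\<Sum>m. ennreal (6 * V * exp (- (d / 2) * K\<^sup>2) * exp (- (d / 2) * (2 + real m) powr \<theta>)))"
      by (intro suminf_le IG) auto
    also have "\<dots> = ennreal (\<Sum>m. 6 * V * exp (- (d / 2) * K\<^sup>2) * exp (- (d / 2) * (2 + real m) powr \<theta>))"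
      using V(2) summ by (intro suminf_ennreal2 summable_mult) auto
    also have "(\<Sum>m. 6 * V * exp (- (d / 2) * K\<^sup>2) * exp (- (d / 2) * (2 + real m) powr \<theta>))
       = 6 * V * S * exp (- (d / 2) * K\<^sup>2)"
      unfolding S_def by (subst suminf_mult[OF summ]) simp
    finally show "(\<integral>\<^sup>+p. indicator (sup_large r K \<inter> zero_mode_bounded B) p \<partial>?W)
       \<le> ennreal (6 * V * S * exp (- (d / 2) * K\<^sup>2))" .
  qed
qed

section \<open>Lower bound for the partition functions\<close>

text \<open>Meant for \<open>y = \<mu> / sqrt |k|\<close>, where \<open>y^4 = \<mu>^4 / k^2\<close>
  comes from a Gaussian factor. The cube is a compromise: summed over \<open>k\<close> it gives the
  convergent sum of \<open>wt\<close>, and its growth \<open>\<mu>^3\<close> still loses against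
  \<open>\<mu>^4\<close>.\<close>

lemma one_plus_power4_le_exp:
  fixes y :: real
  assumes "0 \<le> y"
  shows "1 + y ^ 4 \<le> exp (2 * y ^ 3)"
proof (cases "y \<le> 1")
  case True
  have "y ^ 4 \<le> y ^ 3" using assms True by (intro power_decreasing) auto
  moreover have "0 \<le> y ^ 3" using assms by simp
  ultimately have "1 + y ^ 4 \<le> 1 + 2 * y ^ 3" by linarith
  also have "\<dots> \<le> exp (2 * y ^ 3)" by (rule exp_ge_add_one_self)
  finally show ?thesis .
next
  case False
  have "y ^ 4 \<le> y ^ 6" using False by (intro power_increasing) auto
  also have "\<dots> = (y ^ 3)\<^sup>2" by simp
  finally have "1 + y ^ 4 \<le> 1 + (y ^ 3)\<^sup>2" by simp
  also have "\<dots> \<le> (1 + y ^ 3)\<^sup>2" using assms by (simp add: power2_sum)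
  also have "\<dots> \<le> (exp (y ^ 3))\<^sup>2" using assms by (intro power_mono exp_ge_add_one_self) auto
  also have "\<dots> = exp (2 * y ^ 3)" by (simp flip: exp_double)
  finally show ?thesis .
qed

text \<open>
  The Laplace transform of the sum at \<open>\<lambda> = \<mu>\<^sup>4 / 2\<close> is at least \<open>exp (- C \<mu>\<^sup>3)\<close>, which exceeds
  \<open>exp (- \<lambda> d)\<close> for large \<open>\<mu>\<close>; this could not happen if the sum were almost surely larger than \<open>d\<close>.
\<close>

lemma small_mass_probability:
  fixes d :: real
  assumes "0 < d"
  obtains \<delta> where "0 < \<delta>" "\<And>J F. finite J \<Longrightarrow> J \<subseteq> F - {0} \<Longrightarrow>
    ennreal \<delta> \<le> (\<integral>\<^sup>+x. indicator {x. (\<Sum>k\<in>J. (cmod (x k))\<^sup>2) \<le> d} x \<partial>a_law F)"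
proof -
  \<comment> \<open>This gives \<open>\<mu> * d \<ge> 4 * wt_sum + 2\<close>, hence
    \<open>\<mu>^4 * d / 2 \<ge> A + \<mu>^3\<close>; the summand \<open>1\<close> ensures
    \<open>\<mu> \<ge> 1\<close>.\<close>
  define \<mu> where "\<mu> = (4 * wt_sum + 2) / d + 1"
  have \<mu>: "1 \<le> \<mu>" using assms wt_sum_nonneg by (simp add: \<mu>_def)
  define A where "A = 2 * \<mu> ^ 3 * wt_sum"
  have Ad: "A + 1 \<le> \<mu> ^ 4 / 2 * d"
  proof -
    have "4 * wt_sum + 2 \<le> \<mu> * d" using assms by (simp add: \<mu>_def field_simps)
    then have "\<mu> ^ 3 * (4 * wt_sum + 2) \<le> \<mu> ^ 3 * (\<mu> * d)" using \<mu> by (intro mult_left_mono) auto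
    moreover have "1 \<le> \<mu> ^ 3" using \<mu> by simp
    moreover have "\<mu> ^ 3 * (\<mu> * d) = \<mu> ^ 4 * d" by (simp add: eval_nat_numeral)
    moreover have "\<mu> ^ 3 * (4 * wt_sum + 2) = 2 * A + 2 * \<mu> ^ 3" by (simp add: A_def algebra_simps)
    ultimately show ?thesis by linarith
  qed
  show thesis
  \<comment> \<open>The Laplace transform is at least \<open>exp (- A)\<close>, and the event that
    the sum exceeds \<open>d\<close> contributes at most \<open>exp (- A - 1)\<close>; the
    difference has to come from the complement.\<close>
  proof (rule that[of "exp (- A) - exp (- A - 1)"])
    show "0 < exp (- A) - exp (- A - 1)" by simp
    fix J F :: "int set" assume J: "finite J" "J \<subseteq> F - {0}"
    interpret prob_space "a_law F" by (rule prob_space_a_law)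
    let ?S = "\<lambda>x. \<Sum>k\<in>J. (cmod (x k))\<^sup>2"
    have mS: "?S \<in> borel_measurable (a_law F)"
    proof (rule borel_measurable_sum)
      fix k assume "k \<in> J"
      then have "(\<lambda>x. x k) \<in> borel_measurable (a_law F)" using J by (intro measurable_a_law_component) auto
      then show "(\<lambda>x. (cmod (x k))\<^sup>2) \<in> borel_measurable (a_law F)" by measurable
    qed
    have mI: "(\<lambda>x. indicator {x. ?S x \<le> d} x :: ennreal) \<in> borel_measurable (a_law F)"
      using mS by measurable
    have "exp (- A) \<le> (\<Prod>k\<in>J. 1 / (1 - 2 * (- (\<mu> ^ 4 / 2)) / (of_int k)\<^sup>2))"
    proof -
      have "exp (- A) \<le> exp (- (2 * \<mu> ^ 3 * sum wt J))"
        unfolding A_def using \<mu> J by (intro exp_mono le_imp_neg_le mult_left_mono sum_wt_le) auto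
      also have "\<dots> = (\<Prod>k\<in>J. exp (- (2 * \<mu> ^ 3 * wt k)))"
        by (simp add: sum_distrib_left exp_sum J flip: sum_negf)
      also have "\<dots> \<le> (\<Prod>k\<in>J. 1 / (1 - 2 * (- (\<mu> ^ 4 / 2)) / (of_int k)\<^sup>2))"
      proof (intro prod_mono conjI)
        fix k assume "k \<in> J"
        then have k: "k \<noteq> 0" using J by auto
        define s where "s = sqrt \<bar>real_of_int k\<bar>"
        have s: "0 < s" "s\<^sup>2 = \<bar>of_int k\<bar>" using k by (auto simp: s_def)
        have s4: "s ^ 4 = (of_int k)\<^sup>2"
          using arg_cong[OF s(2), of "\<lambda>x. x\<^sup>2"] by (simp flip: power_mult)
        have wk: "wt k = 1 / s ^ 3"
          using k s(1) by (simp add: wt_altdef eval_nat_numeral flip: s_def s(2))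
        have "1 + \<mu> ^ 4 / (of_int k)\<^sup>2 = 1 + (\<mu> / s) ^ 4" by (simp add: power_divide s4)
        also have "\<dots> \<le> exp (2 * (\<mu> / s) ^ 3)" using s \<mu> by (intro one_plus_power4_le_exp) auto
        also have "\<dots> = exp (2 * \<mu> ^ 3 * wt k)" by (simp add: power_divide wk)
        finally have le: "1 + \<mu> ^ 4 / (of_int k)\<^sup>2 \<le> exp (2 * \<mu> ^ 3 * wt k)" .
        have "0 < 1 + \<mu> ^ 4 / (of_int k)\<^sup>2" using \<mu> by (intro add_pos_nonneg) auto
        with le show "exp (- (2 * \<mu> ^ 3 * wt k)) \<le> 1 / (1 - 2 * (- (\<mu> ^ 4 / 2)) / (of_int k)\<^sup>2)"
          by (simp add: exp_minus inverse_eq_divide frac_le)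
      qed auto
      finally show ?thesis .
    qed
    then have "ennreal (exp (- A)) \<le> (\<integral>\<^sup>+x. ennreal (exp (\<Sum>k\<in>J. - (\<mu> ^ 4 / 2) * (cmod (x k))\<^sup>2)) \<partial>a_law F)"
    proof (subst nn_integral_a_law_exp[OF J])
      fix n assume "n \<in> J"
      then have "n \<noteq> 0" using J by auto
      then have "0 < (real_of_int n)\<^sup>2" by simp
      then show "2 * - (\<mu> ^ 4 / 2) < (real_of_int n)\<^sup>2"
        using \<mu> by (smt (verit) zero_le_power mult_minus_right field_sum_of_halves)
    qed (intro ennreal_leI)
    also have "\<dots> \<le> (\<integral>\<^sup>+x. ennreal (exp (- A - 1)) + indicator {x. ?S x \<le> d} x \<partial>a_law F)"
    proof (rule nn_integral_mono)
      fix x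
      have eq: "(\<Sum>k\<in>J. - (\<mu> ^ 4 / 2) * (cmod (x k))\<^sup>2) = - (\<mu> ^ 4 / 2 * ?S x)"
        by (simp add: sum_distrib_left sum_negf)
      show "ennreal (exp (\<Sum>k\<in>J. - (\<mu> ^ 4 / 2) * (cmod (x k))\<^sup>2))
        \<le> ennreal (exp (- A - 1)) + indicator {x. ?S x \<le> d} x"
      proof (cases "?S x \<le> d")
        case True
        have "0 \<le> \<mu> ^ 4 / 2 * ?S x" using \<mu> by (intro mult_nonneg_nonneg sum_nonneg) auto
        then have "ennreal (exp (\<Sum>k\<in>J. - (\<mu> ^ 4 / 2) * (cmod (x k))\<^sup>2)) \<le> 1"
          unfolding eq by simp
        then show ?thesis using True by (simp add: add_increasing)
      next
        case False
        then have "\<mu> ^ 4 / 2 * d \<le> \<mu> ^ 4 / 2 * ?S x" using \<mu> by (intro mult_left_mono) auto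
        then have "- (\<mu> ^ 4 / 2 * ?S x) \<le> - A - 1" using Ad by linarith
        then show ?thesis unfolding eq using False by (simp add: ennreal_leI)
      qed
    qed
    also have "\<dots> = ennreal (exp (- A - 1)) + (\<integral>\<^sup>+x. indicator {x. ?S x \<le> d} x \<partial>a_law F)"
      using mI by (subst nn_integral_add) (auto simp: emeasure_space_1)
    finally show "ennreal (exp (- A) - exp (- A - 1)) \<le> (\<integral>\<^sup>+x. indicator {x. ?S x \<le> d} x \<partial>a_law F)"
      by (simp add: ennreal_minus_le_iff flip: ennreal_minus)
  qed
qed

section \<open>The truncated partition functions\<close>

lemma Omega_N_sets [measurable]: "Omega_N N B \<in> sets modes_space"
proof -
  have [measurable]: "(\<lambda>p. cnj (snd p n)) \<in> borel_measurable modes_space" for n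
    by (rule borel_measurable_continuous_on[OF _ measurable_modes_component(2)]) (intro continuous_intros)
  have "{p \<in> space modes_space. (\<forall>n. snd p (- n) = cnj (snd p n)) \<and>
     (\<forall>n. n \<notin> freqs N \<longrightarrow> fst p n = 0 \<and> snd p n = 0) \<and>
     sqrt (\<Sum>n\<in>freqs N. (cmod (fst p n))\<^sup>2) \<le> B \<and> cmod (snd p 0) \<le> B} \<in> sets modes_space"
    by measurable
  then show ?thesis by (simp add: Omega_N_def real_valued_def split_beta')
qed

lemma Omega_N_subset_cutoff:
  assumes "p \<in> Omega_N N B"
  shows "p \<in> cutoff B N"
proof -
  have "sqrt (mass N (fst p)) \<le> B" "cmod (snd p 0) \<le> B"
    using assms by (auto simp: Omega_N_def mass_def split_beta)
  then show ?thesis by (auto simp: cutoff_def intro: sqrt_le_D)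
qed

lemma modes_of_in_Omega_N:
  assumes B: "0 < B" and z: "\<bar>snd z\<bar> \<le> B" and m: "mass N (mode_a (freqs N) (fst z) x) \<le> B\<^sup>2"
  shows "modes_of (freqs N) z x y \<in> Omega_N N B"
proof -
  have F: "- n \<in> freqs N \<longleftrightarrow> n \<in> freqs N" for n by (simp add: freqs_def)
  have "sqrt (mass N (mode_a (freqs N) (fst z) x)) \<le> B"
    using m B by (intro real_le_lsqrt) (auto simp: mass_def sum_nonneg)
  moreover have "real_valued (snd (modes_of (freqs N) z x y))"
    by (auto simp: real_valued_def modes_of_def from_coords_def F)
  moreover have "fst (modes_of (freqs N) z x y) n = 0 \<and> snd (modes_of (freqs N) z x y) n = 0"
    if "n \<notin> freqs N" for n
  proof -
    have "n \<noteq> 0" using that by auto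
    with that show ?thesis by (simp add: modes_of_def from_coords_def)
  qed
  ultimately show ?thesis using z
    by (simp add: Omega_N_def split_beta fst_modes_of snd_modes_of_0 mass_def)
qed

lemma emeasure_zero_box_pos:
  assumes "0 < d" shows "0 < emeasure lborel (zero_box d)"
proof -
  have "0 < measure lborel (cball (0 :: complex \<times> real) d)"
    using content_cball_pos[OF assms] .
  then have "0 < emeasure lborel (cball (0 :: complex \<times> real) d)"
    by (simp add: measure_def enn2real_positive_iff)
  also have "\<dots> \<le> emeasure lborel (zero_box d)"
  proof (intro emeasure_mono)
    show "cball (0 :: complex \<times> real) d \<subseteq> zero_box d"
    proof
      fix z :: "complex \<times> real" assume z: "z \<in> cball 0 d"
      obtain u v where uv: "z = (u, v)" by force
      show "z \<in> zero_box d"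
        using z norm_fst_le[of u v] norm_snd_le[of v u] by (simp add: uv zero_box_def)
    qed
  qed simp
  finally show ?thesis .
qed

lemma partition_function_lower_bound:
  fixes \<kappa> B c :: real
  assumes \<kappa>: "\<kappa> > 0" and B: "B > 0"
  obtains \<zeta> where "0 < \<zeta>" "\<And>N. ennreal \<zeta> \<le>
     (\<integral>\<^sup>+p. ennreal (exp (- c * pairing N N p)) * indicator (Omega_N N B) p \<partial>with_zero_mode (gauss_law \<kappa> (freqs N)))"
proof -
  obtain \<delta> where \<delta>: "0 < \<delta>" "\<And>J F. finite J \<Longrightarrow> J \<subseteq> F - {0} \<Longrightarrow>
    ennreal \<delta> \<le> (\<integral>\<^sup>+x. indicator {x. (\<Sum>k\<in>J. (cmod (x k))\<^sup>2) \<le> B\<^sup>2 / 2} x \<partial>a_law F)"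
    using small_mass_probability[of "B\<^sup>2 / 2"] B by auto
  define D where "D = exp (- (\<bar>c\<bar> * B * B\<^sup>2))"
  \<comment> \<open>A zero mode in the box of size \<open>B / 2\<close> adds at most
    \<open>B^2 / 4\<close> to the mass and the other modes at most \<open>B^2 / 2\<close>, so the
    cutoff \<open>B^2\<close> is respected.\<close>
  define V where "V = measure lborel (zero_box (B / 2))"
  have V: "emeasure lborel (zero_box (B / 2)) = ennreal V"
    using emeasure_zero_box_finite[of "B / 2"] unfolding V_def by (intro emeasure_eq_ennreal_measure) auto
  have "0 < V" using emeasure_zero_box_pos[of "B / 2"] B V by (cases "V \<le> 0") (auto simp: ennreal_neg)
  show thesis
  proof (rule that[of "D * \<delta> * V"])
    show "0 < D * \<delta> * V" using \<delta> \<open>0 < V\<close> by (simp add: D_def)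
    fix N
    let ?F = "freqs N" and ?J = "freqs N - {0}"
    let ?E = "{x. (\<Sum>k\<in>?J. (cmod (x k))\<^sup>2) \<le> B\<^sup>2 / 2}"
    have F: "\<And>n. n \<in> ?F \<Longrightarrow> - n \<in> ?F" by (rule uminus_mem_freqs)
    have inner: "ennreal D * indicator ?E x * indicator (zero_box (B / 2)) z
       \<le> (\<integral>\<^sup>+y. ennreal (exp (- c * pairing N N (modes_of ?F z x y))) * indicator (Omega_N N B) (modes_of ?F z x y) \<partial>b_law \<kappa> ?F)"
      for z x
    proof (cases "x \<in> ?E \<and> z \<in> zero_box (B / 2)")
      case True
      then have z: "cmod (fst z) \<le> B / 2" "\<bar>snd z\<bar> \<le> B / 2" by (cases z, simp add: zero_box_def)+
      let ?a = "mode_a ?F (fst z) x"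
      have "mass N ?a = (cmod (fst z))\<^sup>2 + (\<Sum>k\<in>?J. (cmod (x k))\<^sup>2)"
        unfolding mass_def by (subst sum.remove[of _ 0]) (auto simp: mode_a_def intro!: sum.cong)
      also have "\<dots> \<le> (B / 2)\<^sup>2 + B\<^sup>2 / 2" using True z by (intro add_mono power_mono) auto
      also have "\<dots> \<le> B\<^sup>2" by (simp add: power_divide)
      finally have m: "mass N ?a \<le> B\<^sup>2" .
      have z2: "\<bar>snd z\<bar> \<le> B" using z B by linarith
      have "\<bar>Re (autocorr N ?a 0)\<bar> \<le> B\<^sup>2"
        using abs_Re_le_cmod[of "autocorr N ?a 0"] norm_autocorr_le_mass[of N ?a 0] m by linarith
      then have "\<bar>c * snd z * Re (autocorr N ?a 0)\<bar> \<le> \<bar>c\<bar> * B * B\<^sup>2"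
        unfolding abs_mult using z2 B by (intro mult_mono) auto
      then have 1: "- (\<bar>c\<bar> * B * B\<^sup>2) \<le> - c * snd z * Re (autocorr N ?a 0)" by (simp add: abs_le_iff)
      have 2: "0 \<le> c\<^sup>2 / \<kappa> * (\<Sum>n\<in>{n \<in> ?F \<inter> freqs N. n \<ge> 1}. (cmod (autocorr N ?a n))\<^sup>2 / of_int n)"
        using \<kappa> by (intro mult_nonneg_nonneg sum_nonneg) auto
      have "ennreal D * indicator ?E x * indicator (zero_box (B / 2)) z = ennreal D" using True by simp
      also have "\<dots> \<le> ennreal (exp (- c * snd z * Re (autocorr N ?a 0) +
        c\<^sup>2 / \<kappa> * (\<Sum>n\<in>{n \<in> ?F \<inter> freqs N. n \<ge> 1}. (cmod (autocorr N ?a n))\<^sup>2 / of_int n)))"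
        unfolding D_def using 1 2 by (intro ennreal_leI exp_mono) linarith
      also have "\<dots> = (\<integral>\<^sup>+y. ennreal (exp (- c * pairing N N (modes_of ?F z x y))) \<partial>b_law \<kappa> ?F)"
        by (rule nn_integral_b_law_pairing[OF \<kappa> F, symmetric])
      also have "\<dots> = (\<integral>\<^sup>+y. ennreal (exp (- c * pairing N N (modes_of ?F z x y))) * indicator (Omega_N N B) (modes_of ?F z x y) \<partial>b_law \<kappa> ?F)"
        using modes_of_in_Omega_N[OF B z2 m] by simp
      finally show ?thesis .
    qed (auto simp: indicator_def)
    have mE: "(\<lambda>x. indicator ?E x :: ennreal) \<in> borel_measurable (a_law ?F)"
    proof -
      have "(\<lambda>x. \<Sum>k\<in>?J. (cmod (x k))\<^sup>2) \<in> borel_measurable (a_law ?F)"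
      proof (rule borel_measurable_sum)
        fix k assume "k \<in> ?J"
        then have "(\<lambda>x. x k) \<in> borel_measurable (a_law ?F)" by (rule measurable_a_law_component)
        then show "(\<lambda>x. (cmod (x k))\<^sup>2) \<in> borel_measurable (a_law ?F)" by measurable
      qed
      then show ?thesis by measurable
    qed
    have "ennreal (D * \<delta> * V) = (\<integral>\<^sup>+z. ennreal D * ennreal \<delta> * indicator (zero_box (B / 2)) z \<partial>lborel)"
      using \<delta> by (simp add: nn_integral_cmult_indicator V ennreal_mult' D_def)
    also have "\<dots> \<le> (\<integral>\<^sup>+z. \<integral>\<^sup>+x. ennreal D * indicator ?E x * indicator (zero_box (B / 2)) z \<partial>a_law ?F \<partial>lborel)"
    proof (rule nn_integral_mono)
      fix z :: "complex \<times> real"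
      have "(\<integral>\<^sup>+x. ennreal D * indicator ?E x * indicator (zero_box (B / 2)) z \<partial>a_law ?F)
        = ennreal D * (\<integral>\<^sup>+x. indicator ?E x \<partial>a_law ?F) * indicator (zero_box (B / 2)) z"
        using mE by (subst nn_integral_multc nn_integral_cmult; (intro borel_measurable_times_ennreal borel_measurable_const)?; simp)+
      moreover have "ennreal D * ennreal \<delta> * indicator (zero_box (B / 2)) z
         \<le> ennreal D * (\<integral>\<^sup>+x. indicator ?E x \<partial>a_law ?F) * indicator (zero_box (B / 2)) z"
        by (intro mult_right_mono mult_left_mono \<delta>(2)) auto
      ultimately show "ennreal D * ennreal \<delta> * indicator (zero_box (B / 2)) z
        \<le> (\<integral>\<^sup>+x. ennreal D * indicator ?E x * indicator (zero_box (B / 2)) z \<partial>a_law ?F)" by simp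
    qed
    also have "\<dots> \<le> (\<integral>\<^sup>+z. \<integral>\<^sup>+x. \<integral>\<^sup>+y. ennreal (exp (- c * pairing N N (modes_of ?F z x y))) *
        indicator (Omega_N N B) (modes_of ?F z x y) \<partial>b_law \<kappa> ?F \<partial>a_law ?F \<partial>lborel)"
      by (intro nn_integral_mono inner)
    also have "\<dots> = (\<integral>\<^sup>+p. ennreal (exp (- c * pairing N N p)) * indicator (Omega_N N B) p \<partial>with_zero_mode (gauss_law \<kappa> ?F))"
      by (rule nn_integral_with_zero_mode[OF \<kappa> F, symmetric]) (assumption, measurable)
    finally show "ennreal (D * \<delta> * V) \<le> (\<integral>\<^sup>+p. ennreal (exp (- c * pairing N N p)) * indicator (Omega_N N B) p
       \<partial>with_zero_mode (gauss_law \<kappa> ?F))" .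
  qed
qed

section \<open>Tail bounds for the Gibbs measures\<close>

text \<open>
  No measurability of \<open>f\<close> is assumed: if the set function defining the density is not a measure,
  then \<^const>\<open>density\<close> is the null measure.
\<close>

lemma measure_normalized_density_le:
  assumes \<zeta>: "0 < \<zeta>" "ennreal \<zeta> \<le> (\<integral>\<^sup>+x. f x \<partial>M)"
    and u: "0 \<le> u" "(\<integral>\<^sup>+x. f x * indicator A x \<partial>M) \<le> ennreal u"
  shows "measure (normalized (density M f)) A \<le> u / \<zeta>"
proof -
  let ?\<mu> = "\<lambda>A. \<integral>\<^sup>+x. f x * indicator A x \<partial>M"
  have e: "emeasure (density M f) A = (if A \<in> sets M \<and> measure_space (space M) (sets M) ?\<mu> then ?\<mu> A else 0)" for A
    unfolding density_def emeasure_measure_of_conv sets.sigma_sets_eq by simp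
  have "inverse (emeasure (density M f) (space M)) * emeasure (density M f) A \<le> ennreal (u / \<zeta>)"
  proof (cases "measure_space (space M) (sets M) ?\<mu>")
    case True
    have "?\<mu> (space M) = (\<integral>\<^sup>+x. f x \<partial>M)"
      by (intro nn_integral_cong) simp
    then have "ennreal \<zeta> \<le> emeasure (density M f) (space M)" using True \<zeta> by (simp add: e)
    then have "inverse (emeasure (density M f) (space M)) \<le> inverse (ennreal \<zeta>)"
      using \<zeta>(1) by (cases "emeasure (density M f) (space M)") (auto simp: inverse_ennreal le_imp_inverse_le)
    moreover have "emeasure (density M f) A \<le> ennreal u"
      using u(2) by (simp add: e)
    ultimately have "inverse (emeasure (density M f) (space M)) * emeasure (density M f) A \<le> inverse (ennreal \<zeta>) * ennreal u"
      by (intro mult_mono) auto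
    also have "\<dots> = ennreal (u / \<zeta>)"
      using \<zeta> u(1) by (simp add: inverse_ennreal divide_inverse mult.commute flip: ennreal_mult)
    finally show ?thesis .
  qed (simp add: e)
  then show ?thesis
    using \<zeta> u(1) by (simp add: normalized_def measure_def enn2real_leI)
qed

text \<open>For a single measure the lower bound on the mass need not be quantitative: a vanishing
  integral makes the density null, and otherwise some positive real lies below the integral, even if
  it is infinite.\<close>

lemma measure_normalized_density_le_const:
  obtains \<zeta> where "0 < \<zeta>"
    "\<And>A u. 0 \<le> u \<Longrightarrow> (\<integral>\<^sup>+x. f x * indicator A x \<partial>M) \<le> ennreal u \<Longrightarrow>
       measure (normalized (density M f)) A \<le> u / \<zeta>"
proof (cases "(\<integral>\<^sup>+x. f x \<partial>M) = 0")
  case True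
  show thesis
  proof (rule that[of 1])
    fix A and u :: real assume "0 \<le> u"
    have "emeasure (density M f) A = 0" for A
    proof -
      have "(\<integral>\<^sup>+x. f x * indicator A x \<partial>M) \<le> (\<integral>\<^sup>+x. f x \<partial>M)"
        by (intro nn_integral_mono) (auto simp: indicator_def)
      then show ?thesis
        using True unfolding density_def emeasure_measure_of_conv by simp
    qed
    then show "measure (normalized (density M f)) A \<le> u / 1"
      using \<open>0 \<le> u\<close> by (simp add: normalized_def measure_def)
  qed simp
next
  case False
  have "\<exists>\<zeta>>0. ennreal \<zeta> \<le> (\<integral>\<^sup>+x. f x \<partial>M)"
  proof (cases "\<integral>\<^sup>+x. f x \<partial>M")
    case (real \<zeta>)
    with False show ?thesis by (intro exI[of _ \<zeta>]) auto
  next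
    case top
    then show ?thesis by (intro exI[of _ 1]) simp
  qed
  then obtain \<zeta> where \<zeta>: "0 < \<zeta>" "ennreal \<zeta> \<le> (\<integral>\<^sup>+x. f x \<partial>M)" by blast
  show thesis by (rule that[OF \<zeta>(1) measure_normalized_density_le[OF \<zeta>]])
qed

text \<open>A substitute for Cauchy-Schwarz with the parameter \<open>t\<close> left free.
  Measurability is asked of the majorants \<open>S\<close> and \<open>G\<close>, which keeps
  \<open>Omega B\<close> and the full interaction out of measurability arguments.\<close>

lemma nn_integral_split_le:
  fixes t C1 C2 :: real
  assumes t: "0 < t" and C: "0 \<le> C1" "0 \<le> C2"
    and S: "S \<in> sets M" and G: "G \<in> borel_measurable M"
    and A: "\<And>p. p \<in> A \<Longrightarrow> p \<in> S"
    and fG: "\<And>p. p \<in> A \<Longrightarrow> ennreal (exp (- (2 * v p))) \<le> G p"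
    and C1: "(\<integral>\<^sup>+p. indicator S p \<partial>M) \<le> ennreal C1" and C2: "(\<integral>\<^sup>+p. G p \<partial>M) \<le> ennreal C2"
  shows "(\<integral>\<^sup>+p. ennreal (exp (- v p)) * indicator A p \<partial>M) \<le> ennreal (t * C1 + C2 / t)"
proof -
  have "ennreal (exp (- v p)) * indicator A p \<le> ennreal t * indicator S p + ennreal (1 / t) * G p" for p
  proof (cases "p \<in> A")
    case True
    define w where "w = exp (- v p)"
    have w: "0 \<le> w" "exp (- (2 * v p)) = w\<^sup>2" by (auto simp: w_def simp flip: exp_double)
    have "t * w \<le> t\<^sup>2 + w\<^sup>2" 
    proof -
      have "2 * t * w \<le> t\<^sup>2 + w\<^sup>2" by (rule sum_squares_bound)
      moreover have "0 \<le> t * w" using t w by simp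
      ultimately show ?thesis by linarith
    qed
    then have "w \<le> t + 1 / t * w\<^sup>2" using t by (simp add: field_simps power2_eq_square)
    then have "ennreal w \<le> ennreal (t + 1 / t * w\<^sup>2)" by (rule ennreal_leI)
    also have "\<dots> = ennreal t + ennreal (1 / t) * ennreal (w\<^sup>2)"
      using t w by (simp only: ennreal_plus ennreal_mult zero_le_divide_1_iff zero_le_power less_imp_le mult_nonneg_nonneg)
    also have "\<dots> \<le> ennreal t + ennreal (1 / t) * G p"
      using fG[OF True] w by (intro add_left_mono mult_left_mono) auto
    finally show ?thesis using True A[OF True] by (simp add: w_def)
  qed simp
  then have "(\<integral>\<^sup>+p. ennreal (exp (- v p)) * indicator A p \<partial>M)
    \<le> (\<integral>\<^sup>+p. ennreal t * indicator S p + ennreal (1 / t) * G p \<partial>M)"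
    by (intro nn_integral_mono)
  also have "\<dots> = ennreal t * (\<integral>\<^sup>+p. indicator S p \<partial>M) + ennreal (1 / t) * (\<integral>\<^sup>+p. G p \<partial>M)"
    using S G by (simp add: nn_integral_add nn_integral_cmult)
  also have "\<dots> \<le> ennreal t * ennreal C1 + ennreal (1 / t) * ennreal C2"
    using C1 C2 by (intro add_mono mult_left_mono) auto
  also have "\<dots> = ennreal (t * C1 + C2 / t)"
    using t C by (simp add: divide_inverse mult.commute flip: ennreal_mult ennreal_plus)
  finally show ?thesis .
qed

text \<open>Fatou's lemma is applied twice, in the order of the iterated limit. The summand
  \<open>1\<close> that covers divergent series appears as the indicator of
  \<open>zero_mode_bounded B\<close>, because the constant \<open>1\<close> need not be integrable
  over an unbounded zero mode.\<close>

lemma exp_interaction_bound: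
  fixes \<kappa> B c C :: real
  assumes C: "0 \<le> C" "\<And>M L. (\<integral>\<^sup>+p. ennreal (exp (- c * pairing M L p)) * indicator (cutoff B L) p \<partial>W) \<le> ennreal C"
    and Z: "(\<integral>\<^sup>+p. indicator (zero_mode_bounded B) p \<partial>W) \<le> ennreal V" "0 \<le> V"
    and W: "sets W = sets modes_space"
  obtains G where "G \<in> borel_measurable W" "(\<integral>\<^sup>+p. G p \<partial>W) \<le> ennreal (V + C)"
    "\<And>p. p \<in> Omega B \<Longrightarrow> ennreal (exp (- c * interaction p)) \<le> G p"
proof -
  note [measurable_cong] = W
  let ?h = "\<lambda>M L p. ennreal (exp (- c * pairing M L p)) * indicator (cutoff B L) p"
  define G where "G p = indicator (zero_mode_bounded B) p + liminf (\<lambda>M. liminf (\<lambda>L. ?h M L p))" for p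
  show thesis
  proof (rule that[of G])
    show "G \<in> borel_measurable W" unfolding G_def by measurable
    have "(\<integral>\<^sup>+p. liminf (\<lambda>L. ?h M L p) \<partial>W) \<le> ennreal C" for M
    proof -
      have "(\<integral>\<^sup>+p. liminf (\<lambda>L. ?h M L p) \<partial>W) \<le> liminf (\<lambda>L. \<integral>\<^sup>+p. ?h M L p \<partial>W)"
        by (intro nn_integral_liminf) measurable
      also have "\<dots> \<le> liminf (\<lambda>L. ennreal C)"
        by (intro Liminf_mono always_eventually allI C)
      finally show ?thesis by (simp add: Liminf_const)
    qed
    note inner = this
    have "(\<integral>\<^sup>+p. liminf (\<lambda>M. liminf (\<lambda>L. ?h M L p)) \<partial>W) \<le> liminf (\<lambda>M. \<integral>\<^sup>+p. liminf (\<lambda>L. ?h M L p) \<partial>W)"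
      by (intro nn_integral_liminf) measurable
    also have "\<dots> \<le> liminf (\<lambda>M. ennreal C)"
      by (intro Liminf_mono always_eventually allI inner)
    finally have "(\<integral>\<^sup>+p. liminf (\<lambda>M. liminf (\<lambda>L. ?h M L p)) \<partial>W) \<le> ennreal C" by (simp add: Liminf_const)
    moreover have "(\<integral>\<^sup>+p. G p \<partial>W) = (\<integral>\<^sup>+p. indicator (zero_mode_bounded B) p \<partial>W)
        + (\<integral>\<^sup>+p. liminf (\<lambda>M. liminf (\<lambda>L. ?h M L p)) \<partial>W)"
      unfolding G_def by (intro nn_integral_add) measurable
    ultimately show "(\<integral>\<^sup>+p. G p \<partial>W) \<le> ennreal (V + C)"
      using Z C(1) by (auto simp: ennreal_plus intro: add_mono)
    fix p assume p: "p \<in> Omega B"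
    then have summ: "(\<lambda>n. (cmod (fst p n))\<^sup>2) summable_on UNIV"
      and le: "sqrt (\<Sum>\<^sub>\<infinity>n. (cmod (fst p n))\<^sup>2) \<le> B" and b: "cmod (snd p 0) \<le> B"
      by (auto simp: Omega_def split_beta)
    have mass: "mass L (fst p) \<le> B\<^sup>2" for L
    proof -
      have "mass L (fst p) \<le> (\<Sum>\<^sub>\<infinity>n. (cmod (fst p n))\<^sup>2)"
        unfolding mass_def by (intro finite_sum_le_infsum summ) auto
      also have "\<dots> \<le> B\<^sup>2" using le by (rule sqrt_le_D)
      finally show ?thesis .
    qed
    then have cut: "p \<in> cutoff B L" for L using b by (simp add: cutoff_def)
    have "(cmod (fst p 0))\<^sup>2 \<le> B\<^sup>2" using mass[of 0] by (simp add: mass_def freqs_def)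
    moreover have "0 \<le> B" using b norm_ge_zero order_trans by blast
    ultimately have "cmod (fst p 0) \<le> B" by (rule power2_le_imp_le)
    then have "p \<in> zero_mode_bounded B" using b by (simp add: zero_mode_bounded_def)
    then show "ennreal (exp (- c * interaction p)) \<le> G p"
      using exp_interaction_le_liminf[OF summ, of c] cut by (simp add: G_def)
  qed
qed

lemma Omega_N_subset_zero_mode_bounded:
  assumes "0 < B" "p \<in> Omega_N N B" shows "p \<in> zero_mode_bounded B"
proof -
  from Omega_N_subset_cutoff[OF assms(2)] have p: "cmod (snd p 0) \<le> B" "mass N (fst p) \<le> B\<^sup>2"
    by (auto simp: cutoff_def)
  have "(cmod (fst p 0))\<^sup>2 \<le> mass N (fst p)"
    unfolding mass_def by (rule member_le_sum) auto
  then have "(cmod (fst p 0))\<^sup>2 \<le> B\<^sup>2" using p by linarith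
  then have "cmod (fst p 0) \<le> B" using assms(1) by (rule power2_le_imp_le[OF _ less_imp_le])
  then show ?thesis using p by (simp add: zero_mode_bounded_def)
qed

lemma Omega_subset_zero_mode_bounded:
  assumes "0 < B" "p \<in> Omega B" shows "p \<in> zero_mode_bounded B"
proof -
  have summ: "(\<lambda>n. (cmod (fst p n))\<^sup>2) summable_on UNIV"
    and le: "sqrt (\<Sum>\<^sub>\<infinity>n. (cmod (fst p n))\<^sup>2) \<le> B" and b: "cmod (snd p 0) \<le> B"
    using assms(2) by (auto simp: Omega_def split_beta)
  have "(cmod (fst p 0))\<^sup>2 = (\<Sum>n\<in>{0}. (cmod (fst p n))\<^sup>2)" by simp
  also have "\<dots> \<le> (\<Sum>\<^sub>\<infinity>n. (cmod (fst p n))\<^sup>2)"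
    by (intro finite_sum_le_infsum summ) auto
  also have "\<dots> \<le> B\<^sup>2" using le by (rule sqrt_le_D)
  finally have "cmod (fst p 0) \<le> B" using assms(1) by (rule power2_le_imp_le[OF _ less_imp_le])
  then show ?thesis using b by (simp add: zero_mode_bounded_def)
qed

lemma zero_mode_bounded_finite:
  assumes \<kappa>: "\<kappa> > 0"
  obtains V where "0 \<le> V" "\<And>F. (\<And>n. n \<in> F \<Longrightarrow> - n \<in> F) \<Longrightarrow>
    (\<integral>\<^sup>+p. indicator (zero_mode_bounded B) p \<partial>with_zero_mode (gauss_law \<kappa> F)) \<le> ennreal V"
proof (rule that[of "measure lborel (zero_box B)"])
  fix F :: "int set" assume F: "\<And>n. n \<in> F \<Longrightarrow> - n \<in> F"
  interpret A: prob_space "a_law F" by (rule prob_space_a_law)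
  interpret B: prob_space "b_law \<kappa> F" by (rule prob_space_b_law[OF \<kappa>])
  have "(\<integral>\<^sup>+p. indicator (zero_mode_bounded B) p \<partial>with_zero_mode (gauss_law \<kappa> F))
    = (\<integral>\<^sup>+z. \<integral>\<^sup>+x. \<integral>\<^sup>+y. indicator (zero_mode_bounded B) (modes_of F z x y) \<partial>b_law \<kappa> F \<partial>a_law F \<partial>lborel)"
    by (rule nn_integral_with_zero_mode[OF \<kappa> F]) (assumption, measurable)
  also have "\<dots> = (\<integral>\<^sup>+z. indicator (zero_box B) z \<partial>lborel)"
    by (simp add: indicator_def zero_mode_bounded_modes_of A.emeasure_space_1 B.emeasure_space_1)
  also have "\<dots> = ennreal (measure lborel (zero_box B))"
    using emeasure_zero_box_finite[of B] by (simp add: emeasure_eq_ennreal_measure)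
  finally show "(\<integral>\<^sup>+p. indicator (zero_mode_bounded B) p \<partial>with_zero_mode (gauss_law \<kappa> F)) \<le> ennreal (measure lborel (zero_box B))"
    by simp
qed simp

text \<open>Half of the decay rate is spent on the constant: for these \<open>K\<close>,
  \<open>C \<le> c * K \<le> exp (c * K\<^sup>2)\<close>.\<close>

lemma mult_exp_le_exp:
  fixes C c K :: real
  assumes "0 < c" "0 \<le> C" "1 + C / c \<le> K"
  shows "C * exp (- (2 * c) * K\<^sup>2) \<le> exp (- c * K\<^sup>2)"
proof -
  have K: "1 \<le> K" "C / c \<le> K" using assms by (auto intro: order_trans[rotated])
  then have "C \<le> c * K" using assms by (simp add: field_simps)
  also have "\<dots> \<le> c * K\<^sup>2" using K assms by (simp add: power2_eq_square)
  also have "\<dots> \<le> exp (c * K\<^sup>2)" using exp_ge_add_one_self[of "c * K\<^sup>2"] by linarith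
  finally have "C * exp (- (2 * c) * K\<^sup>2) \<le> exp (c * K\<^sup>2) * exp (- (2 * c) * K\<^sup>2)"
    by (intro mult_right_mono) auto
  also have "\<dots> = exp (- c * K\<^sup>2)" by (simp flip: exp_add)
  finally show ?thesis .
qed

theorem corollary4p6:
  shows "\<exists>\<delta>>0. \<forall>(\<alpha>::real) (\<beta>::real) (\<gamma>::real) (\<kappa>::real) (B::real) (s1::real) (s2::real).
    \<alpha> \<noteq> 0 \<and> \<beta> \<noteq> 0 \<and> \<gamma> \<noteq> 0 \<and> \<kappa> = - ((\<alpha> * \<gamma>) / (2 * \<beta>)) \<and> \<kappa> > 0 \<and> B > 0 \<and>
    0 < s1 \<and> 1/2 - \<delta> < s1 \<and> s1 < 1/2 \<and>
    1/2 < s2 \<and> 1 - \<delta> < s2 \<and> s2 < 1 \<and> s2 < 2 * s1 \<longrightarrow>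
    (\<exists>c>0. \<exists>K0>0. \<forall>K\<ge>K0.
       (\<forall>N. measure (mu_N \<alpha> \<kappa> B N) (Omega_N N B - Omega_N_ball N B s1 s2 K)
              \<le> exp (- c * K\<^sup>2)) \<and>
       measure (mu \<alpha> \<kappa> B) (Omega B - Omega_ball B s1 s2 K) \<le> exp (- c * K\<^sup>2))"
proof (rule exI[of _ 1], intro conjI allI impI)
  fix \<alpha> \<beta> \<gamma> \<kappa> B s1 s2 :: real
  assume H: "\<alpha> \<noteq> 0 \<and> \<beta> \<noteq> 0 \<and> \<gamma> \<noteq> 0 \<and> \<kappa> = - ((\<alpha> * \<gamma>) / (2 * \<beta>)) \<and> \<kappa> > 0 \<and> B > 0 \<and>
    0 < s1 \<and> 1/2 - 1 < s1 \<and> s1 < 1/2 \<and>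
    1/2 < s2 \<and> 1 - 1 < s2 \<and> s2 < 1 \<and> s2 < 2 * s1"
  then have \<kappa>: "\<kappa> > 0" and B: "B > 0" and s: "s1 < 1/2" "s2 < 1" by auto
  \<comment> \<open>The second entry is the midpoint of \<open>s1 + 1/2\<close> and
    \<open>1\<close>, so \<open>r\<close> exceeds \<open>s1 + 1/2\<close>, dominates
    \<open>s2\<close> and stays below \<open>1\<close>.\<close>
  define r where "r = max s2 (s1 / 2 + 3 / 4)"
  have "s1 / 2 + 3 / 4 \<le> r" by (simp add: r_def)
  then have "s1 - r < - 1 / 2" using s by linarith
  then have r: "s2 \<le> r" "s1 - r < - 1 / 2" "r < 1" using s by (auto simp: r_def)
  \<comment> \<open>The ratio between the norm threshold and the supremum threshold: a norm above
    \<open>K\<close> forces a weighted supremum above \<open>K / D\<close>, called \<open>L\<close>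
    below.\<close>
  define D where "D = 2 * (1 + sqrt (\<Sum>\<^sub>\<infinity>n\<in>UNIV. jbracket n powr (2 * (s1 - r))))"
  have D: "2 \<le> D" unfolding D_def by (simp add: infsum_nonneg)
  obtain c1 C1 where c1: "0 < c1" "0 \<le> C1" "\<And>F K. (\<And>n. n \<in> F \<Longrightarrow> - n \<in> F) \<Longrightarrow> 1 \<le> K \<Longrightarrow>
     (\<integral>\<^sup>+p. indicator (sup_large r K \<inter> zero_mode_bounded B) p \<partial>with_zero_mode (gauss_law \<kappa> F))
       \<le> ennreal (C1 * exp (- c1 * K\<^sup>2))"
    by (rule sup_large_tail[OF \<kappa> r(3), of B]) blast
  \<comment> \<open>Taken with \<open>\<alpha>\<close> because this is the moment of the squared
    Gibbs weight.\<close>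
  obtain C2 where C2: "0 \<le> C2" "\<And>F M L. (\<And>n. n \<in> F \<Longrightarrow> - n \<in> F) \<Longrightarrow>
     (\<integral>\<^sup>+p. ennreal (exp (- \<alpha> * pairing M L p)) * indicator (cutoff B L) p \<partial>with_zero_mode (gauss_law \<kappa> F)) \<le> ennreal C2"
    by (rule exp_pairing_bound[OF \<kappa> B, of \<alpha>]) blast
  obtain V where V: "0 \<le> V" "\<And>F. (\<And>n. n \<in> F \<Longrightarrow> - n \<in> F) \<Longrightarrow>
    (\<integral>\<^sup>+p. indicator (zero_mode_bounded B) p \<partial>with_zero_mode (gauss_law \<kappa> F)) \<le> ennreal V"
    by (rule zero_mode_bounded_finite[OF \<kappa>, of B]) blast
  obtain \<zeta>1 where \<zeta>1: "0 < \<zeta>1" "\<And>N. ennreal \<zeta>1 \<le>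
     (\<integral>\<^sup>+p. ennreal (exp (- (\<alpha> / 2) * pairing N N p)) * indicator (Omega_N N B) p \<partial>with_zero_mode (gauss_law \<kappa> (freqs N)))"
    by (rule partition_function_lower_bound[OF \<kappa> B, of "\<alpha> / 2"]) blast
  let ?W = "\<lambda>F. with_zero_mode (gauss_law \<kappa> F)"
  let ?f = "\<lambda>p. ennreal (exp (- (\<alpha> / 2) * interaction p)) * indicator (Omega B) p"
  obtain \<zeta>2 where \<zeta>2: "0 < \<zeta>2" "\<And>A u. 0 \<le> u \<Longrightarrow> (\<integral>\<^sup>+p. ?f p * indicator A p \<partial>?W UNIV) \<le> ennreal u \<Longrightarrow>
       measure (normalized (density (?W UNIV) ?f)) A \<le> u / \<zeta>2"
    by (rule measure_normalized_density_le_const[of "?W UNIV" ?f]) blast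
  define \<zeta> where "\<zeta> = min \<zeta>1 \<zeta>2"
  have \<zeta>: "0 < \<zeta>" "\<zeta> \<le> \<zeta>1" "\<zeta> \<le> \<zeta>2" using \<zeta>1 \<zeta>2 by (auto simp: \<zeta>_def)
  have sets: "sets (?W F) = sets modes_space" for F by (simp add: with_zero_mode_def)
  define C where "C = C1 + (V + C2)"
  have C: "0 \<le> C" using c1 C2 V by (simp add: C_def)
  \<comment> \<open>The balanced bound decays like \<open>exp (- (c1 / 2) * L\<^sup>2)\<close>,
    which is \<open>exp (- 2 * c * K\<^sup>2)\<close> for this \<open>c\<close>; the spare factor
    \<open>2\<close> later absorbs the constant \<open>C / \<zeta>\<close>.\<close>
  define c where "c = c1 / (4 * D\<^sup>2)"
  have c: "0 < c" using c1 D by (simp add: c_def)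
  \<comment> \<open>The term \<open>D * (1 + B)\<close> ensures \<open>1 \<le> L\<close> and
    \<open>B \<le> L\<close>; the terms \<open>1\<close> and \<open>C / \<zeta> / c\<close> are what
    \<open>mult_exp_le_exp\<close> asks for.\<close>
  define K0 where "K0 = 1 + D * (1 + B) + C / \<zeta> / c"
  have K0: "0 < K0" using C c \<zeta> D B by (simp add: K0_def add_pos_nonneg)
  show "\<exists>c>0. \<exists>K0>0. \<forall>K\<ge>K0.
       (\<forall>N. measure (mu_N \<alpha> \<kappa> B N) (Omega_N N B - Omega_N_ball N B s1 s2 K)
              \<le> exp (- c * K\<^sup>2)) \<and>
       measure (mu \<alpha> \<kappa> B) (Omega B - Omega_ball B s1 s2 K) \<le> exp (- c * K\<^sup>2)"
  proof (rule exI[of _ c], intro conjI c exI[of _ K0] K0 allI impI)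
    fix K assume K: "K0 \<le> K"
    have pos: "0 \<le> D * (1 + B)" "0 \<le> C / \<zeta> / c" using C c \<zeta> D B by auto
    define L where "L = K / D"
    have "D * (1 + B) \<le> K" using K pos by (simp add: K0_def)
    then have "1 + B \<le> L" using D by (simp add: L_def pos_le_divide_eq mult.commute)
    then have L: "1 \<le> L" "B \<le> L" using B by auto
    have DL: "D * L = K" using D by (simp add: L_def)
    \<comment> \<open>This value equalizes the two terms of the splitting:
      \<open>t * exp (- c1 * L\<^sup>2) = 1 / t\<close>.\<close>
    define t where "t = exp (c1 / 2 * L\<^sup>2)"
    define u where "u = C * exp (- (2 * c) * K\<^sup>2)"
    have cK: "2 * c * K\<^sup>2 = c1 / 2 * L\<^sup>2" using D by (simp add: c_def L_def power_divide)
    have t: "0 < t" by (simp add: t_def)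
    have u0: "0 \<le> u" using C by (simp add: u_def)
    have u: "t * (C1 * exp (- c1 * L\<^sup>2)) + (V + C2) / t = u"
    proof -
      have "t * exp (- c1 * L\<^sup>2) = exp (- (2 * c * K\<^sup>2))"
        unfolding cK t_def by (simp flip: exp_add)
      moreover have "1 / t = exp (- (2 * c * K\<^sup>2))"
        unfolding cK t_def by (simp add: exp_minus inverse_eq_divide)
      moreover have "t * (C1 * exp (- c1 * L\<^sup>2)) + (V + C2) / t = C1 * (t * exp (- c1 * L\<^sup>2)) + (V + C2) * (1 / t)"
        by simp
      ultimately show ?thesis by (simp add: u_def C_def distrib_right)
    qed
    have "1 + C / \<zeta> / c \<le> K" using K pos by (simp add: K0_def)
    from mult_exp_le_exp[OF c _ this] C \<zeta>
    have fin: "u / \<zeta> \<le> exp (- c * K\<^sup>2)" by (simp add: u_def)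
    have S: "sup_large r L \<inter> zero_mode_bounded B \<in> sets (?W F)" for F
      by (simp add: sets sets.Int sup_large_sets zero_mode_bounded_sets)
    have ball: "in_HH s1 s2 p \<and> HH_norm s1 s2 p \<le> K"
      if "p \<notin> sup_large r L" "p \<in> zero_mode_bounded B" "real_valued (snd p)" for p
      using not_sup_large_HH_norm[OF that(1,2) L(2) _ that(3) r(1,2)] L DL by (simp add: D_def)
    show "measure (mu_N \<alpha> \<kappa> B N) (Omega_N N B - Omega_N_ball N B s1 s2 K) \<le> exp (- c * K\<^sup>2)" for N
    proof -
      let ?A = "Omega_N N B - Omega_N_ball N B s1 s2 K"
      have F: "\<And>n. n \<in> freqs N \<Longrightarrow> - n \<in> freqs N" by (rule uminus_mem_freqs)
      let ?G = "\<lambda>p. ennreal (exp (- \<alpha> * pairing N N p)) * indicator (cutoff B N) p"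
      let ?g = "\<lambda>p. ennreal (exp (- (\<alpha> / 2) * pairing N N p)) * indicator (Omega_N N B) p"
      have "(\<integral>\<^sup>+p. ?g p * indicator ?A p \<partial>?W (freqs N))
         = (\<integral>\<^sup>+p. ennreal (exp (- (\<alpha> / 2 * pairing N N p))) * indicator ?A p \<partial>?W (freqs N))"
        by (intro nn_integral_cong) (auto simp: indicator_def)
      also have "\<dots> \<le> ennreal (t * (C1 * exp (- c1 * L\<^sup>2)) + (V + C2) / t)"
      proof (rule nn_integral_split_le[where G = ?G and S = "sup_large r L \<inter> zero_mode_bounded B"])
        fix p assume p: "p \<in> ?A"
        then have "real_valued (snd p)" "\<not> (in_HH s1 s2 p \<and> HH_norm s1 s2 p \<le> K)"
          by (auto simp: Omega_N_def Omega_N_ball_def split_beta)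
        moreover have "p \<in> zero_mode_bounded B"
          using p B by (intro Omega_N_subset_zero_mode_bounded) auto
        ultimately show "p \<in> sup_large r L \<inter> zero_mode_bounded B" using ball by blast
        show "ennreal (exp (- (2 * (\<alpha> / 2 * pairing N N p)))) \<le> ?G p"
          using p Omega_N_subset_cutoff[of p N B] by simp
      next
        have "?G \<in> borel_measurable modes_space" by measurable
        then show "?G \<in> borel_measurable (?W (freqs N))" using sets by (simp cong: measurable_cong_sets)
      next
        have "(\<integral>\<^sup>+p. ?G p \<partial>?W (freqs N)) \<le> ennreal C2" by (rule C2(2)[OF F])
        also have "\<dots> \<le> ennreal (V + C2)" using V(1) by (intro ennreal_leI) simp
        finally show "(\<integral>\<^sup>+p. ?G p \<partial>?W (freqs N)) \<le> ennreal (V + C2)" .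
      next
        show "(\<integral>\<^sup>+p. indicator (sup_large r L \<inter> zero_mode_bounded B) p \<partial>?W (freqs N)) \<le> ennreal (C1 * exp (- c1 * L\<^sup>2))"
          by (rule c1(3)[OF F L(1)])
      qed (use t c1 V C2 S in auto)
      finally have "(\<integral>\<^sup>+p. ?g p * indicator ?A p \<partial>?W (freqs N)) \<le> ennreal u" by (simp only: u)
      from measure_normalized_density_le[OF \<zeta>1(1) \<zeta>1(2) u0 this]
      have "measure (normalized (density (?W (freqs N)) ?g)) ?A \<le> u / \<zeta>1" .
      also have "\<dots> \<le> u / \<zeta>" using \<zeta> u0 by (intro divide_left_mono) auto
      also have "normalized (density (?W (freqs N)) ?g) = mu_N \<alpha> \<kappa> B N"
        by (simp add: mu_N_def rho_N_eq_gauss_law[OF \<kappa>] interaction_N_eq_pairing)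
      finally show ?thesis using fin by simp
    qed
    show "measure (mu \<alpha> \<kappa> B) (Omega B - Omega_ball B s1 s2 K) \<le> exp (- c * K\<^sup>2)"
    proof -
      let ?A = "Omega B - Omega_ball B s1 s2 K"
      have bd: "(\<integral>\<^sup>+p. ennreal (exp (- \<alpha> * pairing M L p)) * indicator (cutoff B L) p \<partial>?W UNIV) \<le> ennreal C2" for M L
        by (rule C2(2)) simp
      have bV: "(\<integral>\<^sup>+p. indicator (zero_mode_bounded B) p \<partial>?W UNIV) \<le> ennreal V" by (rule V(2)) simp
      obtain G where G: "G \<in> borel_measurable (?W UNIV)" "(\<integral>\<^sup>+p. G p \<partial>?W UNIV) \<le> ennreal (V + C2)"
        "\<And>p. p \<in> Omega B \<Longrightarrow> ennreal (exp (- \<alpha> * interaction p)) \<le> G p"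
        by (rule exp_interaction_bound[OF C2(1) bd bV V(1) sets]) blast
      have "(\<integral>\<^sup>+p. ?f p * indicator ?A p \<partial>?W UNIV)
         = (\<integral>\<^sup>+p. ennreal (exp (- (\<alpha> / 2 * interaction p))) * indicator ?A p \<partial>?W UNIV)"
        by (intro nn_integral_cong) (auto simp: indicator_def)
      also have "\<dots> \<le> ennreal (t * (C1 * exp (- c1 * L\<^sup>2)) + (V + C2) / t)"
      proof (rule nn_integral_split_le[where G = G and S = "sup_large r L \<inter> zero_mode_bounded B"])
        fix p assume p: "p \<in> ?A"
        then have "real_valued (snd p)" "\<not> (in_HH s1 s2 p \<and> HH_norm s1 s2 p \<le> K)"
          by (auto simp: Omega_def Omega_ball_def split_beta)
        moreover have "p \<in> zero_mode_bounded B"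
          using p B by (intro Omega_subset_zero_mode_bounded) auto
        ultimately show "p \<in> sup_large r L \<inter> zero_mode_bounded B" using ball by blast
        show "ennreal (exp (- (2 * (\<alpha> / 2 * interaction p)))) \<le> G p"
          using p G(3)[of p] by simp
      next
        show "(\<integral>\<^sup>+p. indicator (sup_large r L \<inter> zero_mode_bounded B) p \<partial>?W UNIV) \<le> ennreal (C1 * exp (- c1 * L\<^sup>2))"
          by (rule c1(3)[OF _ L(1)]) simp
      qed (use t c1 V C2 S G in auto)
      finally have "(\<integral>\<^sup>+p. ?f p * indicator ?A p \<partial>?W UNIV) \<le> ennreal u" by (simp only: u)
      from \<zeta>2(2)[OF u0 this]
      have "measure (normalized (density (?W UNIV) ?f)) ?A \<le> u / \<zeta>2" .
      also have "\<dots> \<le> u / \<zeta>" using \<zeta> u0 by (intro divide_left_mono) auto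
      also have "normalized (density (?W UNIV) ?f) = mu \<alpha> \<kappa> B"
        by (simp add: mu_def rho_eq_gauss_law)
      finally show ?thesis using fin by simp
    qed
  qed
qed simp

end
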